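(* Let $X$ be a spectrally negative L\'evy process, let $\omega:\mathbb{R}\to[0,\infty)$ be measurable and locally bounded, and let $\mathcal{W}^{(\omega)}(\cdot)$ and $\mathcal{W}^{(\omega)}(\cdot,\cdot)$ be the associated $\omega$-scale functions. Let $c>0$. Then for $x,y\in[0,c]$, $$\int_0^\infty\mathbb{E}_x\left[\exp\left(-\int_0^t\omega(X_s)\,ds\right);\ t<\tau_0^-\wedge\tau_c^+,\ X_t\in dy\right]dt=\left(\frac{\mathcal{W}^{(\omega)}(x)}{\mathcal{W}^{(\omega)}(c)}\,\mathcal{W}^{(\omega)}(c,y)-\mathcal{W}^{(\omega)}(x,y)\right)dy,$$ as an identity of measures in $dy$ on $[0,c]$.
   Context: $X=\{X_t,t\ge 0\}$ is a spectrally negative L\'evy process (a c\`adl\`ag process with stationary independent increments and no positive jumps) that is not the negative of a subordinator. Its Laplace exponent $\psi$, defined by $\mathbb{E}[e^{\theta X_t}]=e^{t\psi(\theta)}$ for $\theta\ge 0$, is continuous and strictly convex on $[0,\infty)$ and tends to $\infty$ at $\infty$. $\mathbb{P}_x$ is the law of $X$ with $X_0=x$, and $\mathbb{E}_x$ its expectation. $\mathbb{E}[\,\cdot\,;A]$ means $\mathbb{E}[\,\cdot\,\mathbf 1_A]$. $\Phi(\theta)=\inf\{s>0:\psi(s)>\theta\}$, $\theta\ge0$. For $q\ge 0$ the scale function $W^{(q)}:\mathbb{R}\to[0,\infty)$ vanishes on $(-\infty,0)$, is continuous and increasing on $[0,\infty)$, and satisfies $\int_0^\infty e^{-\theta y}W^{(q)}(y)\,dy=1/(\psi(\theta)-q)$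 for $\theta>\Phi(q)$. $W:=W^{(0)}$. First passage times: $\tau_z^-=\inf\{t>0:X_t<z\}$, $\tau_c^+=\inf\{t>0:X_t>c\}$, with $\inf\emptyset=\infty$. For each $y\in\mathbb{R}$, $\mathcal{W}^{(\omega)}(\cdot,y)$ is the unique locally bounded function on $\mathbb{R}$ satisfying $\mathcal{W}^{(\omega)}(x,y)=W(x-y)+\int_y^x W(x-z)\omega(z)\mathcal{W}^{(\omega)}(z,y)\,dz$ (so $\mathcal{W}^{(\omega)}(x,y)=0$ for $x<y$), and $\mathcal{W}^{(\omega)}(x):=\mathcal{W}^{(\omega)}(x,0)$. *)

theory Defs
  imports "HOL-Probability.Probability"
begin

section \<open>Spectrally negative Levy processes\<close>

definition cadlag :: "(real \<Rightarrow> real) \<Rightarrow> bool" where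
  "cadlag f \<longleftrightarrow>
     (\<forall>t\<ge>0. (f \<longlongrightarrow> f t) (at_right t)) \<and> (\<forall>t>0. \<exists>l. (f \<longlongrightarrow> l) (at_left t))"

definition no_positive_jumps :: "(real \<Rightarrow> real) \<Rightarrow> bool" where
  "no_positive_jumps f \<longleftrightarrow> (\<forall>t>0. \<forall>l. (f \<longlongrightarrow> l) (at_left t) \<longrightarrow> f t \<le> l)"

text \<open>Time is the half-line \<open>t \<ge> 0\<close>; the values of \<open>X\<close> at negative times are irrelevant.\<close>

locale levy_process = prob_space M for M :: "'a measure" +
  fixes X :: "real \<Rightarrow> 'a \<Rightarrow> real"
  assumes random_variable_X: "\<And>t. 0 \<le> t \<Longrightarrow> X t \<in> borel_measurable M"
    and X_zero: "AE w in M. X 0 w = 0"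
    and cadlag_paths: "\<And>w. w \<in> space M \<Longrightarrow> cadlag (\<lambda>t. X t w)"
    and independent_increments:
      "\<And>(t :: nat \<Rightarrow> real) n. 0 \<le> t 0 \<Longrightarrow> (\<And>i. i < n \<Longrightarrow> t i \<le> t (Suc i)) \<Longrightarrow>
         indep_vars (\<lambda>_. borel) (\<lambda>i w. X (t (Suc i)) w - X (t i) w) {..<n}"
    and stationary_increments:
      "\<And>s t. 0 \<le> s \<Longrightarrow> 0 \<le> t \<Longrightarrow>
         distr M borel (\<lambda>w. X (s + t) w - X s w) = distr M borel (X t)"

text \<open>The negative of a subordinator is a Levy process with almost surely non-increasing
  paths.\<close>

locale spectrally_negative_levy_process = levy_process M X
  for M :: "'a measure" and X :: "real \<Rightarrow> 'a \<Rightarrow> real" +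
  assumes AE_no_positive_jumps: "AE w in M. no_positive_jumps (\<lambda>t. X t w)"
    and not_negative_subordinator:
      "\<not> (AE w in M. \<forall>s t. 0 \<le> s \<longrightarrow> s \<le> t \<longrightarrow> X t w \<le> X s w)"

text \<open>As the right-hand side is nonzero and non-integrable functions have integral zero, the
  equation includes the finiteness of the exponential moments.\<close>

definition is_laplace_exponent ::
  "'a measure \<Rightarrow> (real \<Rightarrow> 'a \<Rightarrow> real) \<Rightarrow> (real \<Rightarrow> real) \<Rightarrow> bool" where
  "is_laplace_exponent M X \<psi> \<longleftrightarrow>
     (\<forall>t\<ge>0. \<forall>\<theta>\<ge>0. (LINT w|M. exp (\<theta> * X t w)) = exp (t * \<psi> \<theta>))"


section \<open>Scale functions\<close>

definition right_inverse :: "(real \<Rightarrow> real) \<Rightarrow> real \<Rightarrow> real" where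
  "right_inverse \<psi> q = Inf {s. 0 < s \<and> q < \<psi> s}"

definition is_scale_function :: "(real \<Rightarrow> real) \<Rightarrow> real \<Rightarrow> (real \<Rightarrow> real) \<Rightarrow> bool" where
  "is_scale_function \<psi> q W \<longleftrightarrow>
     (\<forall>x. 0 \<le> W x) \<and> (\<forall>x<0. W x = 0) \<and>
     continuous_on {0..} W \<and> mono_on {0..} W \<and>
     (\<forall>\<theta>>right_inverse \<psi> q.
        set_integrable lborel {0..} (\<lambda>y. exp (- \<theta> * y) * W y) \<and>
        (LINT y:{0..}|lborel. exp (- \<theta> * y) * W y) = 1 / (\<psi> \<theta> - q))"

definition locally_bounded :: "(real \<Rightarrow> real) \<Rightarrow> bool" where
  "locally_bounded f \<longleftrightarrow> (\<forall>K. compact K \<longrightarrow> bounded (f ` K))"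

text \<open>Here \<open>W\<close> is the 0-scale function. Measurability is implicit on paper, where the integral
  is taken to make sense; without it the Bochner integral would default to zero.
  The interval integral is oriented, and for \<open>x < y\<close> both terms vanish.\<close>

definition is_omega_scale_function ::
  "(real \<Rightarrow> real) \<Rightarrow> (real \<Rightarrow> real) \<Rightarrow> (real \<Rightarrow> real \<Rightarrow> real) \<Rightarrow> bool" where
  "is_omega_scale_function W \<omega> \<W> \<longleftrightarrow>
     (\<forall>y. (\<lambda>x. \<W> x y) \<in> borel_measurable borel \<and> locally_bounded (\<lambda>x. \<W> x y) \<and>
        (\<forall>x. \<W> x y = W (x - y) + (LBINT z=y..x. W (x - z) * \<omega> z * \<W> z y)))"


section \<open>First passage times and the killed process\<close>

text \<open>The infimum of the empty set in \<^typ>\<open>ereal\<close> is \<open>\<infinity>\<close>.\<close>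

definition passage_below :: "real \<Rightarrow> (real \<Rightarrow> real) \<Rightarrow> ereal" where
  "passage_below z f = (INF t\<in>{t. 0 < t \<and> f t < z}. ereal t)"

definition passage_above :: "real \<Rightarrow> (real \<Rightarrow> real) \<Rightarrow> ereal" where
  "passage_above c f = (INF t\<in>{t. 0 < t \<and> c < f t}. ereal t)"

text \<open>\<open>\<P>\<^sub>x\<close> is realised as the law of \<open>x + X\<close> under \<open>M\<close>.\<close>

definition started_at :: "real \<Rightarrow> (real \<Rightarrow> 'a \<Rightarrow> real) \<Rightarrow> real \<Rightarrow> 'a \<Rightarrow> real" where
  "started_at x X t w = x + X t w"

text \<open>\<open>\<E>\<^sub>x[exp (- \<integral>\<^sub>0\<^sup>t \<omega>(X\<^sub>s) ds); t < \<tau>\<^sub>0\<^sup>- \<and> \<tau>\<^sub>c\<^sup>+, X\<^sub>t \<in> B]\<close>, for the process \<open>Y\<close> equal to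
  \<open>X\<close> started at \<open>x\<close>.\<close>

definition omega_killed_expectation ::
  "'a measure \<Rightarrow> (real \<Rightarrow> 'a \<Rightarrow> real) \<Rightarrow> (real \<Rightarrow> real) \<Rightarrow> real \<Rightarrow> real \<Rightarrow> real set \<Rightarrow> real"
  where
  "omega_killed_expectation M Y \<omega> c t B =
     (LINT w:{w \<in> space M.
                ereal t < min (passage_below 0 (\<lambda>s. Y s w)) (passage_above c (\<lambda>s. Y s w)) \<and>
                Y t w \<in> B}|M.
        exp (- (LINT s:{0..t}|lborel. \<omega> (Y s w))))"

end

theory Submission
  imports Defs
begin

text \<open>Let \<open>V\<close> be the resolvent, at rate zero, of the process killed below \<open>0\<close>. Time reversal turns the
Laplace transform of \<open>V f\<close> in the starting point into an expected integral of \<open>e\<^sup>\<theta>\<^sup>X\<close> before the first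
passage above a level \<open>y\<close>. Without positive jumps the process is at \<open>y\<close> at that time, so optional
stopping of the exponential martingale evaluates this integral in terms of \<open>\<psi>\<close> and the passage
probability \<open>p(y)\<close>. Uniqueness of Laplace transforms then gives
\<open>V f(x) + (W * f)(x) = W(x) \<integral> f(y) p(y) dy\<close>; the probabilities \<open>p(y)\<close> are never computed.

By the Markov property, the resolvent \<open>u\<close> with additional killing at rate \<open>\<omega>\<close> satisfies
\<open>V f = u + V(\<omega> u)\<close>, and killing above \<open>c\<close> is the limit of killing at rate \<open>n\<close> on \<open>(c, \<infinity>)\<close>. On
\<open>[0, c]\<close> this leaves the Volterra equation \<open>u = \<kappa> W - W * f + W * (\<omega> u)\<close> with an unknown constant
\<open>\<kappa>\<close>. Its solution is \<open>u(x) = \<kappa> \<W>(x) - \<integral> \<W>(x, y) f(y) dy\<close>, and \<open>u(c) = 0\<close>, which holds because the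
process started at \<open>c\<close> exceeds \<open>c\<close> immediately, fixes \<open>\<kappa>\<close>.\<close>

section \<open>Volterra equations\<close>

text \<open>There is no discounting, so the resolvents may be infinite and paths may stay above 0
  forever. Everything up to the Volterra equation is therefore an identity between extended
  nonnegative integrals, arranged without subtraction. Finiteness on [0, c] comes from the bound
  W(c) c, which the identity for V gives for indicators of subsets of [0, c].

  The probability space is not assumed complete and paths are only right-continuous, so each path
  event is reduced to countably many times. The Markov property is used at fixed times only; first
  passage is approached along grids, and bounded second moments justify the limit.

  The constant \<kappa> is the limit of p - r(n), where r(n) contains the behaviour above c under
  killing at rate n. This is never analysed directly: the equation at x = c can be solved for p -
  r(n) because W(c) > 0, and this forces convergence.

  The \<omega>-scale functions are given as measurable in the first variable, while the answer
  integrates in the second. Joint measurability on the square is recovered from the Neumann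
  series.\<close>

locale volterra_kernel =
  fixes k :: "real \<Rightarrow> real \<Rightarrow> real" and L c :: real
  assumes kernel_measurable [measurable]: "case_prod k \<in> borel_measurable (borel \<Otimes>\<^sub>M borel)"
    and kernel_nonneg: "\<And>x z. 0 \<le> k x z"
    and kernel_le: "\<And>x z. k x z \<le> L"
    and kernel_support: "\<And>x z. z \<notin> {0..x} \<Longrightarrow> k x z = 0"
begin

lemma L_nonneg: "0 \<le> L"
  using kernel_nonneg kernel_le order_trans by blast

lemma kernel_section_measurable [measurable]: "k x \<in> borel_measurable borel"
proof -
  have "(\<lambda>z. case_prod k (x, z)) \<in> borel_measurable borel"
    by measurable
  then show ?thesis by simp
qed

text \<open>In the sup norm weighted by e^(-(2L+1)z) the operator has norm at most L/(2L+1), which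
  is below 1/2; the summand 1 keeps the rate positive when L = 0. Every later iteration uses this
  halving, on intervals of any length.\<close>

lemma operator_contraction:
  assumes [measurable]: "\<phi> \<in> borel_measurable borel"
    and bound: "\<And>z. z \<in> {0..x} \<Longrightarrow> \<bar>\<phi> z\<bar> \<le> C * exp ((2 * L + 1) * z)" and "0 \<le> C"
  shows "integrable lborel (\<lambda>z. k x z * \<phi> z)"
    and "\<bar>LINT z|lborel. k x z * \<phi> z\<bar> \<le> C / 2 * exp ((2 * L + 1) * x)"
proof -
  let ?l = "2 * L + 1"
  have \<lambda>: "0 < ?l" using L_nonneg by simp
  have int: "integrable lborel (\<lambda>z. indicator {0..x} z *\<^sub>R (L * C * exp (?l * z)))"
    by (intro borel_integrable_compact continuous_intros) auto
  have le: "\<bar>k x z * \<phi> z\<bar> \<le> indicator {0..x} z *\<^sub>R (L * C * exp (?l * z))" for z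
  proof (cases "z \<in> {0..x}")
    case True
    have "k x z * \<bar>\<phi> z\<bar> \<le> L * (C * exp (?l * z))"
      by (intro mult_mono kernel_le bound True L_nonneg) auto
    with True show ?thesis by (simp add: abs_mult kernel_nonneg mult.assoc)
  qed (simp add: kernel_support)
  show int2: "integrable lborel (\<lambda>z. k x z * \<phi> z)"
    by (rule Bochner_Integration.integrable_bound[OF int])
      (use order_trans[OF le abs_ge_self] in \<open>auto simp del: real_scaleR_def\<close>)
  show "\<bar>LINT z|lborel. k x z * \<phi> z\<bar> \<le> C / 2 * exp (?l * x)"
  proof (cases "0 \<le> x")
    case True
    have "\<bar>LINT z|lborel. k x z * \<phi> z\<bar> \<le> (LINT z|lborel. indicator {0..x} z *\<^sub>R (L * C * exp (?l * z)))"
      using Bochner_Integration.integral_norm_bound_integral[OF int2 int] le by simp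
    also have "\<dots> = L * C * exp (?l * x) / ?l - L * C * exp (?l * 0) / ?l"
      using True \<lambda>
      by (intro integral_FTC_atLeastAtMost)
        (auto intro!: derivative_eq_intros continuous_intros simp: has_real_derivative_iff_has_vector_derivative[symmetric])
    also have "\<dots> \<le> L * C * exp (?l * x) / ?l"
      using L_nonneg \<open>0 \<le> C\<close> by simp
    also have "\<dots> = (L / ?l) * (C * exp (?l * x))" by simp
    also have "\<dots> \<le> (1/2) * (C * exp (?l * x))"
      using L_nonneg \<open>0 \<le> C\<close> by (intro mult_right_mono) (auto simp: field_simps)
    finally show ?thesis by simp
  next
    case False
    then have "k x z = 0" for z by (intro kernel_support) auto
    then show ?thesis using \<open>0 \<le> C\<close> by simp
  qed
qed

lemma operator_integrable:
  assumes "\<phi> \<in> borel_measurable borel" and "\<And>z. z \<in> {0..x} \<Longrightarrow> \<bar>\<phi> z\<bar> \<le> C"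
  shows "integrable lborel (\<lambda>z. k x z * \<phi> z)"
proof (rule operator_contraction(1)[where C="\<bar>C\<bar>"])
  fix z assume z: "z \<in> {0..x}"
  have "\<bar>\<phi> z\<bar> \<le> \<bar>C\<bar> * 1" using assms(2)[OF z] by simp
  also have "\<dots> \<le> \<bar>C\<bar> * exp ((2 * L + 1) * z)"
    using z L_nonneg by (intro mult_left_mono) auto
  finally show "\<bar>\<phi> z\<bar> \<le> \<bar>C\<bar> * exp ((2 * L + 1) * z)" .
qed (use assms in auto)

text \<open>Each substitution of the equation into itself halves the weighted bound, so a bounded
  solution of the homogeneous equation vanishes on the whole interval, whatever the sizes of L and
  c.\<close>

lemma fixed_point_zero:
  assumes \<eta>: "\<eta> \<in> borel_measurable borel"
    and bound: "\<And>x. x \<in> {0..c} \<Longrightarrow> \<bar>\<eta> x\<bar> \<le> C"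
    and fixed: "\<And>x. x \<in> {0..c} \<Longrightarrow> \<eta> x = (LINT z|lborel. k x z * \<eta> z)"
    and x: "x \<in> {0..c}"
  shows "\<eta> x = 0"
proof -
  have *: "\<forall>x\<in>{0..c}. \<bar>\<eta> x\<bar> \<le> \<bar>C\<bar> / 2 ^ n * exp ((2 * L + 1) * x)" for n
  proof (induction n)
    case 0
    show ?case
    proof
      fix x assume x: "x \<in> {0..c}"
      have "\<bar>\<eta> x\<bar> \<le> \<bar>C\<bar> * 1" using bound[OF x] by simp
      also have "\<dots> \<le> \<bar>C\<bar> * exp ((2 * L + 1) * x)"
        using x L_nonneg by (intro mult_left_mono) auto
      finally show "\<bar>\<eta> x\<bar> \<le> \<bar>C\<bar> / 2 ^ 0 * exp ((2 * L + 1) * x)" by simp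
    qed
  next
    case (Suc n)
    show ?case
    proof
      fix x assume x: "x \<in> {0..c}"
      have "\<bar>LINT z|lborel. k x z * \<eta> z\<bar> \<le> \<bar>C\<bar> / 2 ^ n / 2 * exp ((2 * L + 1) * x)"
        using Suc x by (intro operator_contraction \<eta>) auto
      then show "\<bar>\<eta> x\<bar> \<le> \<bar>C\<bar> / 2 ^ Suc n * exp ((2 * L + 1) * x)"
        using fixed[OF x] by (simp add: mult.commute)
    qed
  qed
  have "(\<lambda>n. \<bar>C\<bar> * exp ((2 * L + 1) * x) * (1/2) ^ n) \<longlonglongrightarrow> \<bar>C\<bar> * exp ((2 * L + 1) * x) * 0"
    by (intro tendsto_intros LIMSEQ_power_zero) auto
  then have "\<bar>\<eta> x\<bar> \<le> \<bar>C\<bar> * exp ((2 * L + 1) * x) * 0"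
    by (rule LIMSEQ_le_const) (use bspec[OF * x] in \<open>simp add: power_divide\<close>)
  then show ?thesis by simp
qed

end

section \<open>Resolvent kernels and inhomogeneous Volterra equations\<close>

locale volterra_resolvent = volterra_kernel +
  fixes g R :: "real \<Rightarrow> real \<Rightarrow> real" and G :: real
  assumes g_measurable [measurable]: "case_prod g \<in> borel_measurable (borel \<Otimes>\<^sub>M borel)"
    and g_nonneg: "\<And>x y. 0 \<le> g x y" and g_le: "\<And>x y. g x y \<le> G"
    and R_measurable [measurable]: "\<And>y. (\<lambda>x. R x y) \<in> borel_measurable borel"
    and R_bounded: "\<And>y. \<exists>C. \<forall>x\<in>{0..c}. \<bar>R x y\<bar> \<le> C"
    and R_eq: "\<And>x y. x \<in> {0..c} \<Longrightarrow> y \<in> {0..c} \<Longrightarrow> R x y = g x y + (LINT z|lborel. k x z * R z y)"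
begin

lemma G_nonneg: "0 \<le> G"
  using g_nonneg g_le order_trans by blast

lemma g_section_measurable [measurable]: "g x \<in> borel_measurable borel" "(\<lambda>x. g x y) \<in> borel_measurable borel"
proof -
  have "(\<lambda>z. case_prod g (x, z)) \<in> borel_measurable borel" "(\<lambda>x. case_prod g (x, y)) \<in> borel_measurable borel"
    by measurable
  then show "g x \<in> borel_measurable borel" "(\<lambda>x. g x y) \<in> borel_measurable borel" by auto
qed

text \<open>Partial sums of the Neumann series with first term g. Unlike \<open>R\<close>, for which
  only measurability in the first variable is known, they are jointly measurable by
  construction.\<close>

primrec picard :: "nat \<Rightarrow> real \<Rightarrow> real \<Rightarrow> real" where
  "picard 0 x y = g x y"
| "picard (Suc n) x y = g x y + (LINT z|lborel. k x z * picard n z y)"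

lemma picard_measurable: "(\<lambda>(x, y). picard n x y) \<in> borel_measurable (borel \<Otimes>\<^sub>M borel)"
proof (induction n)
  case (Suc n)
  have [measurable]: "case_prod (picard n) \<in> borel_measurable (borel \<Otimes>\<^sub>M borel)"
    using Suc by simp
  have "(\<lambda>(p, z). case_prod k (fst p, z) * case_prod (picard n) (z, snd p))
      \<in> borel_measurable ((borel \<Otimes>\<^sub>M borel) \<Otimes>\<^sub>M lborel)"
    by measurable
  then have "(\<lambda>p. LINT z|lborel. case_prod k (fst p, z) * case_prod (picard n) (z, snd p))
      \<in> borel_measurable (borel \<Otimes>\<^sub>M borel)"
    by (intro lborel.borel_measurable_lebesgue_integral)
  then show ?case by (simp add: case_prod_beta')
qed simp

lemma picard_section_measurable [measurable]: "(\<lambda>x. picard n x y) \<in> borel_measurable borel"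
proof -
  have [measurable]: "(\<lambda>(x, y). picard n x y) \<in> borel_measurable (borel \<Otimes>\<^sub>M borel)"
    by (rule picard_measurable)
  have "(\<lambda>x. (\<lambda>(x, y). picard n x y) (x, y)) \<in> borel_measurable borel"
    by measurable
  then show ?thesis by simp
qed

text \<open>The upper bound reproduces itself: the operator halves 2G e^((2L+1)x), and adding g
  \<le> G \<le> G e^((2L+1)x) restores the factor 2.\<close>

lemma picard_bounds:
  assumes "0 \<le> x"
  shows "g x y \<le> picard n x y \<and> picard n x y \<le> 2 * G * exp ((2 * L + 1) * x)"
  using assms
proof (induction n arbitrary: x)
  have G: "G \<le> G * exp ((2 * L + 1) * x)" if "0 \<le> x" for x
    using that L_nonneg G_nonneg mult_left_mono[of 1 "exp ((2 * L + 1) * x)" G] by auto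
  {
    case 0
    have "G \<le> 2 * (G * exp ((2 * L + 1) * x))" using G[OF 0] G_nonneg by linarith
    then show ?case using g_le[of x y] by (simp add: mult.assoc)
  next
    case (Suc n)
    have "picard n z y \<ge> 0" if "z \<in> {0..x}" for z
      using Suc.IH[of z] g_nonneg[of z y] that by auto
    then have "k x z * picard n z y \<ge> 0" for z
      by (cases "z \<in> {0..x}") (auto simp: kernel_nonneg kernel_support)
    then have 1: "(LINT z|lborel. k x z * picard n z y) \<ge> 0"
      by (intro integral_nonneg_AE) auto
    have "\<bar>LINT z|lborel. k x z * picard n z y\<bar> \<le> 2 * G / 2 * exp ((2 * L + 1) * x)"
    proof (rule operator_contraction)
      fix z assume "z \<in> {0..x}"
      then show "\<bar>picard n z y\<bar> \<le> 2 * G * exp ((2 * L + 1) * z)"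
        using Suc.IH[of z] g_nonneg[of z y] by auto
    qed (use G_nonneg in auto)
    then have "g x y + (LINT z|lborel. k x z * picard n z y) \<le> 2 * (G * exp ((2 * L + 1) * x))"
      using G[OF Suc.prems] g_le[of x y] by simp
    then show ?case using 1 by (simp add: mult.assoc)
  }
qed

text \<open>The error satisfies the homogeneous recursion and so halves at each step in the weighted
  norm; \<open>C\<close> bounds the initial error |R - g|.\<close>

lemma picard_converges:
  assumes x: "x \<in> {0..c}" and y: "y \<in> {0..c}"
  shows "(\<lambda>n. picard n x y) \<longlonglongrightarrow> R x y"
proof -
  obtain C0 where C0: "\<And>x. x \<in> {0..c} \<Longrightarrow> \<bar>R x y\<bar> \<le> C0" using R_bounded by blast
  have R_int: "integrable lborel (\<lambda>z. k x z * R z y)" if "x \<in> {0..c}" for x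
    using that by (intro operator_integrable[where C=C0]) (auto intro!: C0)
  have P_int: "integrable lborel (\<lambda>z. k x z * picard n z y)" if "x \<in> {0..c}" for x n
  proof (rule operator_contraction)
    fix z assume "z \<in> {0..x}"
    then show "\<bar>picard n z y\<bar> \<le> 2 * G * exp ((2 * L + 1) * z)"
      using picard_bounds[of z y n] g_nonneg[of z y] by auto
  qed (use G_nonneg in auto)
  define C where "C = C0 + G"
  have C: "0 \<le> C" using C0[OF x] G_nonneg unfolding C_def by linarith
  have *: "\<forall>x\<in>{0..c}. \<bar>R x y - picard n x y\<bar> \<le> C / 2 ^ n * exp ((2 * L + 1) * x)" for n
  proof (induction n)
    case 0
    show ?case
    proof
      fix x assume x: "x \<in> {0..c}"
      have "\<bar>R x y - g x y\<bar> \<le> C * 1" using C0[OF x] g_nonneg[of x y] g_le[of x y] by (simp add: C_def abs_le_iff)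
      also have "\<dots> \<le> C * exp ((2 * L + 1) * x)"
        using x L_nonneg C by (intro mult_left_mono) auto
      finally show "\<bar>R x y - picard 0 x y\<bar> \<le> C / 2 ^ 0 * exp ((2 * L + 1) * x)" by simp
    qed
  next
    case (Suc n)
    show ?case
    proof
      fix x assume x: "x \<in> {0..c}"
      have "R x y - picard (Suc n) x y = (LINT z|lborel. k x z * (R z y - picard n z y))"
        using R_eq[OF x y] R_int[OF x] P_int[OF x, of n]
        by (simp add: right_diff_distrib)
      moreover have "\<bar>LINT z|lborel. k x z * (R z y - picard n z y)\<bar> \<le> C / 2 ^ n / 2 * exp ((2 * L + 1) * x)"
        using Suc x C by (intro operator_contraction) auto
      ultimately show "\<bar>R x y - picard (Suc n) x y\<bar> \<le> C / 2 ^ Suc n * exp ((2 * L + 1) * x)"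
        by (simp add: mult.commute)
    qed
  qed
  have lim: "(\<lambda>n. C * exp ((2 * L + 1) * x) * (1/2) ^ n) \<longlonglongrightarrow> C * exp ((2 * L + 1) * x) * 0"
    by (intro tendsto_intros LIMSEQ_power_zero) auto
  have "(\<lambda>n. R x y - picard n x y) \<longlonglongrightarrow> 0"
    by (rule Lim_null_comparison[OF _ lim[simplified]])
      (use bspec[OF * x] in \<open>simp add: power_divide\<close>)
  from tendsto_diff[OF tendsto_const[of "R x y"] this] show ?thesis by simp
qed

text \<open>The lower bound later makes the denominator \<open>\<W> c 0\<close> positive. The upper
  bound is uniform in y, although \<open>R\<close> was assumed bounded for each y
  separately.\<close>

lemma R_bounds:
  assumes x: "x \<in> {0..c}" and y: "y \<in> {0..c}"
  shows "g x y \<le> R x y" and "R x y \<le> 2 * G * exp ((2 * L + 1) * c)"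
proof -
  have "g x y \<le> picard n x y" "picard n x y \<le> 2 * G * exp ((2 * L + 1) * x)" for n
    using picard_bounds[of x y n] x by auto
  then have "g x y \<le> R x y" "R x y \<le> 2 * G * exp ((2 * L + 1) * x)"
    using picard_converges[OF x y] by (meson LIMSEQ_le_const LIMSEQ_le_const2)+
  moreover have "2 * G * exp ((2 * L + 1) * x) \<le> 2 * G * exp ((2 * L + 1) * c)"
    using x L_nonneg G_nonneg by (intro mult_left_mono) auto
  ultimately show "g x y \<le> R x y" "R x y \<le> 2 * G * exp ((2 * L + 1) * c)" by auto
qed

text \<open>A jointly measurable and globally bounded version of \<open>R\<close> on the square;
  integrating in y and exchanging integrals rest on it.\<close>

definition R_joint :: "real \<Rightarrow> real \<Rightarrow> real" where
  "R_joint x y = (if x \<in> {0..c} \<and> y \<in> {0..c} then lim (\<lambda>n. picard n x y) else 0)"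

lemma R_joint_eq: "x \<in> {0..c} \<Longrightarrow> y \<in> {0..c} \<Longrightarrow> R_joint x y = R x y"
  using picard_converges[of x y] by (simp add: R_joint_def limI)

lemma R_joint_measurable [measurable]: "case_prod R_joint \<in> borel_measurable (borel \<Otimes>\<^sub>M borel)"
proof -
  have [measurable]: "(\<lambda>p. picard n (fst p) (snd p)) \<in> borel_measurable (borel \<Otimes>\<^sub>M borel)" for n
    using picard_measurable by (simp add: case_prod_beta')
  have "(\<lambda>p. if fst p \<in> {0..c} \<and> snd p \<in> {0..c} then lim (\<lambda>n. picard n (fst p) (snd p)) else 0)
    \<in> borel_measurable (borel \<Otimes>\<^sub>M borel)"
    by measurable
  then show ?thesis by (simp add: R_joint_def[abs_def] case_prod_beta')
qed

lemma R_joint_section_measurable [measurable]: "R_joint x \<in> borel_measurable borel" "(\<lambda>x. R_joint x y) \<in> borel_measurable borel"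
proof -
  have "(\<lambda>z. case_prod R_joint (x, z)) \<in> borel_measurable borel" "(\<lambda>x. case_prod R_joint (x, y)) \<in> borel_measurable borel"
    by measurable
  then show "R_joint x \<in> borel_measurable borel" "(\<lambda>x. R_joint x y) \<in> borel_measurable borel" by auto
qed

lemma R_joint_bounds: "0 \<le> R_joint x y" "\<bar>R_joint x y\<bar> \<le> 2 * G * exp ((2 * L + 1) * c)"
proof -
  have "0 \<le> R_joint x y \<and> \<bar>R_joint x y\<bar> \<le> 2 * G * exp ((2 * L + 1) * c)"
    using R_bounds[of x y] g_nonneg[of x y] G_nonneg R_joint_eq[of x y]
    by (cases "x \<in> {0..c} \<and> y \<in> {0..c}") (auto simp: R_joint_def)
  then show "0 \<le> R_joint x y" "\<bar>R_joint x y\<bar> \<le> 2 * G * exp ((2 * L + 1) * c)" by auto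
qed

lemma set_integrable_bounded_Icc:
  fixes h :: "real \<Rightarrow> real"
  assumes [measurable]: "h \<in> borel_measurable borel" "B \<in> sets borel" and "B \<subseteq> {0..c}" and "\<And>y. \<bar>h y\<bar> \<le> D"
  shows "integrable lborel (\<lambda>y. indicator B y * h y)"
proof -
  have int: "integrable lborel (\<lambda>y. D * indicator {0..c} y)"
    by (intro integrable_mult_right integrable_real_indicator) (auto simp: emeasure_lborel_Icc_eq)
  have "0 \<le> D" using assms(4)[of 0] by linarith
  then show ?thesis
    using assms(3,4)
    by (intro Bochner_Integration.integrable_bound[OF int]) (auto intro!: AE_I2 simp: indicator_def)
qed

text \<open>Integrating the equation of R(., y) over y in B and exchanging the integrals shows that
  the right-hand side solves the same equation as \<phi>. The difference \<open>\<eta>\<close> is a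
  bounded fixed point of the operator, hence zero on [0, c].\<close>

theorem solution:
  assumes [measurable]: "\<phi> \<in> borel_measurable borel"
    and bound: "\<And>x. x \<in> {0..c} \<Longrightarrow> \<bar>\<phi> x\<bar> \<le> C"
    and B [measurable]: "B \<in> sets borel" and "B \<subseteq> {0..c}"
    and eq: "\<And>x. x \<in> {0..c} \<Longrightarrow>
      \<phi> x = \<kappa> * g x 0 - (LINT y|lborel. indicator B y * g x y) + (LINT z|lborel. k x z * \<phi> z)"
    and x: "x \<in> {0..c}"
  shows "\<phi> x = \<kappa> * R x 0 - (LINT y|lborel. indicator B y * R x y)"
proof -
  define D where "D = 2 * G * exp ((2 * L + 1) * c)"
  have D: "\<bar>R_joint x y\<bar> \<le> D" for x y unfolding D_def by (rule R_joint_bounds)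
  have D0: "0 \<le> D" using D[of 0 0] by linarith
  define U where "U x = (LINT y|lborel. indicator B y * R_joint x y)" for x
  have [measurable]: "U \<in> borel_measurable borel"
  proof -
    have "(\<lambda>(x, y). indicator B y * case_prod R_joint (x, y)) \<in> borel_measurable (borel \<Otimes>\<^sub>M lborel)"
      by measurable
    then have "(\<lambda>x. LINT y|lborel. indicator B y * case_prod R_joint (x, y)) \<in> borel_measurable borel"
      by (intro lborel.borel_measurable_lebesgue_integral)
    then show ?thesis by (simp add: U_def[abs_def])
  qed
  have c: "0 \<le> c" using x by auto
  have Ubound: "\<bar>U x\<bar> \<le> c * D" for x
  proof -
    have "norm (indicator B y * R_joint x y) \<le> indicator {0..c} y * D" for y
      using assms(4) D[of x y] D0 by (auto simp: indicator_def)
    then have "norm (U x) \<le> (LINT y|lborel. indicator {0..c} y * D)"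
      unfolding U_def using D D0 assms(4)
      by (intro Bochner_Integration.integral_norm_bound_integral set_integrable_bounded_Icc[where D=D]) auto
    also have "\<dots> = c * D" using c by simp
    finally show ?thesis by simp
  qed
  have Ueq: "U x = (LINT y|lborel. indicator B y * g x y) + (LINT z|lborel. k x z * U z)" if x: "x \<in> {0..c}" for x
  proof -
    have R_joint_eq': "R_joint x y = g x y + (LINT z|lborel. k x z * R_joint z y)" if y: "y \<in> {0..c}" for y
    proof -
      \<comment> \<open>The two functions agree only on the square; outside [0, x] the kernel
        vanishes.\<close>
      have "k x z * R z y = k x z * R_joint z y" for z
        using R_joint_eq[of z y] y kernel_support[of z x] x by (cases "z \<in> {0..x}") auto
      then have "(\<lambda>z. k x z * R z y) = (\<lambda>z. k x z * R_joint z y)" by (rule ext)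
      then show ?thesis using R_eq[OF x y] R_joint_eq[OF x y] by (simp only:)
    qed
    let ?h = "\<lambda>y z. indicator B y * (k x z * R_joint z y)"
    have hm: "case_prod ?h \<in> borel_measurable (lborel \<Otimes>\<^sub>M lborel)"
    proof -
      have "(\<lambda>p. indicator B (fst p) * (k x (snd p) * case_prod R_joint (snd p, fst p))) \<in> borel_measurable (lborel \<Otimes>\<^sub>M lborel)"
        by measurable
      then show ?thesis by (simp add: case_prod_beta')
    qed
    have hint: "integrable (lborel \<Otimes>\<^sub>M lborel) (case_prod ?h)"
    proof (rule Bochner_Integration.integrable_bound)
      have "integrable (lborel \<Otimes>\<^sub>M lborel) (indicat_real ({0..c} \<times> {0..c}))"
        by (intro integrable_real_indicator)
          (auto simp: lborel.emeasure_pair_measure_Times ennreal_mult_less_top emeasure_lborel_Icc_eq intro!: pair_measureI)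
      then show "integrable (lborel \<Otimes>\<^sub>M lborel) (\<lambda>p. L * D * indicat_real ({0..c} \<times> {0..c}) p)"
        by (rule integrable_mult_right)
      show "AE p in lborel \<Otimes>\<^sub>M lborel. norm (case_prod ?h p) \<le> norm (L * D * indicat_real ({0..c} \<times> {0..c}) p)"
      proof (rule AE_I2)
        fix p
        show "norm (case_prod ?h p) \<le> norm (L * D * indicat_real ({0..c} \<times> {0..c}) p)"
        proof (cases "p \<in> B \<times> {0..x}")
          case True
          obtain y z where p: "p = (y, z)" by force
          have "k x z * \<bar>R_joint z y\<bar> \<le> L * D" by (intro mult_mono kernel_le D L_nonneg) auto
          moreover have "p \<in> {0..c} \<times> {0..c}" using True x assms(4) by auto
          ultimately show ?thesis using True p L_nonneg D0 by (auto simp: abs_mult kernel_nonneg)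
        next
          case False
          then show ?thesis using kernel_support[of _ x] by (cases p) (auto simp: indicator_def)
        qed
      qed
    qed (rule hm)
    have "U x = (LINT y|lborel. indicator B y * g x y + (LINT z|lborel. ?h y z))"
      unfolding U_def using R_joint_eq' assms(4)
      by (intro Bochner_Integration.integral_cong) (auto simp: indicator_def)
    also have "\<dots> = (LINT y|lborel. indicator B y * g x y) + (LINT y|lborel. LINT z|lborel. ?h y z)"
    proof (rule Bochner_Integration.integral_add)
      show "integrable lborel (\<lambda>y. indicator B y * g x y)"
        using assms(4) g_nonneg g_le by (intro set_integrable_bounded_Icc[where D=G]) auto
      show "integrable lborel (\<lambda>y. LINT z|lborel. ?h y z)"
        using lborel_pair.integrable_fst[OF hint] by simp
    qed
    also have "(LINT y|lborel. LINT z|lborel. ?h y z) = (LINT z|lborel. LINT y|lborel. ?h y z)"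
      using lborel_pair.Fubini_integral[OF hint] by simp
    also have "\<dots> = (LINT z|lborel. k x z * U z)"
    proof (rule Bochner_Integration.integral_cong)
      fix z
      have "(LINT y|lborel. ?h y z) = (LINT y|lborel. k x z * (indicator B y * R_joint z y))"
        by (intro Bochner_Integration.integral_cong) auto
      then show "(LINT y|lborel. ?h y z) = k x z * U z" unfolding U_def by simp
    qed simp
    finally show ?thesis .
  qed
  define \<eta> where "\<eta> x = \<kappa> * R_joint x 0 - U x - \<phi> x" for x
  have "\<eta> x = 0"
  proof (rule fixed_point_zero[where \<eta>=\<eta> and x=x and C="\<bar>\<kappa>\<bar> * D + c * D + C"])
    show "\<eta> \<in> borel_measurable borel" unfolding \<eta>_def[abs_def] by measurable
  next
    fix x assume x: "x \<in> {0..c}"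
    have "\<bar>\<kappa> * R_joint x 0\<bar> \<le> \<bar>\<kappa>\<bar> * D" using D[of x 0] by (simp add: abs_mult mult_left_mono)
    then show "\<bar>\<eta> x\<bar> \<le> \<bar>\<kappa>\<bar> * D + c * D + C" using Ubound[of x] bound[OF x] unfolding \<eta>_def by linarith
    have i1: "integrable lborel (\<lambda>z. k x z * R_joint z 0)" by (rule operator_integrable[where C=D]) (use D in auto)
    have i2: "integrable lborel (\<lambda>z. k x z * U z)" by (rule operator_integrable[where C="c * D"]) (use Ubound in auto)
    have i3: "integrable lborel (\<lambda>z. k x z * \<phi> z)" by (rule operator_integrable[where C=C]) (use bound x in auto)
    have "k x z * R z 0 = k x z * R_joint z 0" for z
      using R_joint_eq[of z 0] kernel_support[of z x] x by (cases "z \<in> {0..x}") auto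
    then have "(\<lambda>z. k x z * R z 0) = (\<lambda>z. k x z * R_joint z 0)" by (rule ext)
    then have "R_joint x 0 = g x 0 + (LINT z|lborel. k x z * R_joint z 0)"
      using R_eq[OF x, of 0] R_joint_eq[OF x, of 0] c by (simp only: atLeastAtMost_iff order_refl)
    moreover have "(LINT z|lborel. k x z * \<eta> z) = (LINT z|lborel. \<kappa> * (k x z * R_joint z 0) - k x z * U z - k x z * \<phi> z)"
      unfolding \<eta>_def by (intro Bochner_Integration.integral_cong) (auto simp: algebra_simps)
    moreover have "\<dots> = \<kappa> * (LINT z|lborel. k x z * R_joint z 0) - (LINT z|lborel. k x z * U z) - (LINT z|lborel. k x z * \<phi> z)"
      using i1 i2 i3 by simp
    ultimately show "\<eta> x = (LINT z|lborel. k x z * \<eta> z)"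
      using eq[OF x] Ueq[OF x] unfolding \<eta>_def by (simp add: algebra_simps)
  qed (rule x)
  moreover have "U x = (LINT y|lborel. indicator B y * R x y)"
    unfolding U_def using assms(4) R_joint_eq[OF x]
    by (intro Bochner_Integration.integral_cong) (auto simp: indicator_def)
  ultimately show ?thesis using R_joint_eq[OF x, of 0] c unfolding \<eta>_def by auto
qed

end

section \<open>Laplace transforms\<close>

text \<open>On [-1, 1] every moment is at most 1 in modulus, so the series of e^(itx) may be
  integrated term by term with the exponential series of |t| as majorant. The characteristic
  function is thus determined by the moments.\<close>

lemma char_sums_moments:
  fixes N :: "real measure"
  assumes "real_distribution N" and "AE x in N. \<bar>x\<bar> \<le> 1"
  shows "(\<lambda>k. (\<i> * of_real t) ^ k /\<^sub>R fact k * complex_of_real (LINT x|N. x ^ k)) sums char N t"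
proof -
  interpret real_distribution N by fact
  have pow: "AE x in N. \<bar>x ^ k\<bar> \<le> 1" for k
    using assms(2) by eventually_elim (simp add: power_abs power_le_one)
  have int: "integrable N (\<lambda>x. x ^ k)" for k
    by (rule integrable_const_bound[where B=1]) (use pow[of k] in auto)
  let ?f = "\<lambda>k x. (\<i> * of_real t) ^ k /\<^sub>R fact k * complex_of_real (x ^ k)"
  have eq: "?f k x = (\<i> * of_real (t * x)) ^ k /\<^sub>R fact k" for k x
    by (simp add: power_mult_distrib mult_ac)
  have sum_norm: "summable (\<lambda>k. norm (?f k x))" for x
    unfolding eq by (rule summable_norm_exp)
  have "(\<lambda>k. LINT x|N. ?f k x) sums (LINT x|N. (\<Sum>k. ?f k x))"
  proof (rule sums_integral)
    show "integrable N (?f k)" for k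
      by (intro integrable_mult_right integrable_of_real int)
    show "AE x in N. summable (\<lambda>k. norm (?f k x))"
      using sum_norm by simp
    show "summable (\<lambda>k. LINT x|N. norm (?f k x))"
    proof (rule summable_comparison_test'[where N=0])
      show "summable (\<lambda>k. norm ((\<i> * of_real t) ^ k /\<^sub>R fact k))"
        by (rule summable_norm_exp)
      fix k
      have "(LINT x|N. norm (?f k x)) \<le> (LINT x|N. norm ((\<i> * of_real t) ^ k /\<^sub>R fact k))"
      proof (rule integral_mono_AE)
        show "integrable N (\<lambda>x. norm (?f k x))"
          by (intro integrable_norm integrable_mult_right integrable_of_real int)
        show "AE x in N. norm (?f k x) \<le> norm ((\<i> * of_real t) ^ k /\<^sub>R fact k)"
          using pow[of k]
        proof eventually_elim
          case (elim x)
          then show ?case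
            by (simp add: norm_mult mult_left_le del: of_real_power)
        qed
      qed simp
      moreover have "prob UNIV = 1" using prob_space by simp
      ultimately show "norm (LINT x|N. norm (?f k x)) \<le> norm ((\<i> * of_real t) ^ k /\<^sub>R fact k)"
        by simp
    qed
  qed
  moreover have "(LINT x|N. (\<Sum>k. ?f k x)) = char N t"
    unfolding eq char_def exp_def ..
  moreover have "(LINT x|N. ?f k x) = (\<i> * of_real t) ^ k /\<^sub>R fact k * complex_of_real (LINT x|N. x ^ k)" for k
    by (simp del: of_real_power)
  ultimately show ?thesis by (simp only:)
qed

text \<open>The zeroth moments give both measures the same mass m. If m > 0, division by m yields
  probability laws with equal moments, hence with equal characteristic functions.\<close>

lemma moments_unique:
  fixes N1 N2 :: "real measure"
  assumes sets: "sets N1 = sets borel" "sets N2 = sets borel"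
    and supp: "AE x in N1. 0 \<le> x \<and> x \<le> 1" "AE x in N2. 0 \<le> x \<and> x \<le> 1"
    and fin: "emeasure N1 (space N1) < \<infinity>"
    and eq: "\<And>k :: nat. (\<integral>\<^sup>+x. ennreal (x ^ k) \<partial>N1) = (\<integral>\<^sup>+x. ennreal (x ^ k) \<partial>N2)"
  shows "N1 = N2"
proof -
  define m where "m = emeasure N1 (space N1)"
  have m2: "emeasure N2 (space N2) = m"
    using eq[of 0] by (simp add: m_def)
  show ?thesis
  proof (cases "m = 0")
    case True
    then have "emeasure N1 A = 0" "emeasure N2 A = 0" for A
      using m2 emeasure_mono[of A "space N1" N1] emeasure_mono[of A "space N2" N2]
        emeasure_space[of N1 A] emeasure_space[of N2 A] unfolding m_def by auto
    then show ?thesis using sets by (intro measure_eqI) auto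
  next
    case False
    have "m < \<infinity>" using fin by (simp add: m_def)
    with False have "m / m = 1" by (intro ennreal_divide_self) auto
    then have m: "m * inverse m = 1" "inverse m * m = 1"
      by (simp_all add: divide_ennreal_def mult.commute)
    define P where "P N = density N (\<lambda>_. inverse m)" for N :: "real measure"
    have emP: "emeasure (P N) A = inverse m * emeasure N A" if "A \<in> sets N" for N A
      unfolding P_def using that by (rule emeasure_density_const)
    have "real_distribution (P N)" if "emeasure N (space N) = m" "sets N = sets borel" for N
    proof -
      have "emeasure (P N) (space (P N)) = 1"
        using emP[OF sets.top, of N] m that(1) by (simp add: P_def)
      then show ?thesis
        using that by (intro real_distribution.intro prob_spaceI real_distribution_axioms.intro) (auto simp: P_def)
    qed
    then have dist: "real_distribution (P N1)" "real_distribution (P N2)"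
      using m2 sets by (auto simp: m_def)
    have AE1: "AE x in P N1. 0 \<le> x \<and> x \<le> 1" and AE2: "AE x in P N2. 0 \<le> x \<and> x \<le> 1"
      using supp unfolding P_def by (simp_all add: AE_density)
    have mom: "(LINT x|P N1. x ^ k) = (LINT x|P N2. x ^ k)" for k
    proof -
      have "(LINT x|P N. x ^ k) = enn2real (inverse m * (\<integral>\<^sup>+x. ennreal (x ^ k) \<partial>N))"
        if "AE x in P N. 0 \<le> x \<and> x \<le> 1" "sets N = sets borel" for N
      proof -
        have "(LINT x|P N. x ^ k) = enn2real (\<integral>\<^sup>+x. ennreal (x ^ k) \<partial>P N)"
          using that(2) eventually_mono[OF that(1)] by (intro integral_eq_nn_integral) (auto simp: P_def)
        then show ?thesis
          using that by (simp add: P_def nn_integral_density nn_integral_cmult)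
      qed
      then show ?thesis using AE1 AE2 sets eq by simp
    qed
    have "char (P N1) t = char (P N2) t" for t
    proof -
      have "AE x in P N1. \<bar>x\<bar> \<le> 1" "AE x in P N2. \<bar>x\<bar> \<le> 1"
        by (rule eventually_mono[OF AE1], simp) (rule eventually_mono[OF AE2], simp)
      then show ?thesis
        using sums_unique2[OF char_sums_moments[OF dist(1), of t, unfolded mom] char_sums_moments[OF dist(2), of t]]
        by blast
    qed
    then have "P N1 = P N2" by (intro Levy_uniqueness dist ext)
    have "emeasure N1 A = emeasure N2 A" if A: "A \<in> sets borel" for A
    proof -
      have "inverse m * emeasure N1 A = inverse m * emeasure N2 A"
        using A emP[of A N1] emP[of A N2] \<open>P N1 = P N2\<close> sets by simp
      then have "m * (inverse m * emeasure N1 A) = m * (inverse m * emeasure N2 A)"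
        by (simp only:)
      then show ?thesis by (simp only: m mult.assoc[symmetric] mult_1)
    qed
    then show ?thesis using sets by (intro measure_eqI) auto
  qed
qed

text \<open>The map u = e^(-x) carries the measure with density e^(-\<theta> x) g(x) to [0, 1] and
  turns its transform at \<theta> + k into the k-th moment. Equality along the sequence \<theta> + k
  is therefore enough.\<close>

lemma laplace_unique:
  fixes g1 g2 :: "real \<Rightarrow> ennreal" and \<theta> :: real
  assumes [measurable]: "g1 \<in> borel_measurable borel" "g2 \<in> borel_measurable borel"
    and fin: "(\<integral>\<^sup>+x\<in>{0..}. exp (- \<theta> * x) * g1 x \<partial>lborel) < \<infinity>"
    and eq: "\<And>k :: nat. (\<integral>\<^sup>+x\<in>{0..}. exp (- (\<theta> + real k) * x) * g1 x \<partial>lborel)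
       = (\<integral>\<^sup>+x\<in>{0..}. exp (- (\<theta> + real k) * x) * g2 x \<partial>lborel)"
  shows "AE x in lborel. 0 \<le> x \<longrightarrow> g1 x = g2 x"
proof -
  define h where "h g x = ennreal (exp (- \<theta> * x)) * g x * indicator {0..} x" for g :: "real \<Rightarrow> ennreal" and x :: real
  define N where "N g = distr (density lborel (h g)) borel (\<lambda>x. exp (- x))" for g
  have hm [measurable]: "h g1 \<in> borel_measurable borel" "h g2 \<in> borel_measurable borel"
    unfolding h_def by measurable
  have mom: "(\<integral>\<^sup>+u. ennreal (u ^ k) \<partial>N g) = (\<integral>\<^sup>+x\<in>{0..}. exp (- (\<theta> + real k) * x) * g x \<partial>lborel)"
    if [measurable]: "g \<in> borel_measurable borel" for g :: "real \<Rightarrow> ennreal" and k :: nat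
  proof -
    have [measurable]: "h g \<in> borel_measurable borel" unfolding h_def by measurable
    have "ennreal (exp (- x) ^ k) * h g x = ennreal (exp (- (\<theta> + real k) * x)) * g x * indicator {0..} x" for x
    proof -
      have "exp (- x) ^ k * exp (- \<theta> * x) = exp (- (\<theta> + real k) * x)"
        by (simp add: exp_of_nat_mult[symmetric] exp_add[symmetric] algebra_simps)
      then have "ennreal (exp (- x) ^ k) * ennreal (exp (- \<theta> * x)) = ennreal (exp (- (\<theta> + real k) * x))"
        by (simp add: ennreal_mult[symmetric])
      then show ?thesis unfolding h_def by (simp add: mult.assoc[symmetric])
    qed
    then show ?thesis
      unfolding N_def by (simp add: nn_integral_distr nn_integral_density mult.commute)
  qed
  have supp: "AE u in N g. 0 \<le> u \<and> u \<le> 1" if [measurable]: "g \<in> borel_measurable borel" for g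
  proof -
    have [measurable]: "h g \<in> borel_measurable borel" unfolding h_def by measurable
    show ?thesis unfolding N_def
      by (subst AE_distr_iff) (auto simp: AE_density h_def indicator_def intro!: AE_I2)
  qed
  have "N g1 = N g2"
  proof (rule moments_unique)
    have "emeasure (N g1) (space (N g1)) = (\<integral>\<^sup>+x\<in>{0..}. exp (- \<theta> * x) * g1 x \<partial>lborel)"
      using mom[of g1 0] by simp
    then show "emeasure (N g1) (space (N g1)) < \<infinity>" using fin by simp
  qed (use mom eq supp assms in \<open>auto simp: N_def\<close>)
  moreover have "distr (N g) borel (\<lambda>u. - ln u) = density lborel (h g)" if [measurable]: "g \<in> borel_measurable borel" for g
  proof -
    have [measurable]: "h g \<in> borel_measurable borel" unfolding h_def by measurable
    show ?thesis unfolding N_def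
      by (subst distr_distr) (auto simp: comp_def intro!: distr_id2)
  qed
  ultimately have "density lborel (h g1) = density lborel (h g2)"
    using assms by metis
  then have "AE x in lborel. h g1 x = h g2 x"
    by (intro sigma_finite_measure.density_unique[OF sigma_finite_lborel]) auto
  then show ?thesis
  proof eventually_elim
    case (elim x)
    show ?case
    proof
      assume "0 \<le> x"
      with elim have "ennreal (exp (- \<theta> * x)) * g1 x = ennreal (exp (- \<theta> * x)) * g2 x"
        by (simp add: h_def)
      then have "ennreal (exp (\<theta> * x)) * (ennreal (exp (- \<theta> * x)) * g1 x) = ennreal (exp (\<theta> * x)) * (ennreal (exp (- \<theta> * x)) * g2 x)"
        by simp
      moreover have "ennreal (exp (\<theta> * x)) * ennreal (exp (- \<theta> * x)) = 1"
        by (simp add: ennreal_mult[symmetric] exp_add[symmetric])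
      ultimately show "g1 x = g2 x" by (simp add: mult.assoc[symmetric])
    qed
  qed
qed

text \<open>The difference of the two sides, as a function of \<open>s\<close>, varies at most quadratically,
  so it is constant even though \<open>a\<close> need not be continuous.\<close>

lemma integral_killing_rate:
  fixes a :: "real \<Rightarrow> real"
  assumes [measurable]: "a \<in> borel_measurable borel" and a: "\<And>s. 0 \<le> a s" "\<And>s. a s \<le> K" and "0 \<le> t"
  shows "(\<integral>\<^sup>+s\<in>{0..t}. ennreal (a s * exp (- (LINT v:{s..t}|lborel. a v))) \<partial>lborel)
    = ennreal (1 - exp (- (LINT v:{0..t}|lborel. a v)))"
proof -
  have K: "0 \<le> K" using a[of 0] by linarith
  have int: "set_integrable lborel {r..s} a" for r s
  proof (rule set_integrable_bound)
    show "set_integrable lborel {r..s} (\<lambda>_. K)" by (rule borel_integrable_atLeastAtMost') auto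
  qed (use a K in \<open>auto simp: set_borel_measurable_def\<close>)
  define B where "B s = (LINT v:{s..t}|lborel. a v)" for s
  define G where "G s = exp (- B s)" for s
  have le: "(LINT v:{r..s}|lborel. a v) \<le> K * (s - r)" if "r \<le> s" for r s
  proof -
    have "(LINT v:{r..s}|lborel. a v) \<le> (LINT v:{r..s}|lborel. K)"
      by (rule set_integral_mono[OF int]) (use a in \<open>auto intro!: borel_integrable_atLeastAtMost'\<close>)
    also have "\<dots> = K * (s - r)" using that by (simp add: set_lebesgue_integral_def)
    finally show ?thesis .
  qed
  have nn: "0 \<le> (LINT v:{r..s}|lborel. a v)" for r s
    unfolding set_lebesgue_integral_def by (intro integral_nonneg_AE) (auto simp: a)
  have B_split: "B r = (LINT v:{r..s}|lborel. a v) + B s" if "r \<le> s" "s \<le> t" for r s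
  proof -
    have "B r = (LINT v:{r..s} \<union> {s<..t}|lborel. a v)"
      unfolding B_def using that by (intro arg_cong2[where f="\<lambda>A f. set_lebesgue_integral lborel A f"]) auto
    also have "\<dots> = (LINT v:{r..s}|lborel. a v) + (LINT v:{s<..t}|lborel. a v)"
      by (rule set_integral_Un) (use int[of s t] in \<open>auto intro: int set_integrable_subset\<close>)
    also have "(LINT v:{s<..t}|lborel. a v) = B s"
      unfolding B_def set_lebesgue_integral_def
      by (intro Bochner_Integration.integral_cong_AE eventually_mono[OF AE_lborel_singleton[of s]]) (auto simp: indicator_def)
    finally show ?thesis .
  qed
  have G_mono: "G r \<le> G s" if "r \<le> s" "s \<le> t" for r s
    using B_split[OF that] nn[of r s] by (simp add: G_def)
  have G_le: "0 < G s" "G s \<le> 1" for s using nn[of s t] by (simp_all add: G_def B_def)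
  have [measurable]: "G \<in> borel_measurable borel"
  proof -
    have "(\<lambda>(s, v). indicator {s..t} v *\<^sub>R a v) \<in> borel_measurable (borel \<Otimes>\<^sub>M lborel)"
      unfolding indicator_def atLeastAtMost_iff case_prod_beta' by measurable
    then have "B \<in> borel_measurable borel"
      unfolding B_def[abs_def] set_lebesgue_integral_def by (intro lborel.borel_measurable_lebesgue_integral)
    then show ?thesis unfolding G_def by measurable
  qed
  have intG: "set_integrable lborel {r..s} (\<lambda>v. a v * G v)" for r s
  proof (rule set_integrable_bound[OF int])
    show "AE v in lborel. v \<in> {r..s} \<longrightarrow> norm (a v * G v) \<le> norm (a v)"
      using a G_le by (auto simp: abs_mult mult_left_le less_imp_le intro!: AE_I2)
  qed (auto simp: set_borel_measurable_def)
  define F where "F s = G s - (LINT v:{0..s}|lborel. a v * G v)" for s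
  \<comment> \<open>With d the integral of a over [r, s], both 1 - e^(-d) and I / G(s) lie between d
    e^(-d) and d. The increment of F is thus at most d (1 - e^(-d)) \<le> d^2.\<close>
  have quad: "\<bar>F s - F r\<bar> \<le> K\<^sup>2 * (s - r)\<^sup>2" if "0 \<le> r" "r \<le> s" "s \<le> t" for r s
  proof -
    define d where "d = (LINT v:{r..s}|lborel. a v)"
    have d: "0 \<le> d" "d \<le> K * (s - r)" using nn le that by (auto simp: d_def)
    define I where "I = (LINT v:{r..s}|lborel. a v * G v)"
    have I_split: "(LINT v:{0..s}|lborel. a v * G v) = (LINT v:{0..r}|lborel. a v * G v) + I"
    proof -
      have "(LINT v:{0..s}|lborel. a v * G v) = (LINT v:{0..r} \<union> {r<..s}|lborel. a v * G v)"
        using that by (intro arg_cong2[where f="\<lambda>A f. set_lebesgue_integral lborel A f"]) auto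
      also have "\<dots> = (LINT v:{0..r}|lborel. a v * G v) + (LINT v:{r<..s}|lborel. a v * G v)"
        by (rule set_integral_Un) (use intG[of r s] in \<open>auto intro: intG set_integrable_subset\<close>)
      also have "(LINT v:{r<..s}|lborel. a v * G v) = I"
        unfolding I_def set_lebesgue_integral_def
        by (intro Bochner_Integration.integral_cong_AE eventually_mono[OF AE_lborel_singleton[of r]]) (auto simp: indicator_def)
      finally show ?thesis .
    qed
    have "I \<le> (LINT v:{r..s}|lborel. a v * G s)"
      unfolding I_def
      by (rule set_integral_mono[OF intG]) (use int G_mono that a in \<open>auto intro!: mult_left_mono\<close>)
    then have I1: "I \<le> G s * d" by (simp add: d_def mult.commute)
    have "(LINT v:{r..s}|lborel. a v * G r) \<le> I"
      unfolding I_def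
      by (rule set_integral_mono[OF _ intG]) (use int G_mono that a in \<open>auto intro!: mult_left_mono\<close>)
    then have I2: "d * G r \<le> I" by (simp add: d_def)
    have Gr: "G r = G s * exp (- d)"
      using B_split[of r s] that by (simp add: G_def d_def exp_add[symmetric])
    have e1: "1 - d \<le> exp (- d)" using exp_ge_add_one_self[of "- d"] by simp
    have e2: "exp (- d) * (1 + d) \<le> 1"
      using exp_ge_add_one_self[of d] mult_left_mono[of "1 + d" "exp d" "exp (- d)"]
      by (simp add: exp_add[symmetric])
    have "F s - F r = G s * (1 - exp (- d)) - I" using I_split Gr by (simp add: F_def algebra_simps)
    moreover have "G s * (1 - exp (- d)) \<le> G s * d" using e1 G_le[of s] by (intro mult_left_mono) auto
    moreover have "G s * (d * exp (- d)) \<le> I" using I2 Gr by (simp add: mult_ac)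
    moreover have "G s * (1 - exp (- d)) \<ge> G s * (d * exp (- d))"
      using e2 G_le[of s] by (intro mult_left_mono) (auto simp: algebra_simps)
    ultimately have "\<bar>F s - F r\<bar> \<le> G s * d - G s * (d * exp (- d))"
      using I1 unfolding abs_le_iff by linarith
    also have "\<dots> = G s * (d * (1 - exp (- d)))" by (simp add: algebra_simps)
    also have "\<dots> \<le> 1 * (d * d)"
      using G_le[of s] d e1 by (intro mult_mono mult_nonneg_nonneg) auto
    also have "\<dots> \<le> (K * (s - r)) * (K * (s - r))"
      using d by (simp add: mult_mono)
    finally show ?thesis by (simp add: power2_eq_square algebra_simps)
  qed
  have "F t = F 0"
  proof (cases "t = 0")
    case False
    then have "0 < t" using assms by simp
    have der: "(F has_real_derivative 0) (at x within {0..t})" if x: "x \<in> {0..t}" for x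
    proof -
      have "((\<lambda>y. (F y - F x) / (y - x)) \<longlongrightarrow> 0) (at x within {0..t})"
      proof (rule Lim_null_comparison)
        show "\<forall>\<^sub>F y in at x within {0..t}. norm ((F y - F x) / (y - x)) \<le> K\<^sup>2 * \<bar>y - x\<bar>"
        proof -
          have "norm ((F y - F x) / (y - x)) \<le> K\<^sup>2 * \<bar>y - x\<bar>" if "y \<in> {0..t}" "y \<noteq> x" for y
          proof -
            have "\<bar>F y - F x\<bar> \<le> K\<^sup>2 * (y - x)\<^sup>2"
              using quad[of x y] quad[of y x] x that
              by (cases "x \<le> y") (auto simp: abs_minus_commute power2_commute)
            then show ?thesis using that by (simp add: abs_divide divide_simps power2_eq_square abs_mult mult.assoc)
          qed
          then show ?thesis by (auto simp: eventually_at_filter)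
        qed
        have "((\<lambda>y. K\<^sup>2 * \<bar>y - x\<bar>) \<longlongrightarrow> K\<^sup>2 * \<bar>x - x\<bar>) (at x within {0..t})"
          by (intro tendsto_intros)
        then show "((\<lambda>y. K\<^sup>2 * \<bar>y - x\<bar>) \<longlongrightarrow> 0) (at x within {0..t})" by simp
      qed
      then show ?thesis by (simp add: has_field_derivative_iff)
    qed
    obtain C where "\<And>x. x \<in> {0..t} \<Longrightarrow> F x = C"
      using has_field_derivative_zero_constant[of "{0..t}" F, OF _ der] by auto
    from this[of t] this[of 0] show ?thesis using \<open>0 < t\<close> by simp
  qed simp
  moreover have "G t = 1"
  proof -
    have "B t = 0" unfolding B_def set_lebesgue_integral_def
      by (intro integral_eq_zero_AE eventually_mono[OF AE_lborel_singleton[of t]]) (auto simp: indicator_def)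
    then show ?thesis by (simp add: G_def)
  qed
  moreover have "(LINT v:{0..0}|lborel. a v * G v) = 0"
    unfolding set_lebesgue_integral_def
    by (intro integral_eq_zero_AE eventually_mono[OF AE_lborel_singleton[of 0]]) (auto simp: indicator_def)
  ultimately have *: "(LINT v:{0..t}|lborel. a v * G v) = 1 - G 0" by (simp add: F_def)
  have "(\<integral>\<^sup>+s\<in>{0..t}. ennreal (a s * G s) \<partial>lborel) = (\<integral>\<^sup>+s. ennreal (indicator {0..t} s *\<^sub>R (a s * G s)) \<partial>lborel)"
    by (intro nn_integral_cong) (auto simp: indicator_def)
  also have "\<dots> = ennreal (LINT v:{0..t}|lborel. a v * G v)"
    unfolding set_lebesgue_integral_def
    using intG[of 0 t] a G_le by (intro nn_integral_eq_integral) (auto simp: set_integrable_def less_imp_le)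
  finally show ?thesis using * by (simp add: G_def B_def)
qed

section \<open>Increments, Markov property and time reversal\<close>

text \<open>On countable products the cylinder sets determine a law, and conditions on all
  coordinates are measurable. \<open>rats1\<close> indexes a past rescaled from [0, s] to [0, 1], so
  that its index set does not depend on s.\<close>

definition rats0 :: "real set" where "rats0 = \<rat> \<inter> {0..}"
definition rats1 :: "real set" where "rats1 = \<rat> \<inter> {0..1}"

abbreviation paths0 :: "(real \<Rightarrow> real) measure" where "paths0 \<equiv> PiM rats0 (\<lambda>_. borel)"
abbreviation paths1 :: "(real \<Rightarrow> real) measure" where "paths1 \<equiv> PiM rats1 (\<lambda>_. borel)"

lemma countable_rats [simp]: "countable rats0" "countable rats1"
  by (auto simp: rats0_def rats1_def countable_rat)

lemma rats1_subset: "rats1 \<subseteq> rats0"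
  by (auto simp: rats0_def rats1_def)

lemma rats_fraction: "real k / real N \<in> rats0" "k \<le> N \<Longrightarrow> real k / real N \<in> rats1"
  by (auto simp: rats0_def rats1_def divide_le_eq_1)

text \<open>Places finitely many rational times on one equidistant grid, where the joint law of the
  increments is available.\<close>

lemma common_denominator:
  assumes "finite J" and "J \<subseteq> rats0"
  obtains N k where "0 < N" and "\<And>j. j \<in> J \<Longrightarrow> j = real (k j) / real N"
proof -
  have "\<exists>N>0. \<forall>j\<in>J. \<exists>k::nat. j = real k / real N"
    using assms
  proof induction
    case empty
    show ?case by (intro exI[of _ 1]) simp
  next
    case (insert x F)
    then obtain N where N: "N > 0" "\<forall>j\<in>F. \<exists>k::nat. j = real k / real N" by blast
    have "x \<in> \<rat>" "0 \<le> x" using insert.prems by (auto simp: rats0_def)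
    then obtain p q :: nat where x: "q \<noteq> 0" "x = real p / real q"
      by (metis Rats_abs_nat_div_natE abs_of_nonneg)
    have "\<exists>k::nat. j = real k / real (N * q)" if j: "j \<in> insert x F" for j
    proof (cases "j = x")
      case True
      have "x = real (p * N) / real (N * q)" using x N(1) by simp
      with True show ?thesis by blast
    next
      case False
      then have "j \<in> F" using j by simp
      then obtain k :: nat where k: "j = real k / real N" using N(2) by blast
      have "real k / real N = real (k * q) / real (N * q)" using x(1) by simp
      with k show ?thesis by metis
    qed
    then show ?case using N(1) x(1) by (intro exI[of _ "N * q"]) simp
  qed
  then obtain N where N: "N > 0" "\<forall>j\<in>J. \<exists>k::nat. j = real k / real N" by blast
  then obtain k where "\<forall>j\<in>J. j = real (k j) / real N" by metis
  with N(1) show ?thesis by (intro that[of N k]) blast+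
qed

text \<open>On a grid of step 1/N a path that starts at 0 consists of the partial sums of its
  increments, so the increment laws over all grids determine all cylinder probabilities.\<close>

lemma (in prob_space) law_eqI_increments:
  fixes Y Z :: "real \<Rightarrow> 'a \<Rightarrow> real"
  assumes I: "I \<subseteq> rats0" and I_down: "\<And>n N k. real n / real N \<in> I \<Longrightarrow> k \<le> n \<Longrightarrow> real k / real N \<in> I"
    and Y [measurable]: "\<And>r. r \<in> I \<Longrightarrow> Y r \<in> borel_measurable M"
    and Z [measurable]: "\<And>r. r \<in> I \<Longrightarrow> Z r \<in> borel_measurable M"
    and Y0: "\<And>w. w \<in> space M \<Longrightarrow> Y 0 w = 0" and Z0: "\<And>w. w \<in> space M \<Longrightarrow> Z 0 w = 0"
    and incr: "\<And>N n. 0 < N \<Longrightarrow> 0 < n \<Longrightarrow> real n / real N \<in> I \<Longrightarrow>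
      distr M (PiM {..<n} (\<lambda>_. borel)) (\<lambda>w. \<lambda>i\<in>{..<n}. Y (real (Suc i) / real N) w - Y (real i / real N) w)
      = distr M (PiM {..<n} (\<lambda>_. borel)) (\<lambda>w. \<lambda>i\<in>{..<n}. Z (real (Suc i) / real N) w - Z (real i / real N) w)"
  shows "distr M (PiM I (\<lambda>_. borel)) (\<lambda>w. \<lambda>r\<in>I. Y r w) = distr M (PiM I (\<lambda>_. borel)) (\<lambda>w. \<lambda>r\<in>I. Z r w)"
proof (rule measure_eqI_PiM_infinite)
  fix A J assume J: "finite J" "J \<subseteq> I" and A: "\<And>i. i \<in> J \<Longrightarrow> A i \<in> sets (borel :: real measure)"
  obtain N k where N: "0 < N" and k: "\<And>j. j \<in> J \<Longrightarrow> j = real (k j) / real N"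
    using common_denominator[OF J(1)] J(2) I by blast
  \<comment> \<open>The inserted 0 gives \<open>Max\<close> a value for empty \<open>J\<close>. For
    nonempty \<open>J\<close> the maximum belongs to a time in \<open>J\<close>, so by
    \<open>I_down\<close> the grid up to n stays inside \<open>I\<close>.\<close>
  define n where "n = Max (insert 0 (k ` J))"
  have kn: "k j \<le> n" if "j \<in> J" for j
    unfolding n_def using that J by (intro Max_ge) auto
  define incrs where "incrs U w = (\<lambda>i\<in>{..<n}. U (real (Suc i) / real N) w - U (real i / real N) w)"
    for U :: "real \<Rightarrow> 'a \<Rightarrow> real" and w
  have nI: "real n / real N \<in> I" if "J \<noteq> {}"
  proof -
    have "n \<in> insert 0 (k ` J)" unfolding n_def using J by (intro Max_in) auto
    then have "n \<in> k ` J" using kn that by fastforce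
    then show ?thesis using k J by force
  qed
  have incr_meas: "incrs U \<in> measurable M (PiM {..<n} (\<lambda>_. borel))"
    if "\<And>r. r \<in> I \<Longrightarrow> U r \<in> borel_measurable M" "J \<noteq> {}" for U
  proof -
    have "U (real i / real N) \<in> borel_measurable M" if "i \<le> n" for i
      using \<open>\<And>r. r \<in> I \<Longrightarrow> U r \<in> borel_measurable M\<close> I_down[OF nI that] \<open>J \<noteq> {}\<close> by auto
    then show ?thesis unfolding incrs_def
      by (intro measurable_restrict borel_measurable_diff) (auto simp del: of_nat_Suc)
  qed
  have eqd: "distr M (PiM {..<n} (\<lambda>_. borel)) (incrs Y) = distr M (PiM {..<n} (\<lambda>_. borel)) (incrs Z)"
    if "J \<noteq> {}"
  proof (cases "n = 0")
    case True
    then have "incrs Y = incrs Z" by (auto simp: incrs_def fun_eq_iff)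
    then show ?thesis by simp
  next
    case False
    then show ?thesis using incr[OF N _ nI[OF that]] unfolding incrs_def[abs_def] by simp
  qed
  define S where "S = {\<delta> \<in> space (PiM {..<n} (\<lambda>_. borel :: real measure)). \<forall>j\<in>J. (\<Sum>i<k j. \<delta> i) \<in> A j}"
  have S: "S \<in> sets (PiM {..<n} (\<lambda>_. borel))"
  proof -
    have meas: "(\<lambda>\<delta>. \<Sum>i<k j. \<delta> i :: real) \<in> borel_measurable (PiM {..<n} (\<lambda>_. borel))" if "j \<in> J" for j
      using kn[OF that] by (intro borel_measurable_sum[where f="\<lambda>i \<delta>. \<delta> i"] measurable_component_singleton) auto
    then have "{\<delta> \<in> space (PiM {..<n} (\<lambda>_. borel :: real measure)). (\<Sum>i<k j. \<delta> i) \<in> A j} \<in> sets (PiM {..<n} (\<lambda>_. borel))" if "j \<in> J" for j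
        using measurable_sets_Collect[OF meas[OF that], of "\<lambda>x. x \<in> A j"] A[OF that] by simp
      then show ?thesis unfolding S_def using J
        by (intro sets.sets_Collect_finite_All) auto
  qed
  have eq: "emeasure (distr M (PiM I (\<lambda>_. borel)) (\<lambda>w. \<lambda>r\<in>I. U r w)) (prod_emb I (\<lambda>_. borel) J (Pi\<^sub>E J A))
      = emeasure (distr M (PiM {..<n} (\<lambda>_. borel)) (incrs U)) S"
    if U: "\<And>r. r \<in> I \<Longrightarrow> U r \<in> borel_measurable M" and U0: "\<And>w. w \<in> space M \<Longrightarrow> U 0 w = 0" and "J \<noteq> {}" for U
  proof -
    have "(\<lambda>w. \<lambda>r\<in>I. U r w) \<in> measurable M (PiM I (\<lambda>_. borel))"
      using U by (intro measurable_restrict) auto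
    moreover have "prod_emb I (\<lambda>_. borel) J (Pi\<^sub>E J A) \<in> sets (PiM I (\<lambda>_. borel))"
      using J A by (intro sets_PiM_I) auto
    moreover have "(\<lambda>w. \<lambda>r\<in>I. U r w) -` prod_emb I (\<lambda>_. borel) J (Pi\<^sub>E J A) \<inter> space M = incrs U -` S \<inter> space M"
    proof -
      have tel: "(\<Sum>i<k j. incrs U w i) = U j w" if "j \<in> J" "w \<in> space M" for j w
      proof -
        have "(\<Sum>i<k j. incrs U w i) = (\<Sum>i<k j. U (real (Suc i) / real N) w - U (real i / real N) w)"
          using kn[OF that(1)] by (intro sum.cong) (auto simp: incrs_def)
        also have "\<dots> = U (real (k j) / real N) w - U (real 0 / real N) w"
          by (rule sum_lessThan_telescope)
        finally show ?thesis using k[OF that(1)] U0[OF that(2)] by simp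
      qed
      then show ?thesis unfolding S_def incrs_def using J(2)
        by (auto simp: prod_emb_iff PiE_iff space_PiM subset_eq)
    qed
    ultimately show ?thesis
      using S incr_meas[OF U] \<open>J \<noteq> {}\<close> by (simp add: emeasure_distr)
  qed
  show "emeasure (distr M (PiM I (\<lambda>_. borel)) (\<lambda>w. \<lambda>r\<in>I. Y r w)) (prod_emb I (\<lambda>_. borel) J (Pi\<^sub>E J A))
    = emeasure (distr M (PiM I (\<lambda>_. borel)) (\<lambda>w. \<lambda>r\<in>I. Z r w)) (prod_emb I (\<lambda>_. borel) J (Pi\<^sub>E J A))"
  proof (cases "J = {}")
    case True
    have one: "emeasure (distr M (PiM I (\<lambda>_. borel)) (\<lambda>w. \<lambda>r\<in>I. U r w)) (space (PiM I (\<lambda>_. borel))) = 1"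
      if "\<And>r. r \<in> I \<Longrightarrow> U r \<in> borel_measurable M" for U
    proof -
      have "prob_space (distr M (PiM I (\<lambda>_. borel)) (\<lambda>w. \<lambda>r\<in>I. U r w))"
        using that by (intro prob_space_distr measurable_restrict) auto
      from prob_space.emeasure_space_1[OF this] show ?thesis by simp
    qed
    have "prod_emb I (\<lambda>_. borel) J (Pi\<^sub>E J A) = space (PiM I (\<lambda>_. borel))"
      unfolding True by (auto simp: prod_emb_def space_PiM)
    then show ?thesis using one[of Y, OF Y] one[of Z, OF Z] by simp
  next
    case False
    then show ?thesis using eq[of Y, OF Y Y0] eq[of Z, OF Z Z0] eqd by simp
  qed
next
  have "prob_space (distr M (PiM I (\<lambda>_. borel)) (\<lambda>w. \<lambda>r\<in>I. Y r w))"
    by (intro prob_space_distr measurable_restrict) auto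
  then show "finite_measure (distr M (PiM I (\<lambda>_. borel)) (\<lambda>w. \<lambda>r\<in>I. Y r w))"
    by (rule prob_space.finite_measure)
qed simp_all

text \<open>The start at 0 is required at every sample point, so that identities between paths hold
  without exceptional sets. The final theorem reduces to this case.\<close>

locale levy_process_from_zero = levy_process +
  assumes X_start: "\<And>w. w \<in> space M \<Longrightarrow> X 0 w = 0"
begin

lemma X_meas [measurable]: "0 \<le> t \<Longrightarrow> X t \<in> borel_measurable M"
  by (rule random_variable_X)

lemma increments_law:
  assumes s: "0 \<le> s" and h: "0 \<le> h" and n: "0 < n"
  shows "distr M (PiM {..<n} (\<lambda>_. borel)) (\<lambda>w. \<lambda>i\<in>{..<n}. X (s + real (Suc i) * h) w - X (s + real i * h) w)
    = PiM {..<n} (\<lambda>_. distr M borel (X h))"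
proof -
  define t where "t i = s + real i * h" for i
  have t: "0 \<le> t i" "t i \<le> t (Suc i)" for i
    using s h by (auto simp: t_def algebra_simps)
  have "indep_vars (\<lambda>_. borel) (\<lambda>i w. X (t (Suc i)) w - X (t i) w) {..<n}"
    using t by (intro independent_increments)
  then have "distr M (PiM {..<n} (\<lambda>_. borel)) (\<lambda>w. \<lambda>i\<in>{..<n}. X (t (Suc i)) w - X (t i) w)
    = PiM {..<n} (\<lambda>i. distr M borel (\<lambda>w. X (t (Suc i)) w - X (t i) w))"
    using t n by (subst indep_vars_iff_distr_eq_PiM'[symmetric]) auto
  moreover have "distr M borel (\<lambda>w. X (t (Suc i)) w - X (t i) w) = distr M borel (X h)" for i
    using stationary_increments[OF t(1)[of i] h] by (simp add: t_def algebra_simps)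
  ultimately show ?thesis by (simp add: t_def)
qed

abbreviation future :: "real \<Rightarrow> 'a \<Rightarrow> real \<Rightarrow> real" where
  "future s w \<equiv> (\<lambda>r\<in>rats0. X (s + r) w - X s w)"

abbreviation past :: "real \<Rightarrow> 'a \<Rightarrow> real \<Rightarrow> real" where
  "past s w \<equiv> (\<lambda>q\<in>rats1. X (s * q) w)"

lemma future_measurable [measurable]: "0 \<le> s \<Longrightarrow> future s \<in> measurable M paths0"
  by (intro measurable_restrict borel_measurable_diff X_meas) (auto simp: rats0_def)

lemma past_measurable [measurable]: "0 \<le> s \<Longrightarrow> past s \<in> measurable M paths1"
  by (intro measurable_restrict X_meas) (auto simp: rats1_def)

lemma future_law:
  assumes "0 \<le> s"
  shows "distr M paths0 (future s) = distr M paths0 (\<lambda>w. \<lambda>r\<in>rats0. X r w)"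
proof (rule law_eqI_increments)
  fix N n :: nat assume N: "0 < N" and n: "0 < n"
  have e: "s + real k / real N = s + real k * (1 / real N)" "real k / real N = 0 + real k * (1 / real N)" for k
    by auto
  have "(\<lambda>w. \<lambda>i\<in>{..<n}. (X (s + real (Suc i) / real N) w - X s w) - (X (s + real i / real N) w - X s w))
    = (\<lambda>w. \<lambda>i\<in>{..<n}. X (s + real (Suc i) * (1 / real N)) w - X (s + real i * (1 / real N)) w)"
    by (intro ext restrict_ext) simp
  moreover have "(\<lambda>w. \<lambda>i\<in>{..<n}. X (real (Suc i) / real N) w - X (real i / real N) w)
    = (\<lambda>w. \<lambda>i\<in>{..<n}. X (0 + real (Suc i) * (1 / real N)) w - X (0 + real i * (1 / real N)) w)"
    by (intro ext restrict_ext) simp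
  ultimately show "distr M (PiM {..<n} (\<lambda>_. borel)) (\<lambda>w. \<lambda>i\<in>{..<n}. (X (s + real (Suc i) / real N) w - X s w) - (X (s + real i / real N) w - X s w))
      = distr M (PiM {..<n} (\<lambda>_. borel)) (\<lambda>w. \<lambda>i\<in>{..<n}. X (real (Suc i) / real N) w - X (real i / real N) w)"
    using increments_law[of s "1 / real N" n] increments_law[of 0 "1 / real N" n] assms n by (simp only: divide_nonneg_nonneg zero_le_one of_nat_0_le_iff order_refl)
qed (use assms X_start in \<open>auto simp: rats0_def intro!: X_meas borel_measurable_diff\<close>)

text \<open>On an equidistant grid the increments are independent with one common law. Reversal
  permutes them, and a product of equal factors is invariant under reindexing.\<close>

lemma reversal_law:
  assumes "0 \<le> t"
  shows "distr M paths1 (past t)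
    = distr M paths1 (\<lambda>w. \<lambda>q\<in>rats1. X t w - X (t - t * q) w)"
proof (rule law_eqI_increments)
  fix N n :: nat assume N: "0 < N" and n: "0 < n" and "real n / real N \<in> rats1"
  then have nN: "n \<le> N" by (simp add: rats1_def divide_le_eq_1)
  define h where "h = t / real N"
  have h: "0 \<le> h" using assms by (simp add: h_def)
  interpret \<mu>: prob_space "distr M borel (X h)" by (intro prob_space_distr X_meas h)
  have "(\<lambda>w. \<lambda>i\<in>{..<n}. X (t * (real (Suc i) / real N)) w - X (t * (real i / real N)) w)
      = (\<lambda>w. \<lambda>i\<in>{..<n}. X (0 + real (Suc i) * h) w - X (0 + real i * h) w)"
    by (intro ext restrict_ext) (simp add: h_def mult.commute)
  then have 1: "distr M (PiM {..<n} (\<lambda>_. borel)) (\<lambda>w. \<lambda>i\<in>{..<n}. X (t * (real (Suc i) / real N)) w - X (t * (real i / real N)) w)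
    = PiM {..<n} (\<lambda>_. distr M borel (X h))"
    using increments_law[of 0 h n] h n by simp
  let ?\<Delta> = "\<lambda>w. \<lambda>i\<in>{..<N}. X (0 + real (Suc i) * h) w - X (0 + real i * h) w"
  \<comment> \<open>The i-th increment of the reversed path is the increment of X over the cell with
    index N - 1 - i.\<close>
  let ?rev = "\<lambda>\<delta>. \<lambda>i\<in>{..<n}. \<delta> (N - 1 - i) :: real"
  have "(\<lambda>w. \<lambda>i\<in>{..<n}. (X t w - X (t - t * (real (Suc i) / real N)) w) - (X t w - X (t - t * (real i / real N)) w))
      = ?rev \<circ> ?\<Delta>"
  proof (intro ext)
    fix w i
    show "(\<lambda>i\<in>{..<n}. (X t w - X (t - t * (real (Suc i) / real N)) w) - (X t w - X (t - t * (real i / real N)) w)) i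
      = (?rev \<circ> ?\<Delta>) w i"
    proof (cases "i < n")
      case True
      have "real (Suc (N - Suc i)) * h = t - t * (real i / real N)" "real (N - Suc i) * h = t - t * (real (Suc i) / real N)"
        using True nN N unfolding h_def by (simp_all add: of_nat_diff field_simps)
      then show ?thesis using True nN by simp
    qed simp
  qed
  moreover have "distr M (PiM {..<n} (\<lambda>_. borel)) (?rev \<circ> ?\<Delta>)
    = distr (distr M (PiM {..<N} (\<lambda>_. borel)) ?\<Delta>) (PiM {..<n} (\<lambda>_. borel)) ?rev"
  proof (rule distr_distr[symmetric])
    show "?rev \<in> measurable (PiM {..<N} (\<lambda>_. borel)) (PiM {..<n} (\<lambda>_. borel))"
      using nN N by (intro measurable_restrict measurable_component_singleton) auto
    show "?\<Delta> \<in> measurable M (PiM {..<N} (\<lambda>_. borel))"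
      using h by (intro measurable_restrict borel_measurable_diff X_meas) auto
  qed
  moreover have "\<dots> = distr (PiM {..<N} (\<lambda>_. distr M borel (X h))) (PiM {..<n} (\<lambda>_. distr M borel (X h))) ?rev"
    using increments_law[of 0 h N] h N by (intro distr_cong) (auto intro!: sets_PiM_cong)
  moreover have "\<dots> = PiM {..<n} (\<lambda>_. distr M borel (X h))"
    using nN N by (intro distr_PiM_reindex[where f="\<lambda>i. N - 1 - i" and M="\<lambda>_. distr M borel (X h)"] \<mu>.prob_space_axioms)
      (auto simp: inj_on_def)
  ultimately show "distr M (PiM {..<n} (\<lambda>_. borel)) (\<lambda>w. \<lambda>i\<in>{..<n}. X (t * (real (Suc i) / real N)) w - X (t * (real i / real N)) w)
    = distr M (PiM {..<n} (\<lambda>_. borel)) (\<lambda>w. \<lambda>i\<in>{..<n}. (X t w - X (t - t * (real (Suc i) / real N)) w) - (X t w - X (t - t * (real i / real N)) w))"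
    using 1 by simp
next
  fix n N k assume "real n / real N \<in> rats1" "k \<le> n"
  then show "real k / real N \<in> rats1"
    by (cases "N = 0") (auto simp: rats1_def divide_le_eq_1)
next
  fix r assume "r \<in> rats1"
  then show "X (t * r) \<in> borel_measurable M" "(\<lambda>w. X t w - X (t - t * r) w) \<in> borel_measurable M"
    using assms by (auto simp: rats1_def mult_left_le intro!: X_meas borel_measurable_diff)
qed (use rats1_subset X_start in auto)

text \<open>Cylinder sets form intersection-stable generators of both sigma-algebras. For two
  cylinders one finite sequence of times suffices: the past depends on a first block of increments
  and the future on a second, disjoint one.\<close>

lemma past_future_indep:
  assumes s: "0 \<le> s"
  shows "indep_var paths1 (past s) paths0 (future s)"
proof -
  let ?P1 = "prod_algebra rats1 (\<lambda>_. borel :: real measure)" and ?P0 = "prod_algebra rats0 (\<lambda>_. borel :: real measure)"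
  let ?A = "{past s -` E \<inter> space M | E. E \<in> ?P1}" and ?B = "{future s -` F \<inter> space M | F. F \<in> ?P0}"
  have stable: "Int_stable {f -` E \<inter> space M | E. E \<in> prod_algebra I (\<lambda>_. borel :: real measure)}"
    for f :: "'a \<Rightarrow> real \<Rightarrow> real" and I
  proof (rule Int_stableI, clarify)
    fix E F assume "E \<in> prod_algebra I (\<lambda>_. borel :: real measure)" "F \<in> prod_algebra I (\<lambda>_. borel :: real measure)"
    then have "E \<inter> F \<in> prod_algebra I (\<lambda>_. borel :: real measure)"
      using Int_stable_prod_algebra by (auto simp: Int_stable_def)
    then show "\<exists>G. (f -` E \<inter> space M) \<inter> (f -` F \<inter> space M) = f -` G \<inter> space M \<and> G \<in> prod_algebra I (\<lambda>_. borel)"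
      by (intro exI[of _ "E \<inter> F"]) auto
  qed
  have gen: "sigma_sets (space M) {f -` A \<inter> space M | A. A \<in> sets (PiM I (\<lambda>_. borel :: real measure))}
      = sigma_sets (space M) {f -` E \<inter> space M | E. E \<in> prod_algebra I (\<lambda>_. borel :: real measure)}"
    if f: "f \<in> measurable M (PiM I (\<lambda>_. borel :: real measure))" for f :: "'a \<Rightarrow> real \<Rightarrow> real" and I
  proof -
    have "f \<in> space M \<rightarrow> (\<Pi>\<^sub>E i\<in>I. space (borel :: real measure))"
      using measurable_space[OF f] by (auto simp: space_PiM)
    from sigma_sets_vimage_commute[OF this, of "prod_algebra I (\<lambda>_. borel)"]
    have "{f -` A \<inter> space M | A. A \<in> sets (PiM I (\<lambda>_. borel :: real measure))}
      = sigma_sets (space M) {f -` E \<inter> space M | E. E \<in> prod_algebra I (\<lambda>_. borel :: real measure)}"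
      by (simp add: sets_PiM)
    then show ?thesis by (simp add: sigma_sets_sigma_sets_eq) (subst sigma_sets_sigma_sets_eq, auto)
  qed
  have "indep_set ?A ?B"
    unfolding indep_sets2_eq
  proof (intro conjI ballI)
    show "?A \<subseteq> events"
      using s by (auto intro!: measurable_sets[OF past_measurable] simp: sets_PiM)
    show "?B \<subseteq> events"
      using s by (auto intro!: measurable_sets[OF future_measurable] simp: sets_PiM)
  next
    fix a b assume "a \<in> ?A" "b \<in> ?B"
    then obtain E F where a: "a = past s -` E \<inter> space M" "E \<in> ?P1"
      and b: "b = future s -` F \<inter> space M" "F \<in> ?P0" by auto
    from prod_algebraE[OF a(2)] obtain J E' where E: "E = prod_emb rats1 (\<lambda>_. borel) J (Pi\<^sub>E J E')"
      and J: "finite J" "J \<subseteq> rats1" "\<And>i. i \<in> J \<Longrightarrow> E' i \<in> sets (borel :: real measure)" by metis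
    from prod_algebraE[OF b(2)] obtain K F' where F: "F = prod_emb rats0 (\<lambda>_. borel) K (Pi\<^sub>E K F')"
      and K: "finite K" "K \<subseteq> rats0" "\<And>i. i \<in> K \<Longrightarrow> F' i \<in> sets (borel :: real measure)" by metis
    obtain m k where m: "0 < m" and k: "\<And>j. j \<in> J \<union> K \<Longrightarrow> j = real (k j) / real m"
      using common_denominator[of "J \<union> K"] J K rats1_subset by blast
    define n where "n = Max (insert 0 (k ` K))"
    have kn: "k j \<le> n" if "j \<in> K" for j unfolding n_def using that K by (intro Max_ge) auto
    have km: "k j \<le> m" if "j \<in> J" for j
    proof -
      have "j \<le> 1" using that J(2) by (auto simp: rats1_def)
      then have "real (k j) / real m \<le> 1" using k[of j] that by (metis UnI1)
      then show ?thesis using m by (simp add: divide_le_eq_1)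
    qed
    \<comment> \<open>The first m steps have length s/m and cut up [0, s], which absorbs the factor
      s in \<open>past\<close>; after s the steps have length 1/m.\<close>
    define t where "t i = (if i \<le> m then s * (real i / real m) else s + real (i - m) / real m)" for i
    have t_mono: "t i \<le> t (Suc i)" for i
    proof (cases "Suc i \<le> m")
      case True
      then show ?thesis using s m by (auto simp: t_def intro!: mult_left_mono divide_right_mono)
    next
      case False
      then show ?thesis using m by (cases "i = m") (auto simp: t_def intro!: divide_right_mono)
    qed
    have t_nonneg: "0 \<le> t i" for i using s by (auto simp: t_def)
    define \<Delta> where "\<Delta> i w = X (t (Suc i)) w - X (t i) w" for i w
    have [measurable]: "\<Delta> i \<in> borel_measurable M" for i
      unfolding \<Delta>_def using t_nonneg by (intro borel_measurable_diff X_meas)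
    have ind: "indep_vars (\<lambda>_. borel) \<Delta> {..<m + n}"
      unfolding \<Delta>_def using t_nonneg t_mono by (intro independent_increments)
    have iv: "indep_var (PiM {..<m} (\<lambda>_. borel)) (\<lambda>w. restrict (\<lambda>i. \<Delta> i w) {..<m})
        (PiM {m..<m+n} (\<lambda>_. borel)) (\<lambda>w. restrict (\<lambda>i. \<Delta> i w) {m..<m+n})"
      by (rule indep_var_restrict[OF ind]) auto
    define S1 where "S1 = {\<delta> \<in> space (PiM {..<m} (\<lambda>_. borel :: real measure)). \<forall>j\<in>J. (\<Sum>i<k j. \<delta> i) \<in> E' j}"
    define S2 where "S2 = {\<delta> \<in> space (PiM {m..<m+n} (\<lambda>_. borel :: real measure)). \<forall>j\<in>K. (\<Sum>i<k j. \<delta> (m + i)) \<in> F' j}"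
    have S1: "S1 \<in> sets (PiM {..<m} (\<lambda>_. borel))"
    proof -
      have meas: "(\<lambda>\<delta>. \<Sum>i<k j. \<delta> i :: real) \<in> borel_measurable (PiM {..<m} (\<lambda>_. borel))" if "j \<in> J" for j
        using km[OF that] by (intro borel_measurable_sum[where f="\<lambda>i \<delta>. \<delta> i"] measurable_component_singleton) auto
      then have "{\<delta> \<in> space (PiM {..<m} (\<lambda>_. borel :: real measure)). (\<Sum>i<k j. \<delta> i) \<in> E' j} \<in> sets (PiM {..<m} (\<lambda>_. borel))" if "j \<in> J" for j
        using measurable_sets_Collect[OF meas[OF that], of "\<lambda>x. x \<in> E' j"] J(3)[OF that] by simp
      then show ?thesis unfolding S1_def using J
        by (intro sets.sets_Collect_finite_All) auto
    qed
    have S2: "S2 \<in> sets (PiM {m..<m+n} (\<lambda>_. borel))"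
    proof -
      have meas: "(\<lambda>\<delta>. \<Sum>i<k j. \<delta> (m + i) :: real) \<in> borel_measurable (PiM {m..<m+n} (\<lambda>_. borel))" if "j \<in> K" for j
        using kn[OF that] by (intro borel_measurable_sum measurable_component_singleton) auto
      then have "{\<delta> \<in> space (PiM {m..<m+n} (\<lambda>_. borel :: real measure)). (\<Sum>i<k j. \<delta> (m + i)) \<in> F' j} \<in> sets (PiM {m..<m+n} (\<lambda>_. borel))" if "j \<in> K" for j
        using measurable_sets_Collect[OF meas[OF that], of "\<lambda>x. x \<in> F' j"] K(3)[OF that] by simp
      then show ?thesis unfolding S2_def using K
        by (intro sets.sets_Collect_finite_All) auto
    qed
    have tel1: "(\<Sum>i<k j. (restrict (\<lambda>i. \<Delta> i w) {..<m}) i) = X (s * j) w" if "j \<in> J" "w \<in> space M" for j w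
    proof -
      have "(\<Sum>i<k j. (restrict (\<lambda>i. \<Delta> i w) {..<m}) i) = (\<Sum>i<k j. X (t (Suc i)) w - X (t i) w)"
        using km[OF that(1)] by (intro sum.cong) (auto simp: \<Delta>_def)
      also have "\<dots> = X (t (k j)) w - X (t 0) w" by (rule sum_lessThan_telescope)
      also have "t 0 = 0" by (simp add: t_def)
      also have "t (k j) = s * j" using km[OF that(1)] k[of j] that(1) by (simp add: t_def)
      finally show ?thesis using X_start[OF that(2)] by simp
    qed
    have tel2: "(\<Sum>i<k j. (restrict (\<lambda>i. \<Delta> i w) {m..<m+n}) (m + i)) = X (s + j) w - X s w" if "j \<in> K" for j w
    proof -
      have "(\<Sum>i<k j. (restrict (\<lambda>i. \<Delta> i w) {m..<m+n}) (m + i)) = (\<Sum>i<k j. X (t (m + Suc i)) w - X (t (m + i)) w)"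
        using kn[OF that(1)] by (intro sum.cong) (auto simp: \<Delta>_def)
      also have "\<dots> = X (t (m + k j)) w - X (t (m + 0)) w"
        by (rule sum_lessThan_telescope[of "\<lambda>i. X (t (m + i)) w"])
      also have "t (m + 0) = s" using m by (simp add: t_def)
      also have "t (m + k j) = s + j" using k[of j] that(1) m by (cases "k j = 0") (simp_all add: t_def)
      finally show ?thesis .
    qed
    have a': "a = (\<lambda>w. restrict (\<lambda>i. \<Delta> i w) {..<m}) -` S1 \<inter> space M"
      unfolding a(1) E S1_def using J(2) tel1
      by (auto simp: prod_emb_iff PiE_iff space_PiM subset_eq)
    have b': "b = (\<lambda>w. restrict (\<lambda>i. \<Delta> i w) {m..<m+n}) -` S2 \<inter> space M"
      unfolding b(1) F S2_def using K(2) tel2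
      by (auto simp: prod_emb_iff PiE_iff space_PiM subset_eq)
    have "(\<lambda>w. ((restrict (\<lambda>i. \<Delta> i w) {..<m}), (restrict (\<lambda>i. \<Delta> i w) {m..<m+n}))) -` (S1 \<times> S2) \<inter> space M = a \<inter> b"
      unfolding a' b' by auto
    then show "prob (a \<inter> b) = prob a * prob b"
      using indep_varD[OF iv S1 S2] unfolding a'[symmetric] b'[symmetric] by simp
  qed
  from indep_set_sigma_sets[OF this stable stable]
  have "indep_set (sigma_sets (space M) ?A) (sigma_sets (space M) ?B)" .
  then show ?thesis
    unfolding indep_var_eq using s gen[OF past_measurable] gen[OF future_measurable]
    by (auto intro: past_measurable future_measurable)
qed

text \<open>Independence makes the joint law of past and future a product, and by
  \<open>future_law\<close> an independent copy of X may stand in for the future.\<close>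

theorem markov:
  assumes s: "0 \<le> s"
    and H [measurable]: "case_prod H \<in> borel_measurable (paths1 \<Otimes>\<^sub>M paths0)"
  shows "(\<integral>\<^sup>+w. H (past s w) (future s w) \<partial>M) = (\<integral>\<^sup>+w. \<integral>\<^sup>+w'. H (past s w) (\<lambda>r\<in>rats0. X r w') \<partial>M \<partial>M)"
proof -
  let ?P1 = "paths1" and ?P0 = "paths0"
  have [measurable]: "past s \<in> measurable M ?P1" "future s \<in> measurable M ?P0"
    using s by (rule past_measurable future_measurable)+
  have X0 [measurable]: "(\<lambda>w. \<lambda>r\<in>rats0. X r w) \<in> measurable M ?P0"
    by (intro measurable_restrict X_meas) (auto simp: rats0_def)
  interpret F: prob_space "distr M ?P0 (future s)" by (rule prob_space_distr) measurable
  have "(\<integral>\<^sup>+w. H (past s w) (future s w) \<partial>M) = (\<integral>\<^sup>+p. case_prod H p \<partial>distr M (?P1 \<Otimes>\<^sub>M ?P0) (\<lambda>w. (past s w, future s w)))"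
    by (subst nn_integral_distr) auto
  also have "\<dots> = (\<integral>\<^sup>+p. case_prod H p \<partial>(distr M ?P1 (past s) \<Otimes>\<^sub>M distr M ?P0 (future s)))"
    using past_future_indep[OF s] by (simp add: indep_var_distribution_eq)
  also have "\<dots> = (\<integral>\<^sup>+\<pi>. \<integral>\<^sup>+\<xi>. case_prod H (\<pi>, \<xi>) \<partial>distr M ?P0 (future s) \<partial>distr M ?P1 (past s))"
    by (rule F.nn_integral_fst[symmetric]) simp
  also have "\<dots> = (\<integral>\<^sup>+w. \<integral>\<^sup>+\<xi>. case_prod H (past s w, \<xi>) \<partial>distr M ?P0 (future s) \<partial>M)"
    by (subst nn_integral_distr) (auto intro!: F.borel_measurable_nn_integral_fst)
  also have "\<dots> = (\<integral>\<^sup>+w. \<integral>\<^sup>+w'. H (past s w) (\<lambda>r\<in>rats0. X r w') \<partial>M \<partial>M)"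
    unfolding future_law[OF s]
    by (intro nn_integral_cong) (subst nn_integral_distr, auto dest!: measurable_space[OF past_measurable[OF s]])
  finally show ?thesis .
qed

theorem reversal:
  assumes t: "0 \<le> t" and H [measurable]: "H \<in> borel_measurable paths1"
  shows "(\<integral>\<^sup>+w. H (past t w) \<partial>M) = (\<integral>\<^sup>+w. H (\<lambda>q\<in>rats1. X t w - X (t - t * q) w) \<partial>M)"
proof -
  have "(\<lambda>w. \<lambda>q\<in>rats1. X t w - X (t - t * q) w) \<in> measurable M paths1"
    using t by (intro measurable_restrict borel_measurable_diff X_meas) (auto simp: rats1_def mult_left_le)
  moreover have "past t \<in> measurable M paths1"
    using t by (rule past_measurable)
  ultimately show ?thesis
    using arg_cong[OF reversal_law[OF t], of "\<lambda>N. nn_integral N H"] by (simp add: nn_integral_distr)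
qed

end

section \<open>Killed functionals and their resolvents\<close>

definition rcont :: "(real \<Rightarrow> real) \<Rightarrow> bool" where
  "rcont p \<longleftrightarrow> (\<forall>t\<ge>0. (p \<longlongrightarrow> p t) (at_right t))"

text \<open>Over a countable set of times both constructions are measurable; on right-continuous paths
they give the path itself and nonnegativity on all of \<open>[0, t]\<close>.\<close>

definition rpath :: "(real \<Rightarrow> real) \<Rightarrow> real \<Rightarrow> real" where
  "rpath \<xi> t = lim (\<lambda>n. \<xi> (real (Suc (nat \<lfloor>t * 2 ^ n\<rfloor>)) / 2 ^ n))"

definition alive :: "real \<Rightarrow> real \<Rightarrow> (real \<Rightarrow> real) \<Rightarrow> bool" where
  "alive z t p \<longleftrightarrow> (\<forall>q\<in>rats1. 0 \<le> z + p (t * q))"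

text \<open>The Feynman-Kac functional. The path is an argument, not a sample point, so that the
  same expression applies to X, to its increments after a fixed time and to paths rebuilt by
  \<open>rpath\<close>.\<close>

definition fkf :: "(real \<Rightarrow> real) \<Rightarrow> (real \<Rightarrow> ennreal) \<Rightarrow> real \<Rightarrow> real \<Rightarrow> (real \<Rightarrow> real) \<Rightarrow> ennreal" where
  "fkf \<omega> f z t p = (if alive z t p then ennreal (exp (- (LINT v:{0..t}|lborel. \<omega> (z + p v)))) * f (z + p t) else 0)"

lemma pred_ball_rats1:
  assumes "\<And>q. q \<in> rats1 \<Longrightarrow> Measurable.pred N (\<lambda>a. P a q)"
  shows "Measurable.pred N (\<lambda>a. \<forall>q\<in>rats1. P a q)"
  unfolding pred_def using assms by (intro sets.sets_Collect_countable_All') (auto simp: pred_def)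

text \<open>For t \<ge> 0 the dyadic points (floor(t 2^n) + 1) / 2^n lie strictly to the right of t
  and converge to it, so right continuity suffices. For negative t, \<open>nat\<close> cuts the
  floor off at 0, whence \<open>max t 0\<close>.\<close>

lemma rpath_eq:
  assumes "rcont p"
  shows "rpath (restrict p rats0) t = p (max t 0)"
proof -
  define t' where "t' = max t 0"
  define s where "s n = real (Suc (nat \<lfloor>t * 2 ^ n\<rfloor>)) / 2 ^ n" for n
  have s_eq: "nat \<lfloor>t * 2 ^ n\<rfloor> = nat \<lfloor>t' * 2 ^ n\<rfloor>" for n
  proof (cases "0 \<le> t")
    case False
    then have "t * 2 ^ n < 0" by (simp add: mult_neg_pos)
    then show ?thesis using False by (simp add: t'_def)
  qed (simp add: t'_def)
  have s: "t' < s n \<and> s n \<le> t' + (1/2) ^ n" for n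
  proof -
    have "0 \<le> t' * 2 ^ n" by (simp add: t'_def)
    then have "real (nat \<lfloor>t' * 2 ^ n\<rfloor>) = of_int \<lfloor>t' * 2 ^ n\<rfloor>" by simp
    then have "t' * 2 ^ n < real (Suc (nat \<lfloor>t' * 2 ^ n\<rfloor>))" "real (Suc (nat \<lfloor>t' * 2 ^ n\<rfloor>)) \<le> t' * 2 ^ n + 1"
      by (simp_all, linarith+)
    then show ?thesis unfolding s_def s_eq by (simp add: field_simps)
  qed
  have "(\<lambda>n. t' + (1/2) ^ n) \<longlonglongrightarrow> t' + 0"
    by (intro tendsto_intros LIMSEQ_power_zero) auto
  then have "s \<longlonglongrightarrow> t'"
    by (intro tendsto_sandwich[of "\<lambda>_. t'" s sequentially "\<lambda>n. t' + (1/2) ^ n"])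
      (use s in \<open>auto intro!: always_eventually less_imp_le\<close>)
  then have "filterlim s (at_right t') sequentially"
    using s by (intro filterlim_at_withinI) auto
  moreover have "(p \<longlongrightarrow> p t') (at_right t')"
    using assms by (auto simp: rcont_def t'_def)
  ultimately have "(\<lambda>n. p (s n)) \<longlonglongrightarrow> p t'"
    by (rule filterlim_compose[rotated])
  moreover have "s n \<in> rats0" for n
    using rats_fraction(1)[of "Suc (nat \<lfloor>t * 2 ^ n\<rfloor>)" "2 ^ n"] by (simp add: s_def del: of_nat_Suc)
  ultimately have "(\<lambda>n. restrict p rats0 (s n)) \<longlonglongrightarrow> p t'" by simp
  then show ?thesis unfolding rpath_def s_def[symmetric] t'_def[symmetric] by (rule limI)
qed

lemma rpath_measurable [measurable]:
  "(\<lambda>(\<xi>, t). rpath \<xi> t) \<in> borel_measurable (paths0 \<Otimes>\<^sub>M borel)"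
proof -
  have "(\<lambda>p. fst p (real (Suc (nat \<lfloor>(snd p :: real) * 2 ^ n\<rfloor>)) / 2 ^ n)) \<in> borel_measurable (paths0 \<Otimes>\<^sub>M borel)" for n
  proof (rule measurable_compose_countable[where f="\<lambda>k p. fst p (real (Suc k) / 2 ^ n)" and g="\<lambda>p. nat \<lfloor>(snd p :: real) * 2 ^ n\<rfloor>"])
    show "(\<lambda>p. fst p (real (Suc k) / 2 ^ n)) \<in> borel_measurable (paths0 \<Otimes>\<^sub>M (borel :: real measure))" for k
      using rats_fraction(1)[of "Suc k" "2 ^ n"]
      by (intro measurable_compose[OF measurable_fst] measurable_component_singleton) (simp del: of_nat_Suc)
  qed measurable
  then show ?thesis unfolding rpath_def case_prod_beta' by measurable
qed

text \<open>By right continuity a negative value at v < t persists on an interval to the right of v,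
  which contains a rational multiple of t. The endpoint t has no such interval inside [0, t], but it
  is itself the multiple with factor 1.\<close>

lemma alive_iff:
  assumes p: "rcont p" and t: "0 \<le> t"
  shows "alive z t p \<longleftrightarrow> (\<forall>v\<in>{0..t}. 0 \<le> z + p v)"
proof
  assume al: "alive z t p"
  have one: "(1::real) \<in> rats1" by (auto simp: rats1_def)
  show "\<forall>v\<in>{0..t}. 0 \<le> z + p v"
  proof (rule ballI, rule ccontr)
    fix v assume v: "v \<in> {0..t}" and neg: "\<not> 0 \<le> z + p v"
    have "v \<noteq> t" using bspec[OF al[unfolded alive_def] one] neg by auto
    then have vt: "v < t" using v by simp
    have "(p \<longlongrightarrow> p v) (at_right v)" using p v by (auto simp: rcont_def)
    then have "\<forall>\<^sub>F u in at_right v. p u < - z"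
      by (rule order_tendstoD) (use neg in simp)
    then obtain b where b: "b > v" "\<And>u. v < u \<Longrightarrow> u < b \<Longrightarrow> p u < - z"
      by (auto simp: eventually_at_right_field)
    have "v / t < min b t / t" using vt v b by (intro divide_strict_right_mono) auto
    then obtain q where q: "q \<in> \<rat>" "v / t < q" "q < min b t / t"
      using Rats_dense_in_real by blast
    have "v < t * q" "t * q < min b t" using q vt v by (auto simp: field_simps)
    moreover have "q \<in> rats1"
    proof -
      have "0 \<le> v / t" using v by simp
      moreover have "min b t / t \<le> 1" using vt v by (simp add: divide_le_eq_1)
      ultimately show ?thesis using q by (auto simp: rats1_def)
    qed
    ultimately show False using b(2)[of "t * q"] al by (force simp: alive_def)
  qed
next
  assume *: "\<forall>v\<in>{0..t}. 0 \<le> z + p v"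
  show "alive z t p" unfolding alive_def
    using * t by (auto simp: rats1_def mult_left_le)
qed

lemma alive_cong:
  assumes "0 \<le> t" and "\<And>v. v \<in> {0..t} \<Longrightarrow> p v = p' v"
  shows "alive z t p \<longleftrightarrow> alive z t p'"
  unfolding alive_def using assms by (intro ball_cong) (auto simp: rats1_def mult_left_le)

lemma fkf_cong:
  assumes "0 \<le> t" and eq: "\<And>v. v \<in> {0..t} \<Longrightarrow> p v = p' v"
  shows "fkf \<omega> f z t p = fkf \<omega> f z t p'"
proof -
  have "(LINT v:{0..t}|lborel. \<omega> (z + p v)) = (LINT v:{0..t}|lborel. \<omega> (z + p' v))"
    unfolding set_lebesgue_integral_def
    by (intro Bochner_Integration.integral_cong) (auto simp: eq indicator_def)
  then show ?thesis using alive_cong[OF assms] eq[of t] \<open>0 \<le> t\<close> by (simp add: fkf_def)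
qed

lemma fkf_zero: "fkf (\<lambda>_. 0) f z t p = (if alive z t p then f (z + p t) else 0)"
  by (simp add: fkf_def set_lebesgue_integral_def)

lemma fkf_measurable:
  assumes [measurable]: "\<omega> \<in> borel_measurable borel" "f \<in> borel_measurable borel"
    "z \<in> borel_measurable N" "t \<in> borel_measurable N"
    and p: "(\<lambda>x. p (fst x) (snd x)) \<in> borel_measurable (N \<Otimes>\<^sub>M borel)"
  shows "(\<lambda>a. fkf \<omega> f (z a) (t a) (p a)) \<in> borel_measurable N"
proof -
  have [measurable]: "(\<lambda>a. p a (g a)) \<in> borel_measurable N" if [measurable]: "g \<in> borel_measurable N" for g
  proof -
    have "(\<lambda>a. (a, g a)) \<in> measurable N (N \<Otimes>\<^sub>M borel)" by measurable
    from measurable_compose[OF this p] show ?thesis by simp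
  qed
  have p' [measurable]: "(\<lambda>x. p (fst x) (snd x)) \<in> borel_measurable (N \<Otimes>\<^sub>M lborel)"
    using p by simp
  have "(\<lambda>(a, v). indicator {0..t a} v *\<^sub>R \<omega> (z a + p a v)) \<in> borel_measurable (N \<Otimes>\<^sub>M lborel)"
    unfolding indicator_def atLeastAtMost_iff case_prod_beta' by measurable
  then have [measurable]: "(\<lambda>a. LINT v:{0..t a}|lborel. \<omega> (z a + p a v)) \<in> borel_measurable N"
    unfolding set_lebesgue_integral_def by (rule lborel.borel_measurable_lebesgue_integral)
  have [measurable]: "Measurable.pred N (\<lambda>a. alive (z a) (t a) (p a))"
    unfolding alive_def by (intro pred_ball_rats1) measurable
  show ?thesis unfolding fkf_def by measurable
qed

section \<open>Joint measurability of the paths and the resolvent identity\<close>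

context levy_process_from_zero
begin

text \<open>X is arbitrary at negative times; clamping the time gives a function that is jointly
  measurable on the whole line.\<close>

abbreviation path :: "'a \<Rightarrow> real \<Rightarrow> real" where
  "path w t \<equiv> X (max t 0) w"

lemma rcont_X: "w \<in> space M \<Longrightarrow> rcont (\<lambda>t. X t w)"
  using cadlag_paths by (auto simp: cadlag_def rcont_def)

lemma rcont_path:
  assumes "w \<in> space M" shows "rcont (path w)"
  unfolding rcont_def
proof (intro allI impI)
  fix t :: real assume t: "0 \<le> t"
  have "((\<lambda>t. X t w) \<longlongrightarrow> X (max t 0) w) (at_right t)"
    using rcont_X[OF assms] t by (simp add: rcont_def)
  then show "(path w \<longlongrightarrow> X (max t 0) w) (at_right t)"
    by (rule Lim_transform_eventually) (use t in \<open>auto simp: eventually_at_filter\<close>)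
qed

lemma rcont_shift:
  assumes w: "w \<in> space M" and s: "0 \<le> s"
  shows "rcont (\<lambda>t. X (s + t) w - d)"
proof -
  have "((\<lambda>v. X (s + v) w - d) \<longlongrightarrow> X (s + t) w - d) (at_right t)" if "0 \<le> t" for t
  proof -
    have "((\<lambda>u. X u w) \<longlongrightarrow> X (s + t) w) (at_right (s + t))"
      using rcont_X[OF w] s that by (auto simp: rcont_def)
    moreover have "filterlim (\<lambda>v. s + v) (at_right (s + t)) (at_right t)"
      by (auto simp: filterlim_at eventually_at_filter intro!: tendsto_intros)
    ultimately show ?thesis by (intro tendsto_intros) (rule filterlim_compose)
  qed
  then show ?thesis by (simp add: rcont_def)
qed

text \<open>Measurability is assumed at each fixed time only. Joint measurability follows because
  \<open>rpath\<close> rebuilds the path from its values at rational times.\<close>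

lemma path_measurable [measurable]: "(\<lambda>x. path (fst x) (snd x)) \<in> borel_measurable (M \<Otimes>\<^sub>M borel)"
proof -
  have [measurable]: "(\<lambda>w. \<lambda>r\<in>rats0. X r w) \<in> measurable M paths0"
    by (intro measurable_restrict X_meas) (auto simp: rats0_def)
  have "(\<lambda>x. (\<lambda>(\<xi>, t). rpath \<xi> t) (\<lambda>r\<in>rats0. X r (fst x), snd x)) \<in> borel_measurable (M \<Otimes>\<^sub>M borel)"
    by measurable
  then show ?thesis
    by (rule measurable_cong[THEN iffD1, rotated]) (simp add: space_pair_measure rpath_eq rcont_X mem_Times_iff)
qed

lemma path_measurable_compose:
  assumes [measurable]: "W \<in> measurable N M" "g \<in> borel_measurable N"
  shows "(\<lambda>a. path (W a) (g a)) \<in> borel_measurable N"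
proof -
  have "(\<lambda>a. (W a, g a)) \<in> measurable N (M \<Otimes>\<^sub>M borel)" by measurable
  from measurable_compose[OF this path_measurable] show ?thesis by simp
qed

lemma alive_path_measurable:
  assumes [measurable]: "z \<in> borel_measurable N" "t \<in> borel_measurable N" "W \<in> measurable N M"
  shows "Measurable.pred N (\<lambda>a. alive (z a) (t a) (path (W a)))"
  unfolding alive_def
proof (rule pred_ball_rats1)
  fix q :: real
  have [measurable]: "(\<lambda>a. path (W a) (t a * q)) \<in> borel_measurable N"
    by (rule path_measurable_compose) measurable
  show "Measurable.pred N (\<lambda>a. 0 \<le> z a + path (W a) (t a * q))" by measurable
qed

lemma fkf_path_measurable:
  assumes "\<omega> \<in> borel_measurable borel" "f \<in> borel_measurable borel"
    "z \<in> borel_measurable N" "t \<in> borel_measurable N" and W: "W \<in> measurable N M"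
  shows "(\<lambda>a. fkf \<omega> f (z a) (t a) (path (W a))) \<in> borel_measurable N"
  by (intro fkf_measurable assms path_measurable_compose) (use W in measurable)

abbreviation "fk_mean \<omega> f z t \<equiv> \<integral>\<^sup>+w. fkf \<omega> f z t (path w) \<partial>M"

text \<open>The resolvent at rate zero, possibly infinite, of the process killed below 0 and in
  addition at rate \<open>\<omega>\<close>; \<open>free_res\<close> is the V of the
  overview.\<close>

definition res :: "(real \<Rightarrow> real) \<Rightarrow> (real \<Rightarrow> ennreal) \<Rightarrow> real \<Rightarrow> ennreal" where
  "res \<omega> f z = (\<integral>\<^sup>+t\<in>{0..}. fk_mean \<omega> f z t \<partial>lborel)"

abbreviation "free_res \<equiv> res (\<lambda>_. 0)"

lemma expectation_fkf_measurable:
  assumes "\<omega> \<in> borel_measurable borel" "f \<in> borel_measurable borel"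
    "z \<in> borel_measurable N" "t \<in> borel_measurable N"
  shows "(\<lambda>a. fk_mean \<omega> f (z a) (t a)) \<in> borel_measurable N"
proof -
  have "(\<lambda>x. fkf \<omega> f (z (fst x)) (t (fst x)) (path (snd x))) \<in> borel_measurable (N \<Otimes>\<^sub>M M)"
    using assms by (intro fkf_path_measurable) auto
  from borel_measurable_nn_integral_fst[OF this] show ?thesis by simp
qed

lemma res_measurable [measurable]:
  assumes [measurable]: "\<omega> \<in> borel_measurable borel" "f \<in> borel_measurable borel"
  shows "res \<omega> f \<in> borel_measurable borel"
proof -
  have [measurable]: "(\<lambda>x. fk_mean \<omega> f (fst x) (snd x)) \<in> borel_measurable (borel \<Otimes>\<^sub>M lborel)"
    by (rule expectation_fkf_measurable) measurable
  have "(\<lambda>x. (fk_mean \<omega> f (fst x) (snd x)) * indicator {0..} (snd x)) \<in> borel_measurable (borel \<Otimes>\<^sub>M lborel)"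
    by measurable
  from lborel.borel_measurable_nn_integral_fst[OF this] show ?thesis
    unfolding res_def[abs_def] by simp
qed

text \<open>Duhamel's formula along a single path. The exponential weight covers [s, t], the part
  after s, and the part before s is subject to survival alone; this is the form to which the Markov
  property at s applies.\<close>

lemma fkf_decomposition:
  assumes [measurable]: "\<omega> \<in> borel_measurable borel" and \<omega>: "\<And>y. 0 \<le> \<omega> y" "\<And>y. \<omega> y \<le> K"
    and w: "w \<in> space M" and t: "0 \<le> t"
  shows "fkf (\<lambda>_. 0) f x t (path w) = fkf \<omega> f x t (path w) +
    (\<integral>\<^sup>+s\<in>{0..t}. (if alive x s (path w) then \<omega> (x + path w s) * fkf \<omega> f (x + path w s) (t - s) (\<lambda>v. path w (s + v) - path w s) else 0) \<partial>lborel)"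
proof -
  let ?p = "path w"
  define a where "a v = \<omega> (x + ?p v)" for v
  have [measurable]: "?p \<in> borel_measurable borel"
    using w path_measurable_compose[of "\<lambda>_. w" borel "\<lambda>t. t"] by simp
  have [measurable]: "a \<in> borel_measurable borel" unfolding a_def by measurable
  have rc: "rcont ?p" using w by (rule rcont_path)
  have alive_p: "alive x s ?p \<longleftrightarrow> (\<forall>v\<in>{0..s}. 0 \<le> x + ?p v)" if "0 \<le> s" for s
    by (rule alive_iff[OF rc that])
  have alive_shift: "alive (x + ?p s) (t - s) (\<lambda>v. ?p (s + v) - ?p s) \<longleftrightarrow> (\<forall>v\<in>{s..t}. 0 \<le> x + ?p v)" if s: "s \<in> {0..t}" for s
  proof -
    have "alive (x + ?p s) (t - s) (\<lambda>v. ?p (s + v) - ?p s) \<longleftrightarrow> alive (x + ?p s) (t - s) (\<lambda>v. X (s + v) w - ?p s)"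
      using s by (intro alive_cong) auto
    also have "\<dots> \<longleftrightarrow> (\<forall>v\<in>{0..t - s}. 0 \<le> x + ?p s + (X (s + v) w - ?p s))"
      using s w by (intro alive_iff rcont_shift) auto
    also have "\<dots> \<longleftrightarrow> (\<forall>v\<in>{s..t}. 0 \<le> x + ?p v)"
    proof
      assume *: "\<forall>v\<in>{0..t - s}. 0 \<le> x + ?p s + (X (s + v) w - ?p s)"
      show "\<forall>v\<in>{s..t}. 0 \<le> x + ?p v"
      proof
        fix v assume "v \<in> {s..t}"
        then show "0 \<le> x + ?p v" using bspec[OF *, of "v - s"] s by simp
      qed
    next
      assume *: "\<forall>v\<in>{s..t}. 0 \<le> x + ?p v"
      show "\<forall>v\<in>{0..t - s}. 0 \<le> x + ?p s + (X (s + v) w - ?p s)"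
      proof
        fix v assume "v \<in> {0..t - s}"
        then show "0 \<le> x + ?p s + (X (s + v) w - ?p s)" using bspec[OF *, of "s + v"] s by simp
      qed
    qed
    finally show ?thesis .
  qed
  have shift_int: "(LINT v:{0..t - s}|lborel. \<omega> (x + ?p s + (?p (s + v) - ?p s))) = (LINT v:{s..t}|lborel. a v)" for s
  proof -
    have "(LINT v|lborel. indicator {s..t} v *\<^sub>R a v) = (LINT v|lborel. indicator {s..t} (s + 1 * v) *\<^sub>R a (s + 1 * v))"
      using lborel_integral_real_affine[of 1 "\<lambda>v. indicator {s..t} v *\<^sub>R a v" s] by simp
    then show ?thesis unfolding set_lebesgue_integral_def a_def
      by (simp add: indicator_def algebra_simps cong: if_cong)
  qed
  show ?thesis
  proof (cases "alive x t ?p")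
    case True
    then have al: "\<forall>v\<in>{0..t}. 0 \<le> x + ?p v" using alive_p[OF t] by simp
    have "(if alive x s ?p then \<omega> (x + ?p s) * fkf \<omega> f (x + ?p s) (t - s) (\<lambda>v. ?p (s + v) - ?p s) else 0) * indicator {0..t} s
      = ennreal (a s * exp (- (LINT v:{s..t}|lborel. a v))) * indicator {0..t} s * f (x + ?p t)" for s
    proof (cases "s \<in> {0..t}")
      case s: True
      then have "alive x s ?p" "alive (x + ?p s) (t - s) (\<lambda>v. ?p (s + v) - ?p s)"
        using al alive_p[of s] alive_shift[of s] by auto
      moreover have "x + ?p s + (?p (s + (t - s)) - ?p s) = x + ?p t" by simp
      ultimately show ?thesis using s \<omega>
        unfolding fkf_def shift_int by (simp add: a_def[abs_def] ennreal_mult mult.assoc)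
    qed simp
    then have "(\<integral>\<^sup>+s\<in>{0..t}. (if alive x s ?p then \<omega> (x + ?p s) * fkf \<omega> f (x + ?p s) (t - s) (\<lambda>v. ?p (s + v) - ?p s) else 0) \<partial>lborel)
      = (\<integral>\<^sup>+s. ennreal (a s * exp (- (LINT v:{s..t}|lborel. a v))) * indicator {0..t} s * f (x + ?p t) \<partial>lborel)"
      by simp
    also have "\<dots> = (\<integral>\<^sup>+s\<in>{0..t}. ennreal (a s * exp (- (LINT v:{s..t}|lborel. a v))) \<partial>lborel) * f (x + ?p t)"
    proof (rule nn_integral_multc)
      have "(\<lambda>(s, v). indicator {s..t} v *\<^sub>R a v) \<in> borel_measurable (borel \<Otimes>\<^sub>M lborel)"
        unfolding indicator_def atLeastAtMost_iff case_prod_beta' by measurable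
      then have [measurable]: "(\<lambda>s. LINT v:{s..t}|lborel. a v) \<in> borel_measurable borel"
        unfolding set_lebesgue_integral_def by (rule lborel.borel_measurable_lebesgue_integral)
      show "(\<lambda>s. ennreal (a s * exp (- (LINT v:{s..t}|lborel. a v))) * indicator {0..t} s) \<in> borel_measurable lborel"
        by measurable
    qed
    also have "(\<integral>\<^sup>+s\<in>{0..t}. ennreal (a s * exp (- (LINT v:{s..t}|lborel. a v))) \<partial>lborel)
      = ennreal (1 - exp (- (LINT v:{0..t}|lborel. a v)))"
      using \<omega> t by (intro integral_killing_rate[where K=K]) (auto simp: a_def)
    moreover have "ennreal (exp (- (LINT v:{0..t}|lborel. a v))) + ennreal (1 - exp (- (LINT v:{0..t}|lborel. a v))) = 1"
    proof -
      have "0 \<le> (LINT v:{0..t}|lborel. a v)"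
        unfolding set_lebesgue_integral_def by (intro integral_nonneg_AE) (auto simp: \<omega> a_def)
      then show ?thesis by (subst ennreal_plus[symmetric]) auto
    qed
    ultimately show ?thesis
      using True unfolding fkf_zero by (simp add: fkf_def a_def[symmetric] distrib_right[symmetric])
  next
    case False
    then obtain u where u: "u \<in> {0..t}" "\<not> 0 \<le> x + ?p u" using alive_p[OF t] by blast
    have "(if alive x s ?p then \<omega> (x + ?p s) * fkf \<omega> f (x + ?p s) (t - s) (\<lambda>v. ?p (s + v) - ?p s) else 0) * indicator {0..t} s = 0" for s
    proof (cases "s \<in> {0..t}")
      case s: True
      \<comment> \<open>A visit below 0 at time u rules out survival on whichever of [0, s] and
        [s, t] contains u.\<close>
      have "\<not> alive x s ?p \<or> \<not> alive (x + ?p s) (t - s) (\<lambda>v. ?p (s + v) - ?p s)"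
        using u s alive_p[of s] alive_shift[of s] by (cases "u \<le> s") auto
      then show ?thesis by (auto simp: fkf_def)
    qed simp
    then have "(\<integral>\<^sup>+s\<in>{0..t}. (if alive x s ?p then \<omega> (x + ?p s) * fkf \<omega> f (x + ?p s) (t - s) (\<lambda>v. ?p (s + v) - ?p s) else 0) \<partial>lborel)
      = (\<integral>\<^sup>+s. 0 \<partial>(lborel :: real measure))"
      by (intro nn_integral_cong)
    then show ?thesis using False by (simp only: fkf_def if_False nn_integral_const mult_zero_left add_0)
  qed
qed

text \<open>Up to s the integrand depends on the path through \<open>past s w\<close> only:
  survival, and the value at s as coordinate 1. After s it depends on the increments only, which
  \<open>rpath\<close> rebuilds from \<open>future s w\<close>.\<close>

lemma markov_fkf:
  assumes [measurable]: "\<omega> \<in> borel_measurable borel" "f \<in> borel_measurable borel" "g \<in> borel_measurable borel"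
    and s: "0 \<le> s" and r: "0 \<le> r"
  shows "(\<integral>\<^sup>+w. (if alive x s (path w) then g (x + path w s) * fkf \<omega> f (x + path w s) r (\<lambda>v. path w (s + v) - path w s) else 0) \<partial>M)
    = (\<integral>\<^sup>+w. (if alive x s (path w) then g (x + path w s) * (fk_mean \<omega> f (x + path w s) r) else 0) \<partial>M)"
proof -
  define H where "H \<pi> \<xi> = (if \<forall>q\<in>rats1. 0 \<le> x + \<pi> q then g (x + \<pi> 1) * fkf \<omega> f (x + \<pi> 1) r (rpath \<xi>) else 0)" for \<pi> \<xi>
  have one: "(1::real) \<in> rats1" by (auto simp: rats1_def)
  let ?P = "paths1 \<Otimes>\<^sub>M paths0"
  have comp: "(\<lambda>y. fst y q) \<in> borel_measurable ?P" if "q \<in> rats1" for q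
    using that by (intro measurable_compose[OF measurable_fst] measurable_component_singleton)
  note [measurable] = comp[OF one]
  have [measurable]: "Measurable.pred ?P (\<lambda>y. \<forall>q\<in>rats1. 0 \<le> x + fst y q)"
  proof (rule pred_ball_rats1)
    fix q :: real assume "q \<in> rats1"
    note [measurable] = comp[OF this]
    show "Measurable.pred ?P (\<lambda>y. 0 \<le> x + fst y q)" by measurable
  qed
  have [measurable]: "(\<lambda>y. fkf \<omega> f (x + fst y 1) r (rpath (snd y))) \<in> borel_measurable ?P"
  proof (rule fkf_measurable)
    have "(\<lambda>y. (\<lambda>(\<xi>, t). rpath \<xi> t) (snd (fst y), snd y)) \<in> borel_measurable (?P \<Otimes>\<^sub>M borel)"
      by measurable
    then show "(\<lambda>y. rpath (snd (fst y)) (snd y)) \<in> borel_measurable (?P \<Otimes>\<^sub>M borel)" by simp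
  qed measurable
  have H: "case_prod H \<in> borel_measurable ?P"
    unfolding H_def case_prod_beta' by measurable
  have al: "alive x s (path w) \<longleftrightarrow> (\<forall>q\<in>rats1. 0 \<le> x + past s w q)" for w
    using s by (auto simp: alive_def rats1_def)
  have p1: "past s w 1 = path w s" for w using one s by simp
  have "(if alive x s (path w) then g (x + path w s) * fkf \<omega> f (x + path w s) r (\<lambda>v. path w (s + v) - path w s) else 0)
     = H (past s w) (future s w)" if w: "w \<in> space M" for w
  proof -
    have "rpath (future s w) v = X (s + max v 0) w - X s w" for v
      using w s by (intro rpath_eq rcont_shift)
    then have "fkf \<omega> f z r (\<lambda>v. path w (s + v) - path w s) = fkf \<omega> f z r (rpath (future s w))" for z
      using r s by (intro fkf_cong) auto
    then show ?thesis unfolding H_def al[symmetric] p1 by simp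
  qed
  then have "(\<integral>\<^sup>+w. (if alive x s (path w) then g (x + path w s) * fkf \<omega> f (x + path w s) r (\<lambda>v. path w (s + v) - path w s) else 0) \<partial>M)
    = (\<integral>\<^sup>+w. H (past s w) (future s w) \<partial>M)"
    by (intro nn_integral_cong)
  also have "\<dots> = (\<integral>\<^sup>+w. \<integral>\<^sup>+w'. H (past s w) (\<lambda>r\<in>rats0. X r w') \<partial>M \<partial>M)"
    by (rule markov[OF s H])
  also have "\<dots> = (\<integral>\<^sup>+w. (if alive x s (path w) then g (x + path w s) * (fk_mean \<omega> f (x + path w s) r) else 0) \<partial>M)"
  proof (intro nn_integral_cong)
    fix w assume "w \<in> space M"
    have "(\<integral>\<^sup>+w'. H (past s w) (\<lambda>r\<in>rats0. X r w') \<partial>M)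
      = (\<integral>\<^sup>+w'. (if alive x s (path w) then g (x + path w s) * fkf \<omega> f (x + path w s) r (path w') else 0) \<partial>M)"
    proof (intro nn_integral_cong)
      fix w' assume w': "w' \<in> space M"
      have "rpath (\<lambda>r\<in>rats0. X r w') = path w'"
        using w' by (intro ext) (simp add: rpath_eq rcont_X)
      then show "H (past s w) (\<lambda>r\<in>rats0. X r w') = (if alive x s (path w) then g (x + path w s) * fkf \<omega> f (x + path w s) r (path w') else 0)"
        unfolding H_def al[symmetric] p1 by simp
    qed
    also have "\<dots> = (if alive x s (path w) then g (x + path w s) * (fk_mean \<omega> f (x + path w s) r) else 0)"
    proof (cases "alive x s (path w)")
      case True
      have "(\<lambda>w'. fkf \<omega> f (x + path w s) r (path w')) \<in> borel_measurable M"
        by (rule fkf_path_measurable) measurable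
      then show ?thesis using True by (simp add: nn_integral_cmult)
    qed simp
    finally show "(\<integral>\<^sup>+w'. H (past s w) (\<lambda>r\<in>rats0. X r w') \<partial>M) = \<dots>" .
  qed
  finally show ?thesis .
qed

text \<open>The pathwise decomposition is integrated over the sample space and over t. Writing t = s
  + r turns the triangle 0 \<le> s \<le> t into a quadrant, and the Markov property at s converts
  the integral over r into the killed resolvent at the position at time s.\<close>

theorem resolvent_identity:
  assumes \<omega>m [measurable]: "\<omega> \<in> borel_measurable borel" and \<omega>: "\<And>y. 0 \<le> \<omega> y" "\<And>y. \<omega> y \<le> K"
    and f [measurable]: "f \<in> borel_measurable borel"
  shows "free_res f x = res \<omega> f x + free_res (\<lambda>y. \<omega> y * res \<omega> f y) x"
proof -
  define \<Phi> where "\<Phi> s t w = (if alive x s (path w) then \<omega> (x + path w s) * fkf \<omega> f (x + path w s) (t - s) (\<lambda>v. path w (s + v) - path w s) else 0)" for s t w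
  interpret LM: pair_sigma_finite lborel M ..
  have \<Phi>_meas: "(\<lambda>a. \<Phi> (s a) (t a) (W a)) \<in> borel_measurable N"
    if [measurable]: "s \<in> borel_measurable N" "t \<in> borel_measurable N" "W \<in> measurable N M" for s t W N
  proof -
    have [measurable]: "(\<lambda>a. path (W a) (s a)) \<in> borel_measurable N"
      by (rule path_measurable_compose) measurable
    have [measurable]: "Measurable.pred N (\<lambda>a. alive x (s a) (path (W a)))"
      by (rule alive_path_measurable) measurable
    have [measurable]: "(\<lambda>a. fkf \<omega> f (x + path (W a) (s a)) (t a - s a) (\<lambda>v. path (W a) (s a + v) - path (W a) (s a))) \<in> borel_measurable N"
      by (rule fkf_measurable[OF \<omega>m f]; (intro borel_measurable_add borel_measurable_diff path_measurable_compose)?) measurable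
    show ?thesis unfolding \<Phi>_def by measurable
  qed
  have fm: "(\<lambda>w. fkf \<omega>' f x t (path w)) \<in> borel_measurable M"
    if [measurable]: "\<omega>' \<in> borel_measurable borel" for \<omega>' t
    by (rule fkf_path_measurable) measurable
  have "free_res f x = (\<integral>\<^sup>+t\<in>{0..}. (fk_mean \<omega> f x t) + (\<integral>\<^sup>+w. (\<integral>\<^sup>+s\<in>{0..t}. \<Phi> s t w \<partial>lborel) \<partial>M) \<partial>lborel)"
    unfolding res_def
  proof (intro nn_integral_cong)
    fix t :: real
    show "(fk_mean (\<lambda>_. 0) f x t) * indicator {0..} t
      = ((fk_mean \<omega> f x t) + (\<integral>\<^sup>+w. (\<integral>\<^sup>+s\<in>{0..t}. \<Phi> s t w \<partial>lborel) \<partial>M)) * indicator {0..} t"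
    proof (cases "0 \<le> t")
      case True
      have "(fk_mean (\<lambda>_. 0) f x t) = (\<integral>\<^sup>+w. fkf \<omega> f x t (path w) + (\<integral>\<^sup>+s\<in>{0..t}. \<Phi> s t w \<partial>lborel) \<partial>M)"
        unfolding \<Phi>_def using True by (intro nn_integral_cong fkf_decomposition[where K=K] \<omega>m \<omega>)
      also have "\<dots> = (fk_mean \<omega> f x t) + (\<integral>\<^sup>+w. (\<integral>\<^sup>+s\<in>{0..t}. \<Phi> s t w \<partial>lborel) \<partial>M)"
      proof (rule nn_integral_add[OF fm[OF \<omega>m]])
        have "(\<lambda>y. \<Phi> (snd y) t (fst y)) \<in> borel_measurable (M \<Otimes>\<^sub>M lborel)"
          by (rule \<Phi>_meas) measurable
        then have "(\<lambda>y. \<Phi> (snd y) t (fst y) * indicator {0..t} (snd y)) \<in> borel_measurable (M \<Otimes>\<^sub>M lborel)"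
          by measurable
        from lborel.borel_measurable_nn_integral_fst[OF this]
        show "(\<lambda>w. \<integral>\<^sup>+s\<in>{0..t}. \<Phi> s t w \<partial>lborel) \<in> borel_measurable M" by simp
      qed
      finally show ?thesis by simp
    qed simp
  qed
  also have "\<dots> = res \<omega> f x + (\<integral>\<^sup>+t\<in>{0..}. (\<integral>\<^sup>+w. (\<integral>\<^sup>+s\<in>{0..t}. \<Phi> s t w \<partial>lborel) \<partial>M) \<partial>lborel)"
  proof -
    have 1: "(\<lambda>t. fk_mean \<omega> f x t) \<in> borel_measurable lborel"
      by (rule expectation_fkf_measurable) measurable
    have [measurable]: "(\<lambda>y. \<Phi> (snd y) (fst (fst y)) (snd (fst y))) \<in> borel_measurable ((lborel \<Otimes>\<^sub>M M) \<Otimes>\<^sub>M lborel)"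
      by (rule \<Phi>_meas) measurable
    have "(\<lambda>y. \<Phi> (snd y) (fst (fst y)) (snd (fst y)) * indicator {0..fst (fst y)} (snd y)) \<in> borel_measurable ((lborel \<Otimes>\<^sub>M M) \<Otimes>\<^sub>M lborel)"
      unfolding indicator_def atLeastAtMost_iff by measurable
    from lborel.borel_measurable_nn_integral_fst[OF this]
    have "(\<lambda>y. \<integral>\<^sup>+s\<in>{0..fst y}. \<Phi> s (fst y) (snd y) \<partial>lborel) \<in> borel_measurable (lborel \<Otimes>\<^sub>M M)" by simp
    from borel_measurable_nn_integral_fst[OF this]
    have 2: "(\<lambda>t. \<integral>\<^sup>+w. (\<integral>\<^sup>+s\<in>{0..t}. \<Phi> s t w \<partial>lborel) \<partial>M) \<in> borel_measurable lborel" by simp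
    show ?thesis unfolding res_def distrib_right using 1 2 by (intro nn_integral_add) auto
  qed
  also have "(\<integral>\<^sup>+t\<in>{0..}. (\<integral>\<^sup>+w. (\<integral>\<^sup>+s\<in>{0..t}. \<Phi> s t w \<partial>lborel) \<partial>M) \<partial>lborel)
    = (\<integral>\<^sup>+s\<in>{0..}. (\<integral>\<^sup>+r\<in>{0..}. (\<integral>\<^sup>+w. \<Phi> s (s + r) w \<partial>M) \<partial>lborel) \<partial>lborel)"
  proof -
    have \<Phi>1 [measurable]: "(\<lambda>y. \<Phi> (fst y) t (snd y)) \<in> borel_measurable (lborel \<Otimes>\<^sub>M M)" for t
      by (rule \<Phi>_meas) measurable
    have [measurable]: "(\<lambda>w. \<Phi> s t w) \<in> borel_measurable M" for s t
      by (rule \<Phi>_meas) measurable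
    have \<Psi>: "(\<lambda>y. \<integral>\<^sup>+w. \<Phi> (fst y) (snd y) w \<partial>M) \<in> borel_measurable (lborel \<Otimes>\<^sub>M lborel)"
    proof -
      have "(\<lambda>y. \<Phi> (fst (fst y)) (snd (fst y)) (snd y)) \<in> borel_measurable ((lborel \<Otimes>\<^sub>M lborel) \<Otimes>\<^sub>M M)"
        by (rule \<Phi>_meas) measurable
      from borel_measurable_nn_integral_fst[OF this] show ?thesis by simp
    qed
    define \<Psi> where "\<Psi> s t = (\<integral>\<^sup>+w. \<Phi> s t w \<partial>M)" for s t
    have \<Psi>m [measurable]: "(\<lambda>y. \<Psi> (fst y) (snd y)) \<in> borel_measurable (borel \<Otimes>\<^sub>M borel)"
      using \<Psi> by (simp add: \<Psi>_def)
    have [measurable]: "\<Psi> s \<in> borel_measurable borel" for s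
    proof -
      have "(\<lambda>t. (\<lambda>y. \<Psi> (fst y) (snd y)) (s, t)) \<in> borel_measurable borel" by measurable
      then show ?thesis by simp
    qed
    have "(\<integral>\<^sup>+w. (\<integral>\<^sup>+s\<in>{0..t}. \<Phi> s t w \<partial>lborel) \<partial>M) = (\<integral>\<^sup>+s\<in>{0..t}. \<Psi> s t \<partial>lborel)" for t
    proof -
      have "(\<lambda>y. \<Phi> (fst y) t (snd y) * indicator {0..t} (fst y)) \<in> borel_measurable (lborel \<Otimes>\<^sub>M M)"
        by measurable
      from LM.Fubini[OF this]
      have "(\<integral>\<^sup>+w. (\<integral>\<^sup>+s\<in>{0..t}. \<Phi> s t w \<partial>lborel) \<partial>M) = (\<integral>\<^sup>+s. (\<integral>\<^sup>+w. \<Phi> s t w * indicator {0..t} s \<partial>M) \<partial>lborel)"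
        by simp
      then show ?thesis unfolding \<Psi>_def by (simp add: nn_integral_multc)
    qed
    note * = this
    have "(\<integral>\<^sup>+t\<in>{0..}. (\<integral>\<^sup>+w. (\<integral>\<^sup>+s\<in>{0..t}. \<Phi> s t w \<partial>lborel) \<partial>M) \<partial>lborel)
      = (\<integral>\<^sup>+t. (\<integral>\<^sup>+s. \<Psi> s t * (if 0 \<le> s \<and> s \<le> t then 1 else 0) \<partial>lborel) \<partial>lborel)"
    proof (intro nn_integral_cong)
      fix t :: real
      show "(\<integral>\<^sup>+w. (\<integral>\<^sup>+s\<in>{0..t}. \<Phi> s t w \<partial>lborel) \<partial>M) * indicator {0..} t
        = (\<integral>\<^sup>+s. \<Psi> s t * (if 0 \<le> s \<and> s \<le> t then 1 else 0) \<partial>lborel)"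
      proof (cases "0 \<le> t")
        case True
        with * show ?thesis by (simp add: indicator_def cong: if_cong) (simp add: of_bool_def)
      next
        case False
        then have "(\<lambda>s. \<Psi> s t * (if 0 \<le> s \<and> s \<le> t then 1 else 0)) = (\<lambda>_. 0)"
          by (intro ext) auto
        with False show ?thesis by simp
      qed
    qed
    also have "\<dots> = (\<integral>\<^sup>+s. (\<integral>\<^sup>+t. \<Psi> s t * (if 0 \<le> s \<and> s \<le> t then 1 else 0) \<partial>lborel) \<partial>lborel)"
    proof -
      have "(\<lambda>y. \<Psi> (fst y) (snd y) * (if 0 \<le> fst y \<and> fst y \<le> snd y then 1 else 0)) \<in> borel_measurable (lborel \<Otimes>\<^sub>M lborel)"
        by measurable
      from lborel_pair.Fubini[OF this] show ?thesis by simp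
    qed
    also have "\<dots> = (\<integral>\<^sup>+s\<in>{0..}. (\<integral>\<^sup>+r\<in>{0..}. \<Psi> s (s + r) \<partial>lborel) \<partial>lborel)"
    proof (intro nn_integral_cong)
      fix s :: real
      have "(\<integral>\<^sup>+t. \<Psi> s t * (if 0 \<le> s \<and> s \<le> t then 1 else 0) \<partial>lborel)
        = ennreal \<bar>1\<bar> * (\<integral>\<^sup>+r. \<Psi> s (s + 1 * r) * (if 0 \<le> s \<and> s \<le> s + 1 * r then 1 else 0) \<partial>lborel)"
        by (rule nn_integral_real_affine) auto
      also have "\<dots> = (\<integral>\<^sup>+r. \<Psi> s (s + r) * indicator {0..} r * indicator {0..} s \<partial>lborel)"
        by (auto intro!: nn_integral_cong simp: indicator_def)
      also have "\<dots> = (\<integral>\<^sup>+r\<in>{0..}. \<Psi> s (s + r) \<partial>lborel) * indicator {0..} s"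
        by (rule nn_integral_multc) auto
      finally show "(\<integral>\<^sup>+t. \<Psi> s t * (if 0 \<le> s \<and> s \<le> t then 1 else 0) \<partial>lborel)
        = (\<integral>\<^sup>+r\<in>{0..}. \<Psi> s (s + r) \<partial>lborel) * indicator {0..} s" .
    qed
    finally show ?thesis unfolding \<Psi>_def .
  qed
  also have "\<dots> = free_res (\<lambda>y. \<omega> y * res \<omega> f y) x"
    unfolding res_def[of "\<lambda>_. 0"]
  proof (intro nn_integral_cong)
    fix s :: real
    show "(\<integral>\<^sup>+r\<in>{0..}. (\<integral>\<^sup>+w. \<Phi> s (s + r) w \<partial>M) \<partial>lborel) * indicator {0..} s
      = (fk_mean (\<lambda>_. 0) (\<lambda>y. \<omega> y * res \<omega> f y) x s) * indicator {0..} s"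
    proof (cases "0 \<le> s")
      case s: True
      \<comment> \<open>\<open>?Q\<close> is the integrand after the Markov property: the remaining
        expectation is frozen at the position at time s.\<close>
      let ?Q = "\<lambda>r w. if alive x s (path w) then ennreal (\<omega> (x + path w s)) * (fk_mean \<omega> f (x + path w s) r) else 0"
      have "(\<integral>\<^sup>+r\<in>{0..}. (\<integral>\<^sup>+w. \<Phi> s (s + r) w \<partial>M) \<partial>lborel) = (\<integral>\<^sup>+r\<in>{0..}. (\<integral>\<^sup>+w. ?Q r w \<partial>M) \<partial>lborel)"
      proof (intro nn_integral_cong)
        fix r :: real
        show "(\<integral>\<^sup>+w. \<Phi> s (s + r) w \<partial>M) * indicator {0..} r = (\<integral>\<^sup>+w. ?Q r w \<partial>M) * indicator {0..} r"
          using markov_fkf[OF \<omega>m f, of "\<lambda>y. ennreal (\<omega> y)" s r x] s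
          by (cases "0 \<le> r") (simp_all add: \<Phi>_def cong: if_cong)
      qed
      also have "\<dots> = (\<integral>\<^sup>+w. (\<integral>\<^sup>+r\<in>{0..}. ?Q r w \<partial>lborel) \<partial>M)"
      proof -
        have al [measurable]: "Measurable.pred (lborel \<Otimes>\<^sub>M M) (\<lambda>y. alive x s (path (snd y)))"
          by (rule alive_path_measurable) measurable
        have [measurable]: "(\<lambda>y. path (snd y) s) \<in> borel_measurable (lborel \<Otimes>\<^sub>M M)"
          by (rule path_measurable_compose) measurable
        have [measurable]: "(\<lambda>y. fk_mean \<omega> f (x + path (snd y) s) (fst y)) \<in> borel_measurable (lborel \<Otimes>\<^sub>M M)"
          by (rule expectation_fkf_measurable) measurable
        have Qm [measurable]: "(\<lambda>y. ?Q (fst y) (snd y)) \<in> borel_measurable (lborel \<Otimes>\<^sub>M M)"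
          by measurable
        have Qm2: "(\<lambda>w. ?Q r w) \<in> borel_measurable M" for r
        proof -
          have "(\<lambda>w. (\<lambda>y. ?Q (fst y) (snd y)) (r, w)) \<in> borel_measurable M"
            by (rule measurable_compose[OF _ Qm]) measurable
          then show ?thesis by (simp only: fst_conv snd_conv)
        qed
        have "(\<lambda>y. ?Q (fst y) (snd y) * indicator {0..} (fst y)) \<in> borel_measurable (lborel \<Otimes>\<^sub>M M)"
          by measurable
        from LM.Fubini[OF this] show ?thesis
          using Qm2 by (simp add: nn_integral_multc del: if_split cong: if_cong)
      qed
      also have "\<dots> = (fk_mean (\<lambda>_. 0) (\<lambda>y. \<omega> y * res \<omega> f y) x s)"
      proof (intro nn_integral_cong)
        fix w assume "w \<in> space M"
        have "(\<lambda>r. fk_mean \<omega> f (x + path w s) r) \<in> borel_measurable lborel"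
          by (rule expectation_fkf_measurable) measurable
        then show "(\<integral>\<^sup>+r\<in>{0..}. ?Q r w \<partial>lborel) = fkf (\<lambda>_. 0) (\<lambda>y. \<omega> y * res \<omega> f y) x s (path w)"
          by (simp add: fkf_zero res_def mult.assoc nn_integral_cmult)
      qed
      finally show ?thesis by simp
    qed simp
  qed
  finally show ?thesis .
qed

end

section \<open>Duality and optional stopping\<close>

text \<open>Bounded second moments give uniform integrability through Z \<le> min(Z, K) + Z^2 / K.
  The truncated part converges by domination, and the rest is at most |C| / K. Fatou's lemma gives
  the other inequality.\<close>

lemma (in prob_space) nn_integral_limit_second_moment:
  fixes Z :: "nat \<Rightarrow> 'a \<Rightarrow> real" and Z' :: "'a \<Rightarrow> real"
  assumes [measurable]: "\<And>n. Z n \<in> borel_measurable M" "Z' \<in> borel_measurable M"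
    and nonneg: "\<And>n w. 0 \<le> Z n w"
    and lim: "AE w in M. (\<lambda>n. Z n w) \<longlonglongrightarrow> Z' w"
    and moment: "\<And>n. (\<integral>\<^sup>+w. ennreal ((Z n w)\<^sup>2) \<partial>M) \<le> ennreal C"
    and L: "(\<lambda>n. \<integral>\<^sup>+w. ennreal (Z n w) \<partial>M) \<longlonglongrightarrow> L"
  shows "(\<integral>\<^sup>+w. ennreal (Z' w) \<partial>M) = L"
proof (rule antisym)
  have "(\<integral>\<^sup>+w. ennreal (Z' w) \<partial>M) = (\<integral>\<^sup>+w. liminf (\<lambda>n. ennreal (Z n w)) \<partial>M)"
  proof (rule nn_integral_cong_AE)
    show "AE w in M. ennreal (Z' w) = liminf (\<lambda>n. ennreal (Z n w))"
      using lim
    proof eventually_elim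
      case (elim w)
      then have "(\<lambda>n. ennreal (Z n w)) \<longlonglongrightarrow> ennreal (Z' w)" by (intro tendsto_ennrealI)
      then show ?case by (simp add: lim_imp_Liminf)
    qed
  qed
  also have "\<dots> \<le> liminf (\<lambda>n. \<integral>\<^sup>+w. ennreal (Z n w) \<partial>M)" by (rule nn_integral_liminf) simp
  also have "\<dots> = L" using L by (simp add: lim_imp_Liminf)
  finally show "(\<integral>\<^sup>+w. ennreal (Z' w) \<partial>M) \<le> L" .
next
  have le: "L \<le> (\<integral>\<^sup>+w. ennreal (Z' w) \<partial>M) + ennreal (\<bar>C\<bar> / real (Suc K))" for K :: nat
  proof -
    let ?K = "real (Suc K)"
    have "(\<lambda>n. \<integral>\<^sup>+w. ennreal (min (Z n w) ?K) \<partial>M) \<longlonglongrightarrow> (\<integral>\<^sup>+w. ennreal (min (Z' w) ?K) \<partial>M)"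
    proof (rule nn_integral_dominated_convergence[where w="\<lambda>_. ennreal ?K"])
      show "AE w in M. (\<lambda>n. ennreal (min (Z n w) ?K)) \<longlonglongrightarrow> ennreal (min (Z' w) ?K)"
        using lim by eventually_elim (intro tendsto_ennrealI tendsto_min tendsto_const)
    qed (auto intro!: AE_I2 ennreal_leI simp: emeasure_space_1 ennreal_mult_less_top simp del: of_nat_Suc)
    then have "(\<lambda>n. (\<integral>\<^sup>+w. ennreal (min (Z n w) ?K) \<partial>M) + ennreal (\<bar>C\<bar> / ?K)) \<longlonglongrightarrow> (\<integral>\<^sup>+w. ennreal (min (Z' w) ?K) \<partial>M) + ennreal (\<bar>C\<bar> / ?K)"
      by (intro tendsto_add tendsto_const)
    then have "L \<le> (\<integral>\<^sup>+w. ennreal (min (Z' w) ?K) \<partial>M) + ennreal (\<bar>C\<bar> / ?K)"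
    proof (rule LIMSEQ_le[OF L], intro exI allI impI)
      fix n
      have "Z n w \<le> min (Z n w) ?K + (Z n w)\<^sup>2 / ?K" for w
      proof (cases "Z n w \<le> ?K")
        case False
        then have "?K * Z n w \<le> Z n w * Z n w" using nonneg[of n w] by (intro mult_right_mono) auto
        then have "Z n w \<le> (Z n w)\<^sup>2 / ?K" by (simp add: power2_eq_square le_divide_eq mult.commute del: of_nat_Suc)
        then show ?thesis using nonneg[of n w] by (simp add: min_def)
      qed simp
      then have "ennreal (Z n w) \<le> ennreal (min (Z n w) ?K) + ennreal (1 / ?K) * ennreal ((Z n w)\<^sup>2)" for w
        using nonneg[of n w] by (simp add: ennreal_mult[symmetric] ennreal_plus[symmetric] ennreal_leI del: ennreal_plus of_nat_Suc)
      then have "(\<integral>\<^sup>+w. ennreal (Z n w) \<partial>M) \<le> (\<integral>\<^sup>+w. ennreal (min (Z n w) ?K) + ennreal (1 / ?K) * ennreal ((Z n w)\<^sup>2) \<partial>M)"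
        by (intro nn_integral_mono)
      also have "\<dots> = (\<integral>\<^sup>+w. ennreal (min (Z n w) ?K) \<partial>M) + ennreal (1 / ?K) * (\<integral>\<^sup>+w. ennreal ((Z n w)\<^sup>2) \<partial>M)"
        by (simp add: nn_integral_add nn_integral_cmult del: of_nat_Suc)
      also have "\<dots> \<le> (\<integral>\<^sup>+w. ennreal (min (Z n w) ?K) \<partial>M) + ennreal (1 / ?K) * ennreal \<bar>C\<bar>"
        using order_trans[OF moment[of n] ennreal_leI[OF abs_ge_self]] by (intro add_left_mono mult_left_mono) auto
      also have "ennreal (1 / ?K) * ennreal \<bar>C\<bar> = ennreal (\<bar>C\<bar> / ?K)"
        by (simp add: ennreal_mult[symmetric] del: of_nat_Suc)
      finally show "(\<integral>\<^sup>+w. ennreal (Z n w) \<partial>M) \<le> (\<integral>\<^sup>+w. ennreal (min (Z n w) ?K) \<partial>M) + ennreal (\<bar>C\<bar> / ?K)" .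
    qed
    also have "\<dots> \<le> (\<integral>\<^sup>+w. ennreal (Z' w) \<partial>M) + ennreal (\<bar>C\<bar> / ?K)"
      by (intro add_right_mono nn_integral_mono ennreal_leI) simp
    finally show ?thesis .
  qed
  have "(\<lambda>K. \<bar>C\<bar> / real (Suc K)) \<longlonglongrightarrow> 0"
    by (rule LIMSEQ_Suc[OF lim_const_over_n])
  then have "(\<lambda>K. (\<integral>\<^sup>+w. ennreal (Z' w) \<partial>M) + ennreal (\<bar>C\<bar> / real (Suc K))) \<longlonglongrightarrow> (\<integral>\<^sup>+w. ennreal (Z' w) \<partial>M) + ennreal 0"
    by (intro tendsto_add tendsto_const tendsto_ennrealI)
  then have "L \<le> (\<integral>\<^sup>+w. ennreal (Z' w) \<partial>M) + ennreal 0"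
    by (rule LIMSEQ_le_const) (use le in auto)
  then show "L \<le> (\<integral>\<^sup>+w. ennreal (Z' w) \<partial>M)" by simp
qed

section \<open>Time reversal in the starting point and optional stopping on a grid\<close>

context levy_process_from_zero
begin

text \<open>The process stays at or below y on [0, t]; reflecting the path lets the facts about
  \<open>alive\<close> apply.\<close>

abbreviation "below y t w \<equiv> alive y t (\<lambda>v. - path w v)"

lemma below_measurable:
  assumes [measurable]: "z \<in> borel_measurable N" "t \<in> borel_measurable N" "W \<in> measurable N M"
  shows "Measurable.pred N (\<lambda>a. alive (z a) (t a) (\<lambda>v. - path (W a) v))"
  unfolding alive_def
proof (rule pred_ball_rats1)
  fix q :: real
  have [measurable]: "(\<lambda>a. path (W a) (t a * q)) \<in> borel_measurable N"
    by (rule path_measurable_compose) measurable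
  show "Measurable.pred N (\<lambda>a. 0 \<le> z a + - path (W a) (t a * q))" by measurable
qed

text \<open>Lebesgue measure is invariant under the shift by X_t, so the end point y = x + X_t can
  replace the starting point x. Survival above 0, read backwards from y, says that the reversed
  process stays at or below y, and the reversed process has the law of X.\<close>

lemma duality:
  fixes f \<phi> :: "real \<Rightarrow> ennreal"
  assumes t: "0 \<le> t" and [measurable]: "f \<in> borel_measurable borel" "\<phi> \<in> borel_measurable borel"
  shows "(\<integral>\<^sup>+x. \<phi> x * (\<integral>\<^sup>+w. (if alive x t (path w) then f (x + path w t) else 0) \<partial>M) \<partial>lborel)
    = (\<integral>\<^sup>+y. f y * (\<integral>\<^sup>+w. (if below y t w then \<phi> (y - path w t) else 0) \<partial>M) \<partial>lborel)"
proof -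
  interpret LM: pair_sigma_finite lborel M ..
  have Xt [measurable]: "(\<lambda>w. path w t) \<in> borel_measurable M" by measurable
  define A where "A x w = (if alive x t (path w) then f (x + path w t) else 0)" for x w
  have Am: "(\<lambda>a. A (g a) (W a)) \<in> borel_measurable N" if [measurable]: "g \<in> borel_measurable N" "W \<in> measurable N M" for g W N
  proof -
    have [measurable]: "(\<lambda>a. path (W a) t) \<in> borel_measurable N" by (rule path_measurable_compose) measurable
    have [measurable]: "Measurable.pred N (\<lambda>a. alive (g a) t (path (W a)))" by (rule alive_path_measurable) measurable
    show ?thesis unfolding A_def by measurable
  qed
  have Am1 [measurable]: "A x \<in> borel_measurable M" for x using Am[of "\<lambda>_. x" M "\<lambda>w. w"] by simp
  have Am2: "(\<lambda>x. A x w) \<in> borel_measurable borel" if "w \<in> space M" for w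
    using Am[of "\<lambda>x. x" borel "\<lambda>_. w"] that by simp
  have Am3 [measurable]: "(\<lambda>a. A (fst a) (snd a)) \<in> borel_measurable (lborel \<Otimes>\<^sub>M M)"
    by (rule Am) measurable
  have "(\<integral>\<^sup>+x. \<phi> x * (\<integral>\<^sup>+w. A x w \<partial>M) \<partial>lborel) = (\<integral>\<^sup>+x. (\<integral>\<^sup>+w. \<phi> x * A x w \<partial>M) \<partial>lborel)"
    by (simp add: nn_integral_cmult)
  also have "\<dots> = (\<integral>\<^sup>+w. (\<integral>\<^sup>+x. \<phi> x * A x w \<partial>lborel) \<partial>M)"
  proof -
    have "(\<lambda>a. \<phi> (fst a) * A (fst a) (snd a)) \<in> borel_measurable (lborel \<Otimes>\<^sub>M M)" by measurable
    from LM.Fubini[OF this] show ?thesis by simp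
  qed
  also have "\<dots> = (\<integral>\<^sup>+w. (\<integral>\<^sup>+y. \<phi> (y - path w t) * A (y - path w t) w \<partial>lborel) \<partial>M)"
  proof (rule nn_integral_cong)
    fix w assume "w \<in> space M"
    note [measurable] = Am2[OF this]
    show "(\<integral>\<^sup>+x. \<phi> x * A x w \<partial>lborel) = (\<integral>\<^sup>+y. \<phi> (y - path w t) * A (y - path w t) w \<partial>lborel)"
      using nn_integral_real_affine[of "\<lambda>x. \<phi> x * A x w" 1 "- path w t"] by simp
  qed
  also have "\<dots> = (\<integral>\<^sup>+y. (\<integral>\<^sup>+w. \<phi> (y - path w t) * A (y - path w t) w \<partial>M) \<partial>lborel)"
  proof -
    have [measurable]: "(\<lambda>a. path (snd a) t) \<in> borel_measurable (lborel \<Otimes>\<^sub>M M)"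
      by (rule path_measurable_compose) measurable
    have [measurable]: "(\<lambda>a. A (fst a - path (snd a) t) (snd a)) \<in> borel_measurable (lborel \<Otimes>\<^sub>M M)"
      by (rule Am) measurable
    have "(\<lambda>a. \<phi> (fst a - path (snd a) t) * A (fst a - path (snd a) t) (snd a)) \<in> borel_measurable (lborel \<Otimes>\<^sub>M M)" by measurable
    from LM.Fubini[OF this] show ?thesis by simp
  qed
  also have "\<dots> = (\<integral>\<^sup>+y. f y * (\<integral>\<^sup>+w. (if below y t w then \<phi> (y - path w t) else 0) \<partial>M) \<partial>lborel)"
  proof (intro nn_integral_cong)
    fix y :: real
    define H where "H \<pi> = (if \<forall>q\<in>rats1. 0 \<le> y + - \<pi> q then \<phi> (y - \<pi> 1) else 0)" for \<pi> :: "real \<Rightarrow> real"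
    have one: "(1::real) \<in> rats1" by (auto simp: rats1_def)
    have comp: "(\<lambda>\<pi>. \<pi> q) \<in> borel_measurable paths1" if "q \<in> rats1" for q
      using that by (rule measurable_component_singleton)
    note [measurable] = comp[OF one]
    have [measurable]: "Measurable.pred paths1 (\<lambda>\<pi>. \<forall>q\<in>rats1. 0 \<le> y + - \<pi> q)"
    proof (rule pred_ball_rats1)
      fix q :: real assume "q \<in> rats1"
      note [measurable] = comp[OF this]
      show "Measurable.pred paths1 (\<lambda>\<pi>. 0 \<le> y + - \<pi> q)" by measurable
    qed
    have H: "H \<in> borel_measurable paths1" unfolding H_def by measurable
    have "(\<integral>\<^sup>+w. (if below y t w then \<phi> (y - path w t) else 0) \<partial>M) = (\<integral>\<^sup>+w. H (past t w) \<partial>M)"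
      using t one by (intro nn_integral_cong) (auto simp: H_def alive_def rats1_def)
    also have "\<dots> = (\<integral>\<^sup>+w. H (\<lambda>q\<in>rats1. X t w - X (t - t * q) w) \<partial>M)"
      by (rule reversal[OF t H])
    also have "\<dots> = (\<integral>\<^sup>+w. (if alive (y - path w t) t (path w) then \<phi> (y - path w t) else 0) \<partial>M)"
    proof (intro nn_integral_cong)
      fix w assume w: "w \<in> space M"
      have "(\<forall>q\<in>rats1. 0 \<le> y + - (X t w - X (t - t * q) w)) \<longleftrightarrow> (\<forall>q\<in>rats1. 0 \<le> y - X t w + path w (t * q))"
      proof (intro iffI ballI)
        fix q assume *: "\<forall>q\<in>rats1. 0 \<le> y + - (X t w - X (t - t * q) w)" and q: "q \<in> rats1"
        \<comment> \<open>The fraction q of the reversed time interval is the fraction 1 - q of the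
          original one.\<close>
        have "1 - q \<in> rats1" using q by (auto simp: rats1_def)
        then have "0 \<le> y + - (X t w - X (t - t * (1 - q)) w)" using * by blast
        then show "0 \<le> y - X t w + path w (t * q)" using q t by (simp add: algebra_simps rats1_def)
      next
        fix q assume *: "\<forall>q\<in>rats1. 0 \<le> y - X t w + path w (t * q)" and q: "q \<in> rats1"
        have q': "1 - q \<in> rats1" using q by (auto simp: rats1_def)
        then have "0 \<le> y - X t w + path w (t * (1 - q))" using * by blast
        moreover have "0 \<le> t * (1 - q)" using q t by (simp add: rats1_def)
        ultimately show "0 \<le> y + - (X t w - X (t - t * q) w)" by (simp add: algebra_simps)
      qed
      then show "H (\<lambda>q\<in>rats1. X t w - X (t - t * q) w) = (if alive (y - path w t) t (path w) then \<phi> (y - path w t) else 0)"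
        using t one X_start[OF w] by (simp add: H_def alive_def)
    qed
    finally have *: "(\<integral>\<^sup>+w. (if below y t w then \<phi> (y - path w t) else 0) \<partial>M)
      = (\<integral>\<^sup>+w. (if alive (y - path w t) t (path w) then \<phi> (y - path w t) else 0) \<partial>M)" .
    have "(\<integral>\<^sup>+w. \<phi> (y - path w t) * A (y - path w t) w \<partial>M)
      = (\<integral>\<^sup>+w. f y * (if alive (y - path w t) t (path w) then \<phi> (y - path w t) else 0) \<partial>M)"
      unfolding A_def by (intro nn_integral_cong) (simp add: mult.commute)
    also have "\<dots> = f y * (\<integral>\<^sup>+w. (if alive (y - path w t) t (path w) then \<phi> (y - path w t) else 0) \<partial>M)"
    proof (rule nn_integral_cmult)
      have [measurable]: "Measurable.pred M (\<lambda>w. alive (y - path w t) t (path w))"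
        by (rule alive_path_measurable) measurable
      show "(\<lambda>w. if alive (y - path w t) t (path w) then \<phi> (y - path w t) else 0) \<in> borel_measurable M" by measurable
    qed
    finally show "(\<integral>\<^sup>+w. \<phi> (y - path w t) * A (y - path w t) w \<partial>M)
      = f y * (\<integral>\<^sup>+w. (if below y t w then \<phi> (y - path w t) else 0) \<partial>M)"
      using * by simp
  qed
  finally show ?thesis unfolding A_def .
qed

definition below_exp :: "real \<Rightarrow> real \<Rightarrow> real \<Rightarrow> ennreal" where
  "below_exp \<theta> y t = (\<integral>\<^sup>+w. (if below y t w then ennreal (exp (\<theta> * path w t)) else 0) \<partial>M)"

definition occ :: "real \<Rightarrow> real \<Rightarrow> ennreal" where
  "occ \<theta> y = (\<integral>\<^sup>+t\<in>{0..}. below_exp \<theta> y t \<partial>lborel)"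

lemma below_exp_measurable:
  assumes [measurable]: "z \<in> borel_measurable N" "t \<in> borel_measurable N"
  shows "(\<lambda>a. below_exp \<theta> (z a) (t a)) \<in> borel_measurable N"
proof -
  have [measurable]: "Measurable.pred (N \<Otimes>\<^sub>M M) (\<lambda>x. alive (z (fst x)) (t (fst x)) (\<lambda>v. - path (snd x) v))"
    by (rule below_measurable) measurable
  have [measurable]: "(\<lambda>x. path (snd x) (t (fst x))) \<in> borel_measurable (N \<Otimes>\<^sub>M M)"
    by (rule path_measurable_compose) measurable
  have "(\<lambda>x. if alive (z (fst x)) (t (fst x)) (\<lambda>v. - path (snd x) v) then ennreal (exp (\<theta> * path (snd x) (t (fst x)))) else 0) \<in> borel_measurable (N \<Otimes>\<^sub>M M)"
    by measurable
  from borel_measurable_nn_integral_fst[OF this] show ?thesis by (simp add: below_exp_def)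
qed

text \<open>Duality with the test function e^(-\<theta> x) on x \<ge> 0. Since x = y - X_t, this
  factor becomes e^(-\<theta> y) e^(\<theta> X_t), which is how the exponential occupation
  \<open>occ\<close> before passage above y arises.\<close>

theorem res_laplace_transform:
  assumes [measurable]: "f \<in> borel_measurable borel"
  shows "(\<integral>\<^sup>+x\<in>{0..}. ennreal (exp (- \<theta> * x)) * free_res f x \<partial>lborel)
    = (\<integral>\<^sup>+y. f y * (ennreal (exp (- \<theta> * y)) * occ \<theta> y) \<partial>lborel)"
proof -
  let ?\<phi> = "\<lambda>x. ennreal (exp (- \<theta> * x)) * indicator {0..} x"
  let ?R = "\<lambda>x t. fk_mean (\<lambda>_. 0) f x t"
  have one: "(1::real) \<in> rats1" by (auto simp: rats1_def)
  have R: "(\<lambda>x. ?R (z x) (t x)) \<in> borel_measurable N" if "z \<in> borel_measurable N" "t \<in> borel_measurable N" for z t N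
    using that by (intro expectation_fkf_measurable) auto
  have [measurable]: "?R x \<in> borel_measurable borel" for x by (rule R) measurable
  have [measurable]: "(\<lambda>x. ?R x t) \<in> borel_measurable borel" for t by (rule R) measurable
  have [measurable]: "(\<lambda>x. ?R (fst x) (snd x)) \<in> borel_measurable (lborel \<Otimes>\<^sub>M lborel)" by (rule R) measurable
  have [measurable]: "below_exp \<theta> y \<in> borel_measurable borel" for y by (rule below_exp_measurable) measurable
  have [measurable]: "(\<lambda>y. below_exp \<theta> y t) \<in> borel_measurable borel" for t by (rule below_exp_measurable) measurable
  have [measurable]: "(\<lambda>x. below_exp \<theta> (snd x) (fst x)) \<in> borel_measurable (lborel \<Otimes>\<^sub>M lborel)" by (rule below_exp_measurable) measurable
  have "(\<integral>\<^sup>+x\<in>{0..}. ennreal (exp (- \<theta> * x)) * free_res f x \<partial>lborel)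
    = (\<integral>\<^sup>+x. (\<integral>\<^sup>+t. ?\<phi> x * (?R x t * indicator {0..} t) \<partial>lborel) \<partial>lborel)"
  proof (intro nn_integral_cong)
    fix x :: real
    have "(\<integral>\<^sup>+t. ?\<phi> x * (?R x t * indicator {0..} t) \<partial>lborel) = ?\<phi> x * free_res f x"
      unfolding res_def by (rule nn_integral_cmult) measurable
    then show "ennreal (exp (- \<theta> * x)) * free_res f x * indicator {0..} x
      = (\<integral>\<^sup>+t. ?\<phi> x * (?R x t * indicator {0..} t) \<partial>lborel)"
      by (simp only: mult_ac)
  qed
  also have "\<dots> = (\<integral>\<^sup>+t. (\<integral>\<^sup>+x. ?\<phi> x * (?R x t * indicator {0..} t) \<partial>lborel) \<partial>lborel)"
  proof -
    have "(\<lambda>a. ?\<phi> (fst a) * (?R (fst a) (snd a) * indicator {0..} (snd a))) \<in> borel_measurable (lborel \<Otimes>\<^sub>M lborel)" by measurable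
    from lborel_pair.Fubini[OF this] show ?thesis by simp
  qed
  also have "\<dots> = (\<integral>\<^sup>+t. (\<integral>\<^sup>+y. f y * (ennreal (exp (- \<theta> * y)) * (below_exp \<theta> y t * indicator {0..} t)) \<partial>lborel) \<partial>lborel)"
  proof (rule nn_integral_cong)
    fix t :: real
    show "(\<integral>\<^sup>+x. ?\<phi> x * (?R x t * indicator {0..} t) \<partial>lborel)
      = (\<integral>\<^sup>+y. f y * (ennreal (exp (- \<theta> * y)) * (below_exp \<theta> y t * indicator {0..} t)) \<partial>lborel)"
    proof (cases "0 \<le> t")
      case t: True
      have "(\<integral>\<^sup>+x. ?\<phi> x * ?R x t \<partial>lborel) = (\<integral>\<^sup>+x. ?\<phi> x * (\<integral>\<^sup>+w. (if alive x t (path w) then f (x + path w t) else 0) \<partial>M) \<partial>lborel)"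
        by (simp add: fkf_zero)
      also have "\<dots> = (\<integral>\<^sup>+y. f y * (\<integral>\<^sup>+w. (if below y t w then ?\<phi> (y - path w t) else 0) \<partial>M) \<partial>lborel)"
        by (rule duality[OF t]) measurable
      also have "\<dots> = (\<integral>\<^sup>+y. f y * (ennreal (exp (- \<theta> * y)) * below_exp \<theta> y t) \<partial>lborel)"
      proof (intro nn_integral_cong arg_cong2[where f="(*)"] refl)
        fix y :: real
        have [measurable]: "Measurable.pred M (\<lambda>w. below y t w)"
          by (rule below_measurable) measurable
        have "(\<integral>\<^sup>+w. (if below y t w then ?\<phi> (y - path w t) else 0) \<partial>M)
          = (\<integral>\<^sup>+w. ennreal (exp (- \<theta> * y)) * (if below y t w then ennreal (exp (\<theta> * path w t)) else 0) \<partial>M)"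
        proof (intro nn_integral_cong)
          fix w
          show "(if below y t w then ?\<phi> (y - path w t) else 0)
            = ennreal (exp (- \<theta> * y)) * (if below y t w then ennreal (exp (\<theta> * path w t)) else 0)"
          proof (cases "below y t w")
            case True
            \<comment> \<open>Staying at or below y includes the final time, so y - X_t \<ge> 0 and
              the indicator of the half-line equals 1.\<close>
            then have "path w t \<le> y" using one t by (auto simp: alive_def dest: bspec[of _ _ 1])
            then show ?thesis using True
              by (simp add: ennreal_mult[symmetric] exp_add[symmetric] algebra_simps)
          qed simp
        qed
        also have "\<dots> = ennreal (exp (- \<theta> * y)) * below_exp \<theta> y t"
          unfolding below_exp_def by (rule nn_integral_cmult) measurable
        finally show "(\<integral>\<^sup>+w. (if below y t w then ?\<phi> (y - path w t) else 0) \<partial>M) = \<dots>" .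
      qed
      finally show ?thesis using t by simp
    qed simp
  qed
  also have "\<dots> = (\<integral>\<^sup>+y. (\<integral>\<^sup>+t. f y * (ennreal (exp (- \<theta> * y)) * (below_exp \<theta> y t * indicator {0..} t)) \<partial>lborel) \<partial>lborel)"
  proof -
    have "(\<lambda>a. f (snd a) * (ennreal (exp (- \<theta> * snd a)) * (below_exp \<theta> (snd a) (fst a) * indicator {0..} (fst a)))) \<in> borel_measurable (lborel \<Otimes>\<^sub>M lborel)"
      by measurable
    from lborel_pair.Fubini[OF this] show ?thesis by simp
  qed
  also have "\<dots> = (\<integral>\<^sup>+y. f y * (ennreal (exp (- \<theta> * y)) * occ \<theta> y) \<partial>lborel)"
    unfolding occ_def by (simp add: nn_integral_cmult)
  finally show ?thesis .
qed

text \<open>The crossing event is split according to the first grid index k above y. Given the path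
  up to that grid time, the Markov property replaces e^(\<theta> X_t) by its value there times the
  exponential moment of an independent increment. At paths without a crossing
  \<open>\<sigma>\<close> has no meaning and is not consulted.\<close>

lemma grid_optional_stopping:
  assumes y: "0 < y" and t: "0 \<le> t" and N: "0 < N"
    and laplace: "\<And>s. 0 \<le> s \<Longrightarrow> (\<integral>\<^sup>+w. ennreal (exp (\<theta> * X s w)) \<partial>M) = ennreal (exp (s * c))"
  defines "crosses w \<equiv> \<exists>k\<le>N. y < X (t * (real k / real N)) w"
    and "\<sigma> w \<equiv> t * (real (LEAST k. y < X (t * (real k / real N)) w) / real N)"
  shows "(\<integral>\<^sup>+w. (if crosses w then ennreal (exp (\<theta> * X t w)) else 0) \<partial>M)
    = (\<integral>\<^sup>+w. (if crosses w then ennreal (exp (\<theta> * X (\<sigma> w) w + c * (t - \<sigma> w))) else 0) \<partial>M)"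
proof -
  define s where "s k = t * (real k / real N)" for k
  have s: "0 \<le> s k" for k using t by (simp add: s_def)
  have [measurable]: "X (s k) \<in> borel_measurable M" for k using s by (rule X_meas)
  have [measurable]: "X t \<in> borel_measurable M" using t by (rule X_meas)
  define first where "first k w \<longleftrightarrow> y < X (s k) w \<and> (\<forall>j<k. X (s j) w \<le> y)" for k w
  have [measurable]: "Measurable.pred M (first k)" for k unfolding first_def by measurable
  have split: "(if crosses w then F (\<sigma> w) else (0::ennreal)) = (\<Sum>k\<le>N. if first k w then F (s k) else 0)" for w F
  proof (cases "crosses w")
    case True
    define k where "k = (LEAST k. y < X (s k) w)"
    obtain k' where k': "k' \<le> N" "y < X (s k') w" using True by (auto simp: crosses_def s_def)
    have "y < X (s k) w" unfolding k_def by (rule LeastI[where k=k']) (rule k')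
    moreover have "X (s j) w \<le> y" if "j < k" for j
      using not_less_Least[OF that[unfolded k_def]] by simp
    moreover have "k \<le> k'" unfolding k_def by (rule Least_le) (rule k')
    ultimately have k: "k \<le> N" "first k w" using k'(1) by (simp_all add: first_def)
    have "first j w \<longleftrightarrow> j = k" for j
    proof
      assume "first j w"
      then have "\<not> j < k" "\<not> k < j" using k(2) by (auto simp: first_def not_less[symmetric])
      then show "j = k" by simp
    qed (use k in simp)
    moreover have "\<sigma> w = s k" by (simp add: \<sigma>_def s_def k_def)
    ultimately show ?thesis using True k by simp
  next
    case False
    then have "\<not> first k w" if "k \<le> N" for k using that by (auto simp: crosses_def first_def s_def)
    then show ?thesis using False by simp
  qed
  have eq: "(\<integral>\<^sup>+w. (if first k w then ennreal (exp (\<theta> * X t w)) else 0) \<partial>M)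
    = (\<integral>\<^sup>+w. (if first k w then ennreal (exp (\<theta> * X (s k) w + c * (t - s k))) else 0) \<partial>M)" if k: "k \<le> N" for k
  proof (cases "k = 0")
    case True
    then have "\<not> first k w" if "w \<in> space M" for w using X_start[OF that] y by (simp add: first_def s_def)
    then show ?thesis by (simp cong: nn_integral_cong)
  next
    case False
    have st: "s k \<le> t" using k N t unfolding s_def by (intro mult_left_le) (auto simp: divide_le_eq_1)
    \<comment> \<open>In the past rescaled by s(k), the earlier grid times are the rational
      fractions j/k.\<close>
    define Q where "Q \<pi> \<longleftrightarrow> (\<forall>j<k. \<pi> (real j / real k) \<le> y)" for \<pi>
    define H where "H \<pi> \<xi> = (if y < \<pi> 1 \<and> Q \<pi> then ennreal (exp (\<theta> * \<pi> 1)) * ennreal (exp (\<theta> * rpath \<xi> (t - s k))) else 0)" for \<pi> \<xi>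
    let ?P = "paths1 \<Otimes>\<^sub>M paths0"
    have one: "(1::real) \<in> rats1" by (auto simp: rats1_def)
    have frac: "real j / real k \<in> rats1" if "j < k" for j using that by (intro rats_fraction) auto
    have comp: "(\<lambda>y. fst y q) \<in> borel_measurable ?P" if "q \<in> rats1" for q
      using that by (intro measurable_compose[OF measurable_fst] measurable_component_singleton)
    note [measurable] = comp[OF one]
    have [measurable]: "Measurable.pred ?P (\<lambda>p. Q (fst p))"
    proof -
      have "Measurable.pred ?P (\<lambda>p. \<forall>j\<in>{..<k}. fst p (real j / real k) \<le> y)"
      proof (rule pred_intros_finite(3))
        fix j assume "j \<in> {..<k}"
        then have [measurable]: "(\<lambda>p. fst p (real j / real k)) \<in> borel_measurable ?P" by (intro comp frac) simp
        show "Measurable.pred ?P (\<lambda>p. fst p (real j / real k) \<le> y)" by measurable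
      qed simp
      then show ?thesis by (simp only: Q_def Ball_def lessThan_iff)
    qed
    have [measurable]: "(\<lambda>p. rpath (snd p) (t - s k)) \<in> borel_measurable ?P"
    proof -
      have "(\<lambda>p. (\<lambda>(\<xi>, t). rpath \<xi> t) (snd p, t - s k)) \<in> borel_measurable ?P" by measurable
      then show ?thesis by simp
    qed
    have Hm: "case_prod H \<in> borel_measurable ?P" unfolding H_def case_prod_beta' by measurable
    have past1: "past (s k) w 1 = X (s k) w" for w using one by simp
    have first_past: "first k w \<longleftrightarrow> y < X (s k) w \<and> Q (past (s k) w)" for w
    proof -
      have e: "past (s k) w (real j / real k) = X (s j) w" if "j < k" for j
        using frac[OF that] that by (simp add: s_def)
      show ?thesis unfolding first_def Q_def
        by (intro conj_cong refl all_cong1 imp_cong) (simp only: e)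
    qed
    have "(\<integral>\<^sup>+w. (if first k w then ennreal (exp (\<theta> * X t w)) else 0) \<partial>M) = (\<integral>\<^sup>+w. H (past (s k) w) (future (s k) w) \<partial>M)"
    proof (intro nn_integral_cong)
      fix w assume w: "w \<in> space M"
      have "rpath (future (s k) w) (t - s k) = X (s k + (max (t - s k) 0)) w - X (s k) w"
        by (intro rpath_eq rcont_shift w s)
      then have fl: "rpath (future (s k) w) (t - s k) = X t w - X (s k) w" using st by simp
      then show "(if first k w then ennreal (exp (\<theta> * X t w)) else 0) = H (past (s k) w) (future (s k) w)"
        unfolding H_def past1 first_past[symmetric] fl
        by (simp add: ennreal_mult[symmetric] exp_add[symmetric] right_diff_distrib)
    qed
    also have "\<dots> = (\<integral>\<^sup>+w. \<integral>\<^sup>+w'. H (past (s k) w) (\<lambda>r\<in>rats0. X r w') \<partial>M \<partial>M)"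
      by (rule markov[OF s Hm])
    also have "\<dots> = (\<integral>\<^sup>+w. (if first k w then ennreal (exp (\<theta> * X (s k) w + c * (t - s k))) else 0) \<partial>M)"
    proof (intro nn_integral_cong)
      fix w
      have "(\<integral>\<^sup>+w'. H (past (s k) w) (\<lambda>r\<in>rats0. X r w') \<partial>M)
        = (\<integral>\<^sup>+w'. (if first k w then ennreal (exp (\<theta> * X (s k) w)) else 0) * ennreal (exp (\<theta> * X (t - s k) w')) \<partial>M)"
      proof (intro nn_integral_cong)
        fix w' assume w': "w' \<in> space M"
        have "rpath (\<lambda>r\<in>rats0. X r w') (t - s k) = X (t - s k) w'"
          using st by (simp add: rpath_eq[OF rcont_X[OF w']])
        then show "H (past (s k) w) (\<lambda>r\<in>rats0. X r w') = (if first k w then ennreal (exp (\<theta> * X (s k) w)) else 0) * ennreal (exp (\<theta> * X (t - s k) w'))"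
          unfolding H_def past1 first_past[symmetric] by simp
      qed
      also have "\<dots> = (if first k w then ennreal (exp (\<theta> * X (s k) w)) else 0) * ennreal (exp ((t - s k) * c))"
        using st laplace[of "t - s k"] by (subst nn_integral_cmult) auto
      also have "\<dots> = (if first k w then ennreal (exp (\<theta> * X (s k) w + c * (t - s k))) else 0)"
        by (simp add: ennreal_mult[symmetric] exp_add mult.commute)
      finally show "(\<integral>\<^sup>+w'. H (past (s k) w) (\<lambda>r\<in>rats0. X r w') \<partial>M) = \<dots>" .
    qed
    finally show ?thesis .
  qed
  have "(\<integral>\<^sup>+w. (if crosses w then ennreal (exp (\<theta> * X t w)) else 0) \<partial>M)
    = (\<integral>\<^sup>+w. (\<Sum>k\<le>N. if first k w then ennreal (exp (\<theta> * X t w)) else 0) \<partial>M)"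
    using split[of _ "\<lambda>_. ennreal (exp (\<theta> * X t w))" for w] by (intro nn_integral_cong) simp
  also have "\<dots> = (\<Sum>k\<le>N. \<integral>\<^sup>+w. (if first k w then ennreal (exp (\<theta> * X t w)) else 0) \<partial>M)"
    by (rule nn_integral_sum) measurable
  also have "\<dots> = (\<Sum>k\<le>N. \<integral>\<^sup>+w. (if first k w then ennreal (exp (\<theta> * X (s k) w + c * (t - s k))) else 0) \<partial>M)"
    using eq by (intro sum.cong) auto
  also have "\<dots> = (\<integral>\<^sup>+w. (\<Sum>k\<le>N. if first k w then ennreal (exp (\<theta> * X (s k) w + c * (t - s k))) else 0) \<partial>M)"
    by (rule nn_integral_sum[symmetric]) measurable
  also have "\<dots> = (\<integral>\<^sup>+w. (if crosses w then ennreal (exp (\<theta> * X (\<sigma> w) w + c * (t - \<sigma> w))) else 0) \<partial>M)"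
    using split[of w "\<lambda>u. ennreal (exp (\<theta> * X u w + c * (t - u)))" for w] by (intro nn_integral_cong) simp
  finally show ?thesis .
qed

end

section \<open>First passage upwards\<close>

locale snlp_from_zero = levy_process_from_zero +
  fixes \<psi> :: "real \<Rightarrow> real"
  assumes no_jumps: "AE w in M. no_positive_jumps (\<lambda>t. X t w)"
    and not_decreasing: "\<not> (AE w in M. \<forall>s t. 0 \<le> s \<longrightarrow> s \<le> t \<longrightarrow> X t w \<le> X s w)"
    and laplace_exponent: "is_laplace_exponent M X \<psi>"
begin

lemma laplace_nn:
  assumes "0 \<le> t" "0 \<le> \<theta>"
  shows "(\<integral>\<^sup>+w. ennreal (exp (\<theta> * X t w)) \<partial>M) = ennreal (exp (t * \<psi> \<theta>))"
proof -
  have eq: "(LINT w|M. exp (\<theta> * X t w)) = exp (t * \<psi> \<theta>)"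
    using laplace_exponent assms by (auto simp: is_laplace_exponent_def)
  then have "integrable M (\<lambda>w. exp (\<theta> * X t w))"
    using not_integrable_integral_eq by fastforce
  from nn_integral_eq_integral[OF this] eq show ?thesis by simp
qed

text \<open>Some X_t exceeds some a > 0 with positive probability, so E e^(\<theta> X_t) \<ge>
  e^(\<theta> a) P(X_t > a), which is larger than 1 for large \<theta>.\<close>

lemma psi_eventually_pos: obtains \<theta>\<^sub>0 where "0 < \<theta>\<^sub>0" and "\<And>\<theta>. \<theta>\<^sub>0 \<le> \<theta> \<Longrightarrow> 0 < \<psi> \<theta>"
proof -
  \<comment> \<open>Otherwise stationarity makes all increments between rational times almost surely
    nonpositive, and right continuity makes almost every path non-increasing.\<close>
  have "\<exists>t\<ge>0. \<not> (AE w in M. X t w \<le> 0)"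
  proof (rule ccontr)
    assume "\<not> (\<exists>t\<ge>0. \<not> (AE w in M. X t w \<le> 0))"
    then have le0: "AE w in M. X t w \<le> 0" if "0 \<le> t" for t using that by blast
    have incr: "AE w in M. X (s + t) w \<le> X s w" if st: "0 \<le> s" "0 \<le> t" for s t
    proof -
      have "AE x in distr M borel (X t). x \<le> 0"
        using le0[OF st(2)] st by (subst AE_distr_iff) auto
      then have "AE x in distr M borel (\<lambda>w. X (s + t) w - X s w). x \<le> 0"
        using stationary_increments[OF st] by (simp only:)
      then show ?thesis using st by (subst (asm) AE_distr_iff) auto
    qed
    have "AE w in M. \<forall>s\<in>rats0. \<forall>r\<in>rats0. X (s + r) w \<le> X s w"
      by (intro AE_ball_countable[THEN iffD2] ballI incr countable_rats) (auto simp: rats0_def)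
    then have "AE w in M. \<forall>s t. 0 \<le> s \<longrightarrow> s \<le> t \<longrightarrow> X t w \<le> X s w"
      using AE_space
    proof eventually_elim
      case (elim w)
      show ?case
      proof (intro allI impI, rule ccontr)
        fix s t :: real assume s: "0 \<le> s" "s \<le> t" and "\<not> X t w \<le> X s w"
        then have lt: "X s w < X t w" by simp
        define m where "m = (X s w + X t w) / 2"
        have m: "X s w < m" "m < X t w" using lt by (auto simp: m_def)
        have rc: "((\<lambda>u. X u w) \<longlongrightarrow> X u w) (at_right u)" if "0 \<le> u" for u
          using rcont_X[OF elim(2)] that by (simp add: rcont_def)
        have "s \<noteq> t" using lt by auto
        then have "\<forall>\<^sub>F u in at_right s. X u w < m \<and> u < t"
          using order_tendstoD(2)[OF rc[OF s(1)] m(1)] s by (auto simp: eventually_at_right_less eventually_conj_iff intro: eventually_at_rightI[of s t])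
        then obtain b where b: "b > s" "\<And>u. s < u \<Longrightarrow> u < b \<Longrightarrow> X u w < m \<and> u < t"
          by (auto simp: eventually_at_right_field)
        obtain p where p: "p \<in> \<rat>" "s < p" "p < b" using Rats_dense_in_real b(1) by blast
        have "\<forall>\<^sub>F u in at_right t. m < X u w" using order_tendstoD(1)[OF rc m(2)] s by simp
        then obtain b' where b': "b' > t" "\<And>u. t < u \<Longrightarrow> u < b' \<Longrightarrow> m < X u w"
          by (auto simp: eventually_at_right_field)
        obtain q where q: "q \<in> \<rat>" "t < q" "q < b'" using Rats_dense_in_real b'(1) by blast
        have "p < t" using b(2)[of p] p by simp
        then have "p \<in> rats0" "q - p \<in> rats0" using p q s by (auto simp: rats0_def)
        then have "X (p + (q - p)) w \<le> X p w" using elim(1) by blast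
        then show False using b(2)[of p] b'(2)[of q] p q by auto
      qed
    qed
    then show False using not_decreasing by contradiction
  qed
  then obtain t where t: "0 \<le> t" and nle: "\<not> (AE w in M. X t w \<le> 0)" by blast
  have [measurable]: "X t \<in> borel_measurable M" using t by (rule X_meas)
  have "\<exists>n::nat. \<not> (AE w in M. X t w \<le> 1 / real (Suc n))"
  proof (rule ccontr)
    assume "\<not> (\<exists>n::nat. \<not> (AE w in M. X t w \<le> 1 / real (Suc n)))"
    then have "\<forall>n::nat. AE w in M. X t w \<le> 1 / real (Suc n)" by blast
    then have "AE w in M. \<forall>n::nat. X t w \<le> 1 / real (Suc n)" unfolding AE_all_countable .
    then have "AE w in M. X t w \<le> 0"
    proof eventually_elim
      case (elim w)
      show ?case
      proof (rule ccontr)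
        assume "\<not> X t w \<le> 0"
        then have "0 < X t w" by simp
        from reals_Archimedean[OF this] obtain n where "inverse (real (Suc n)) < X t w" by blast
        then have "1 / real (Suc n) < X t w" by (simp only: inverse_eq_divide)
        moreover have "X t w \<le> 1 / real (Suc n)" using elim by blast
        ultimately show False by linarith
      qed
    qed
    then show False using nle by contradiction
  qed
  then obtain n :: nat where n: "\<not> (AE w in M. X t w \<le> 1 / real (Suc n))" by blast
  define a where "a = 1 / real (Suc n)"
  define E where "E = {w \<in> space M. a < X t w}"
  have E [measurable]: "E \<in> sets M" unfolding E_def by measurable
  have a: "0 < a" by (simp add: a_def)
  have "emeasure M E \<noteq> 0"
  proof
    assume "emeasure M E = 0"
    then have "AE w in M. \<not> a < X t w" using E by (subst AE_iff_measurable[OF E]) (auto simp: E_def)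
    then show False using n by (simp add: a_def not_less)
  qed
  then have d: "0 < prob E" by (simp add: emeasure_eq_measure zero_less_measure_iff)
  define \<theta>\<^sub>0 where "\<theta>\<^sub>0 = max 1 ((1 - ln (prob E)) / a)"
  \<comment> \<open>The threshold is chosen so that \<theta> a + ln P(E) \<ge> 1; the maximum with 1
    also keeps \<theta> positive.\<close>
  have tpos: "0 < t * \<psi> \<theta>" if \<theta>: "\<theta>\<^sub>0 \<le> \<theta>" for \<theta>
  proof -
    have "0 \<le> \<theta>" using \<theta> by (simp add: \<theta>\<^sub>0_def)
    have "1 - ln (prob E) \<le> \<theta> * a" using \<theta> a by (simp add: \<theta>\<^sub>0_def pos_divide_le_eq)
    then have "0 < ln (prob E) + \<theta> * a" by simp
    then have "1 < exp (ln (prob E) + \<theta> * a)" by simp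
    then have "ennreal 1 < ennreal (exp (\<theta> * a) * prob E)"
      using d by (intro ennreal_lessI) (auto simp: exp_add mult.commute)
    also have "\<dots> = (\<integral>\<^sup>+w. ennreal (exp (\<theta> * a)) * indicator E w \<partial>M)"
      by (simp add: nn_integral_cmult emeasure_eq_measure ennreal_mult)
    also have "\<dots> \<le> (\<integral>\<^sup>+w. ennreal (exp (\<theta> * X t w)) \<partial>M)"
      using \<open>0 \<le> \<theta>\<close> by (intro nn_integral_mono) (auto simp: E_def indicator_def intro!: ennreal_leI mult_left_mono)
    also have "\<dots> = ennreal (exp (t * \<psi> \<theta>))" by (rule laplace_nn[OF t \<open>0 \<le> \<theta>\<close>])
    finally show ?thesis by (simp add: ennreal_less_iff)
  qed
  show ?thesis
  proof
    show "0 < \<theta>\<^sub>0" by (simp add: \<theta>\<^sub>0_def)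
    show "0 < \<psi> \<theta>" if "\<theta>\<^sub>0 \<le> \<theta>" for \<theta> using tpos[OF that] t by (simp add: zero_less_mult_iff)
  qed
qed

text \<open>Meaningful only if the level is crossed: otherwise this is \<open>Inf {}\<close>.\<close>

definition hit :: "real \<Rightarrow> 'a \<Rightarrow> real" where
  "hit y w = Inf {u. 0 \<le> u \<and> y < X u w}"

lemma hit_le:
  assumes "0 \<le> v" "y < X v w" shows "0 \<le> hit y w" "hit y w \<le> v"
  using assms unfolding hit_def
  by (auto intro!: cInf_greatest cInf_lower bdd_belowI[where m=0])

text \<open>Right continuity gives X \<ge> y at the infimum. Before it the path is at most y, hence
  so is the left limit, and the absence of positive jumps gives X \<le> y. A time with value above y
  is therefore strictly later.\<close>

lemma X_hit:
  assumes w: "w \<in> space M" and nj: "no_positive_jumps (\<lambda>t. X t w)"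
    and y: "0 < y" and v: "0 \<le> v" "y < X v w"
  shows "X (hit y w) w = y" and "hit y w < v"
proof -
  let ?S = "{u. 0 \<le> u \<and> y < X u w}" and ?\<tau> = "hit y w"
  have \<tau>0: "0 \<le> ?\<tau>" using hit_le[OF v] by simp
  have rc: "((\<lambda>u. X u w) \<longlongrightarrow> X ?\<tau> w) (at_right ?\<tau>)"
    using rcont_X[OF w] \<tau>0 by (simp add: rcont_def)
  have before: "X u w \<le> y" if "0 \<le> u" "u < ?\<tau>" for u
    using hit_le(2)[of u y w] that by force
  have "y \<le> X ?\<tau> w"
  proof (rule ccontr)
    assume "\<not> y \<le> X ?\<tau> w"
    then have lt: "X ?\<tau> w < y" by simp
    obtain b where b: "b > ?\<tau>" "\<And>u. ?\<tau> < u \<Longrightarrow> u < b \<Longrightarrow> X u w < y"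
      using order_tendstoD(2)[OF rc lt] by (auto simp: eventually_at_right_field)
    have "b \<le> ?\<tau>" unfolding hit_def
    proof (rule cInf_greatest)
      show "?S \<noteq> {}" using v by auto
      fix u assume "u \<in> ?S"
      then have u: "0 \<le> u" "y < X u w" by auto
      then have "?\<tau> \<le> u" by (intro hit_le)
      then show "b \<le> u" using b(2)[of u] lt u by (cases "u = ?\<tau>") force+
    qed
    then show False using b by simp
  qed
  moreover have "X ?\<tau> w \<le> y"
  proof (cases "?\<tau> = 0")
    case True
    then show ?thesis using X_start[OF w] y by simp
  next
    case False
    then have pos: "0 < ?\<tau>" using \<tau>0 by simp
    obtain l where l: "((\<lambda>u. X u w) \<longlongrightarrow> l) (at_left ?\<tau>)"
      using cadlag_paths[OF w] pos by (auto simp: cadlag_def)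
    have "l \<le> y"
    proof (rule tendsto_upperbound[OF l])
      show "\<forall>\<^sub>F u in at_left ?\<tau>. X u w \<le> y"
        using pos before by (auto simp: eventually_at_left_field intro!: exI[of _ 0])
    qed simp
    moreover have "X ?\<tau> w \<le> l" using nj l pos by (auto simp: no_positive_jumps_def)
    ultimately show ?thesis by simp
  qed
  ultimately show eq: "X ?\<tau> w = y" by simp
  show "?\<tau> < v" using hit_le(2)[OF v] v(2) eq by (cases "?\<tau> = v") auto
qed

text \<open>The inequality \<open>hit y w < t\<close> is strict because at its hitting time the path
  is at y and not yet above it.\<close>

lemma crossed_iff:
  assumes w: "w \<in> space M" and nj: "no_positive_jumps (\<lambda>t. X t w)" and y: "0 < y"
  shows "(\<exists>v\<in>{0..t}. y < X v w) \<longleftrightarrow> (\<exists>v\<ge>0. y < X v w) \<and> hit y w < t"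
proof
  assume "\<exists>v\<in>{0..t}. y < X v w"
  then show "(\<exists>v\<ge>0. y < X v w) \<and> hit y w < t"
    using X_hit(2)[OF w nj y] by force
next
  assume *: "(\<exists>v\<ge>0. y < X v w) \<and> hit y w < t"
  then have "\<exists>u\<in>{u. 0 \<le> u \<and> y < X u w}. u < t"
    unfolding hit_def by (intro cInf_lessD) auto
  then show "\<exists>v\<in>{0..t}. y < X v w" by force
qed

text \<open>Arbitrarily soon after the hitting time there is an interval on which the path exceeds
  y. A fine enough grid meets it, so the first grid crossing falls between the hitting time and the
  end of that interval.\<close>

lemma grid_hit_convergence:
  assumes w: "w \<in> space M" and nj: "no_positive_jumps (\<lambda>t. X t w)"
    and y: "0 < y" and v: "0 \<le> v" "v \<le> t" "y < X v w"
  defines "\<sigma> n \<equiv> t * (real (LEAST k. y < X (t * (real k / real (2 ^ n :: nat))) w) / real (2 ^ n :: nat))"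
  shows "\<forall>\<^sub>F n in sequentially. \<exists>k\<le>2 ^ n. y < X (t * (real k / real (2 ^ n :: nat))) w"
    and "\<sigma> \<longlonglongrightarrow> hit y w" and "(\<lambda>n. X (\<sigma> n) w) \<longlonglongrightarrow> y"
proof -
  let ?\<tau> = "hit y w"
  note hv = X_hit[OF w nj y v(1) v(3)]
  have \<tau>0: "0 \<le> ?\<tau>" using hit_le[OF v(1) v(3)] by simp
  have t: "0 < t" using \<tau>0 hv(2) v by linarith
  have key: "\<forall>\<^sub>F n in sequentially. \<exists>k\<le>2 ^ n. y < X (t * (real k / real (2 ^ n :: nat))) w \<and> ?\<tau> \<le> \<sigma> n \<and> \<sigma> n < ?\<tau> + e"
    if e: "0 < e" for e
  proof -
    have "\<exists>u\<in>{u. 0 \<le> u \<and> y < X u w}. u < min (?\<tau> + e) t"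
      using v e hv(2) unfolding hit_def[of y w, symmetric]
      by (intro cInf_lessD) (auto simp: hit_def[symmetric])
    then obtain u where u: "0 \<le> u" "y < X u w" "u < ?\<tau> + e" "u < t" by auto
    have "((\<lambda>u. X u w) \<longlongrightarrow> X u w) (at_right u)"
      using rcont_X[OF w] u by (simp add: rcont_def)
    from order_tendstoD(1)[OF this u(2)]
    obtain b where b: "b > u" "\<And>r. u < r \<Longrightarrow> r < b \<Longrightarrow> y < X r w" by (auto simp: eventually_at_right_field)
    \<comment> \<open>On [u, u + d) the path exceeds y, and this interval ends before t and before
      the hitting time plus e. Mesh below d puts the grid point with index ceil(u N / t) into
      it.\<close>
    define d where "d = min (min b (?\<tau> + e)) t - u"
    have d: "0 < d" using b u by (simp add: d_def)
    have "(\<lambda>n. t * (1/2) ^ n) \<longlonglongrightarrow> t * 0"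
      by (intro tendsto_intros LIMSEQ_power_zero) auto
    then have "\<forall>\<^sub>F n in sequentially. t * (1/2) ^ n < d" by (rule order_tendstoD) (use d in simp)
    then show ?thesis
    proof eventually_elim
      case (elim n)
      let ?N = "real (2 ^ n :: nat)"
      have N: "0 < ?N" by simp
      have mesh: "t / ?N < d" using elim by (simp add: power_divide)
      define k where "k = nat \<lceil>u * ?N / t\<rceil>"
      have pos: "0 \<le> u * ?N / t" using u t by simp
      then have kr: "real k = of_int \<lceil>u * ?N / t\<rceil>" unfolding k_def by (simp add: ceiling_mono[of 0, simplified])
      have k1: "u * ?N / t \<le> real k" "real k < u * ?N / t + 1" unfolding kr by linarith+
      have s1: "u \<le> t * (real k / ?N)" using k1(1) t N by (simp add: field_simps)
      have "t * (real k / ?N) < u + t / ?N" using k1(2) t N by (simp add: field_simps)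
      then have s2: "t * (real k / ?N) < u + d" using mesh by simp
      then have s3: "t * (real k / ?N) < b" "t * (real k / ?N) < ?\<tau> + e" "t * (real k / ?N) < t" by (auto simp: d_def)
      have kN: "k \<le> 2 ^ n"
      proof -
        have "t * (real k / ?N) < t * 1" using s3 by simp
        then have "real k / ?N < 1" using t by (simp only: mult_less_cancel_left_pos)
        then have "real k < ?N" using N by (simp only: divide_less_eq_1_pos)
        then show ?thesis by linarith
      qed
      have yk: "y < X (t * (real k / ?N)) w"
        using s1 s3(1) b(2) u(2) by (cases "u = t * (real k / ?N)") force+
      have "(LEAST k. y < X (t * (real k / ?N)) w) \<le> k" by (rule Least_le[of _ k]) (rule yk)
      then have "\<sigma> n \<le> t * (real k / ?N)" unfolding \<sigma>_def using t N by (intro mult_left_mono divide_right_mono) auto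
      moreover have "y < X (\<sigma> n) w" unfolding \<sigma>_def by (rule LeastI[of "\<lambda>k. y < X (t * (real k / ?N)) w" k]) (rule yk)
      then have "?\<tau> \<le> \<sigma> n" using t by (intro hit_le(2)) (auto simp: \<sigma>_def)
      ultimately show ?case using kN yk s3(2) by force
    qed
  qed
  show "\<forall>\<^sub>F n in sequentially. \<exists>k\<le>2 ^ n. y < X (t * (real k / real (2 ^ n :: nat))) w"
    using key[of 1] by (auto elim: eventually_mono)
  have ev: "\<forall>\<^sub>F n in sequentially. ?\<tau> \<le> \<sigma> n \<and> \<sigma> n < ?\<tau> + e" if "0 < e" for e
    using key[OF that] by (auto elim: eventually_mono)
  show lim: "\<sigma> \<longlonglongrightarrow> ?\<tau>"
  proof (rule tendstoI)
    fix e :: real assume "0 < e"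
    from ev[OF this] show "\<forall>\<^sub>F n in sequentially. dist (\<sigma> n) ?\<tau> < e"
      by eventually_elim (auto simp: dist_real_def)
  qed
  \<comment> \<open>The grid crossings never precede the hitting time, so a limit from the right is
    all that is used.\<close>
  have cont: "((\<lambda>u. X u w) \<longlongrightarrow> X ?\<tau> w) (at ?\<tau> within {?\<tau>..})"
    using rcont_X[OF w] \<tau>0 by (simp add: rcont_def at_within_Ici_at_right)
  show "(\<lambda>n. X (\<sigma> n) w) \<longlonglongrightarrow> y"
  proof (rule tendstoI)
    fix e :: real assume e: "0 < e"
    have "\<forall>\<^sub>F u in at_right ?\<tau>. dist (X u w) y < e"
      using tendstoD[OF cont e] hv(1) by (simp add: at_within_Ici_at_right)
    then obtain b where b: "b > ?\<tau>" "\<And>u. ?\<tau> < u \<Longrightarrow> u < b \<Longrightarrow> dist (X u w) y < e"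
      by (auto simp: eventually_at_right_field)
    have "0 < b - ?\<tau>" using b by simp
    from ev[OF this] show "\<forall>\<^sub>F n in sequentially. dist (X (\<sigma> n) w) y < e"
    proof eventually_elim
      case (elim n)
      then show ?case using b(2)[of "\<sigma> n"] hv(1) e by (cases "\<sigma> n = ?\<tau>") auto
    qed
  qed
qed

end

section \<open>Passage as a measurable event and optional stopping in continuous time\<close>

context snlp_from_zero
begin

lemma alive_below_iff:
  assumes w: "w \<in> space M" and t: "0 \<le> t"
  shows "below y t w \<longleftrightarrow> (\<forall>v\<in>{0..t}. X v w \<le> y)"
proof -
  have "rcont (\<lambda>v. - X v w)"
    using rcont_X[OF w] by (auto simp: rcont_def intro: tendsto_minus)
  then have "alive y t (\<lambda>v. - X v w) \<longleftrightarrow> (\<forall>v\<in>{0..t}. 0 \<le> y + - X v w)"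
    using t by (rule alive_iff)
  moreover have "below y t w \<longleftrightarrow> alive y t (\<lambda>v. - X v w)"
    using t by (intro alive_cong) auto
  ultimately show ?thesis by (auto simp: add_increasing)
qed

lemma crossed_measurable [measurable]: "{w \<in> space M. \<exists>v\<ge>0. v < a \<and> y < X v w} \<in> sets M"
proof -
  have "{w \<in> space M. \<exists>v\<ge>0. v < a \<and> y < X v w} = {w \<in> space M. \<exists>r\<in>rats0. r < a \<and> y < X r w}"
  proof (intro set_eqI iffI; clarsimp)
    fix w v assume w: "w \<in> space M" and v: "0 \<le> v" "v < a" "y < X v w"
    have "((\<lambda>u. X u w) \<longlongrightarrow> X v w) (at_right v)" using rcont_X[OF w] v by (simp add: rcont_def)
    from order_tendstoD(1)[OF this v(3)]
    obtain b where b: "b > v" "\<And>r. v < r \<Longrightarrow> r < b \<Longrightarrow> y < X r w" by (auto simp: eventually_at_right_field)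
    obtain r where r: "r \<in> \<rat>" "v < r" "r < min a b" using Rats_dense_in_real[of v "min a b"] v b by auto
    then show "\<exists>r\<in>rats0. r < a \<and> y < X r w" using b(2)[of r] v by (intro bexI[of _ r]) (auto simp: rats0_def)
  next
    fix w r assume "r \<in> rats0" "r < a" "y < X r w"
    then show "\<exists>v\<ge>0. v < a \<and> y < X v w" by (auto simp: rats0_def)
  qed
  also have "\<dots> = (\<Union>r\<in>rats0. {w \<in> space M. r < a \<and> y < X r w})" by auto
  also have "\<dots> \<in> sets M"
  proof (rule sets.countable_UN'')
    fix r assume "r \<in> rats0"
    then have [measurable]: "X r \<in> borel_measurable M" by (intro X_meas) (simp add: rats0_def)
    show "{w \<in> space M. r < a \<and> y < X r w} \<in> sets M" by measurable
  qed simp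
  finally show ?thesis .
qed

definition crossing :: "real \<Rightarrow> 'a set" where
  "crossing y = {w \<in> space M. \<exists>v\<ge>0. y < X v w}"

lemma crossing_eq: "crossing y = (\<Union>n::nat. {w \<in> space M. \<exists>v\<ge>0. v < real n \<and> y < X v w})"
  unfolding crossing_def by auto (meson reals_Archimedean2)

lemma crossing_measurable [measurable]: "crossing y \<in> sets M"
  unfolding crossing_eq by (intro sets.countable_UN) (auto intro: crossed_measurable)

lemma hit_measurable [measurable]: "hit y \<in> borel_measurable M"
  unfolding borel_measurable_iff_less
proof
  fix a
  \<comment> \<open>Off \<open>crossing y\<close> the hitting time is the fixed real number
    \<open>Inf {}\<close>, so that set is included or excluded as a whole.\<close>
  have "{w \<in> space M. hit y w < a} = {w \<in> space M. \<exists>v\<ge>0. v < a \<and> y < X v w} \<union> (if Inf {} < a then space M - crossing y else {})"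
  proof (intro set_eqI iffI)
    fix w assume w: "w \<in> {w \<in> space M. hit y w < a}"
    show "w \<in> {w \<in> space M. \<exists>v\<ge>0. v < a \<and> y < X v w} \<union> (if Inf {} < a then space M - crossing y else {})"
    proof (cases "w \<in> crossing y")
      case True
      then have "\<exists>u\<in>{u. 0 \<le> u \<and> y < X u w}. u < a"
        using w unfolding hit_def by (intro cInf_lessD) (auto simp: crossing_def)
      then show ?thesis using w by auto
    next
      case False
      then have "{u. 0 \<le> u \<and> y < X u w} = {}" using w by (auto simp: crossing_def)
      then have "hit y w = Inf {}" by (simp only: hit_def)
      then show ?thesis using w False by auto
    qed
  next
    fix w assume w: "w \<in> {w \<in> space M. \<exists>v\<ge>0. v < a \<and> y < X v w} \<union> (if Inf {} < a then space M - crossing y else {})"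
    show "w \<in> {w \<in> space M. hit y w < a}"
    proof (cases "\<exists>v\<ge>0. v < a \<and> y < X v w")
      case True
      then show ?thesis using hit_le(2)[of _ y w] w by (force split: if_splits)
    next
      case False
      then have *: "Inf {} < a" "w \<in> space M - crossing y" using w by (auto split: if_splits)
      then have "{u. 0 \<le> u \<and> y < X u w} = {}" by (auto simp: crossing_def)
      then have "hit y w = Inf {}" by (simp only: hit_def)
      then show ?thesis using * by auto
    qed
  qed
  also have "\<dots> \<in> sets M" by (auto intro: crossed_measurable)
  finally show "{w \<in> space M. hit y w < a} \<in> sets M" .
qed

text \<open>No positive jumps: the process is at \<open>y\<close> when it first exceeds \<open>y\<close>, so optional stopping
  of the exponential martingale needs no overshoot term.\<close>

lemma optional_stopping:
  assumes y: "0 < y" and t: "0 < t" and \<theta>: "0 \<le> \<theta>" "0 \<le> \<psi> \<theta>" "0 \<le> \<psi> (2 * \<theta>)"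
  shows "(\<integral>\<^sup>+w. (if w \<in> crossing y \<and> hit y w < t then ennreal (exp (\<theta> * X t w)) else 0) \<partial>M)
    = (\<integral>\<^sup>+w. ennreal (if w \<in> crossing y \<and> hit y w < t then exp (\<theta> * y + \<psi> \<theta> * (t - hit y w)) else 0) \<partial>M)"
proof -
  define g where "g n k = t * (real k / real (2 ^ n :: nat))" for n k :: nat
  have g: "0 \<le> g n k" for n k using t by (simp add: g_def)
  have [measurable]: "X (g n k) \<in> borel_measurable M" for n k using g by (rule X_meas)
  have [measurable]: "X t \<in> borel_measurable M" using t by (intro X_meas) simp
  define crosses where "crosses n w \<longleftrightarrow> (\<exists>k\<le>2 ^ n. y < X (g n k) w)" for n w
  define first where "first n w = (LEAST k. y < X (g n k) w)" for n w
  define \<sigma> where "\<sigma> n w = g n (first n w)" for n w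
  have [measurable]: "Measurable.pred M (crosses n)" for n unfolding crosses_def by measurable
  have [measurable]: "first n \<in> measurable M (count_space UNIV)" for n unfolding first_def by measurable
  have [measurable]: "\<sigma> n \<in> borel_measurable M" for n unfolding \<sigma>_def g_def by measurable
  have [measurable]: "(\<lambda>w. X (\<sigma> n w) w) \<in> borel_measurable M" for n
    unfolding \<sigma>_def by (rule measurable_compose_countable[where f="\<lambda>k w. X (g n k) w" and g="first n"]) measurable
  have \<sigma>: "0 \<le> \<sigma> n w" "crosses n w \<Longrightarrow> \<sigma> n w \<le> t" for n w
  proof -
    show "0 \<le> \<sigma> n w" unfolding \<sigma>_def by (rule g)
    assume "crosses n w"
    then obtain k where k: "k \<le> 2 ^ n" "y < X (g n k) w" by (auto simp: crosses_def)
    have "first n w \<le> 2 ^ n" using Least_le[of "\<lambda>k. y < X (g n k) w", OF k(2)] k(1) by (simp add: first_def)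
    then have "real (first n w) \<le> real (2 ^ n :: nat)" by (simp only: of_nat_le_iff)
    then show "\<sigma> n w \<le> t" unfolding \<sigma>_def g_def using t by (intro mult_left_le) (auto simp: divide_le_eq_1)
  qed
  define Z where "Z n w = (if crosses n w then exp (\<theta> * X (\<sigma> n w) w + \<psi> \<theta> * (t - \<sigma> n w)) else 0)" for n w
  have stop: "(\<integral>\<^sup>+w. (if crosses n w then ennreal (exp (\<eta> * X t w)) else 0) \<partial>M)
    = (\<integral>\<^sup>+w. (if crosses n w then ennreal (exp (\<eta> * X (\<sigma> n w) w + \<psi> \<eta> * (t - \<sigma> n w))) else 0) \<partial>M)" if "0 \<le> \<eta>" for n \<eta>
    unfolding crosses_def \<sigma>_def first_def g_def
    by (rule grid_optional_stopping) (use y t laplace_nn that in auto)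
  let ?C = "exp (2 * \<psi> \<theta> * t) * exp (t * \<psi> (2 * \<theta>))"
  \<comment> \<open>The grid identity at 2\<theta> controls the second moment: Z^2 is at most e^(2
    \<psi>(\<theta>) t) times the stopped exponential for 2\<theta>, because \<psi>(2\<theta>) (t -
    \<sigma>) \<ge> 0. The mean of the latter is at most E e^(2\<theta> X_t).\<close>
  have moment: "(\<integral>\<^sup>+w. ennreal ((Z n w)\<^sup>2) \<partial>M) \<le> ennreal ?C" for n
  proof -
    have "ennreal ((Z n w)\<^sup>2) \<le> ennreal (exp (2 * \<psi> \<theta> * t)) *
        (if crosses n w then ennreal (exp (2 * \<theta> * X (\<sigma> n w) w + \<psi> (2 * \<theta>) * (t - \<sigma> n w))) else 0)" for w
    proof (cases "crosses n w")
      case True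
      have "2 * \<theta> * X (\<sigma> n w) w + 2 * \<psi> \<theta> * (t - \<sigma> n w) \<le> 2 * \<psi> \<theta> * t + (2 * \<theta> * X (\<sigma> n w) w + \<psi> (2 * \<theta>) * (t - \<sigma> n w))"
      proof -
        have "2 * \<psi> \<theta> * (t - \<sigma> n w) \<le> 2 * \<psi> \<theta> * t" using \<theta> \<sigma>[of n w] by (intro mult_left_mono) auto
        moreover have "0 \<le> \<psi> (2 * \<theta>) * (t - \<sigma> n w)" using \<theta> \<sigma>(2)[OF True] by simp
        ultimately show ?thesis by linarith
      qed
      moreover have "(Z n w)\<^sup>2 = exp (2 * \<theta> * X (\<sigma> n w) w + 2 * \<psi> \<theta> * (t - \<sigma> n w))"
        using True by (simp add: Z_def power2_eq_square exp_add[symmetric])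
      ultimately show ?thesis using True by (simp add: ennreal_mult[symmetric] exp_add[symmetric] ennreal_leI)
    qed (simp add: Z_def)
    then have "(\<integral>\<^sup>+w. ennreal ((Z n w)\<^sup>2) \<partial>M) \<le> (\<integral>\<^sup>+w. ennreal (exp (2 * \<psi> \<theta> * t)) *
        (if crosses n w then ennreal (exp (2 * \<theta> * X (\<sigma> n w) w + \<psi> (2 * \<theta>) * (t - \<sigma> n w))) else 0) \<partial>M)"
      by (rule nn_integral_mono)
    also have "\<dots> = ennreal (exp (2 * \<psi> \<theta> * t)) * (\<integral>\<^sup>+w. (if crosses n w then ennreal (exp (2 * \<theta> * X t w)) else 0) \<partial>M)"
      using stop[of "2 * \<theta>" n] \<theta> by (subst nn_integral_cmult) auto
    also have "\<dots> \<le> ennreal (exp (2 * \<psi> \<theta> * t)) * (\<integral>\<^sup>+w. ennreal (exp (2 * \<theta> * X t w)) \<partial>M)"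
      by (intro mult_left_mono nn_integral_mono) auto
    also have "\<dots> = ennreal ?C"
      using laplace_nn[of t "2 * \<theta>"] t \<theta> by (simp add: ennreal_mult)
    finally show ?thesis .
  qed
  have AE_conv: "AE w in M. (\<forall>\<^sub>F n in sequentially. crosses n w \<longleftrightarrow> w \<in> crossing y \<and> hit y w < t) \<and>
      (w \<in> crossing y \<and> hit y w < t \<longrightarrow> (\<lambda>n. \<sigma> n w) \<longlonglongrightarrow> hit y w \<and> (\<lambda>n. X (\<sigma> n w) w) \<longlonglongrightarrow> y)"
    using no_jumps AE_space
  proof eventually_elim
    case (elim w)
    have iff: "(\<exists>v\<in>{0..t}. y < X v w) \<longleftrightarrow> w \<in> crossing y \<and> hit y w < t"
      using crossed_iff[OF elim(2,1) y, of t] elim(2) by (simp add: crossing_def)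
    show ?case
    proof (cases "\<exists>v\<in>{0..t}. y < X v w")
      case True
      then obtain v where v: "0 \<le> v" "v \<le> t" "y < X v w" by auto
      note conv = grid_hit_convergence[OF elim(2,1) y v]
      have "\<forall>\<^sub>F n in sequentially. crosses n w" using conv(1) by (simp add: crosses_def g_def)
      then have "\<forall>\<^sub>F n in sequentially. crosses n w \<longleftrightarrow> w \<in> crossing y \<and> hit y w < t"
        by eventually_elim (use True iff in blast)
      then show ?thesis using conv(2,3) by (simp add: \<sigma>_def first_def g_def)
    next
      case False
      have "g n k \<in> {0..t}" if "k \<le> 2 ^ n" for n k
      proof -
        have "real k \<le> real (2 ^ n :: nat)" using that by (simp only: of_nat_le_iff)
        then have "t * (real k / real (2 ^ n :: nat)) \<le> t * 1"
          using t by (intro mult_left_mono) (auto simp only: divide_le_eq_1_pos of_nat_0_less_iff zero_less_power zero_less_numeral)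
        then show ?thesis using g[of n k] by (simp only: g_def mult_1_right atLeastAtMost_iff)
      qed
      then have "\<not> crosses n w" for n using False by (auto simp: crosses_def)
      then show ?thesis using False iff by auto
    qed
  qed
  \<comment> \<open>The grid identity moves the means of Z to the side of X_t, where e^(\<theta>
    X_t) is an integrable majorant. The stopped side has no such majorant, hence the second
    moments.\<close>
  have L: "(\<lambda>n. \<integral>\<^sup>+w. ennreal (Z n w) \<partial>M) \<longlonglongrightarrow> (\<integral>\<^sup>+w. (if w \<in> crossing y \<and> hit y w < t then ennreal (exp (\<theta> * X t w)) else 0) \<partial>M)"
  proof -
    have "(\<integral>\<^sup>+w. ennreal (Z n w) \<partial>M) = (\<integral>\<^sup>+w. (if crosses n w then ennreal (exp (\<theta> * X t w)) else 0) \<partial>M)" for n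
      unfolding stop[OF \<theta>(1)] Z_def by (intro nn_integral_cong) simp
    moreover have "(\<lambda>n. \<integral>\<^sup>+w. (if crosses n w then ennreal (exp (\<theta> * X t w)) else 0) \<partial>M) \<longlonglongrightarrow> (\<integral>\<^sup>+w. (if w \<in> crossing y \<and> hit y w < t then ennreal (exp (\<theta> * X t w)) else 0) \<partial>M)"
    proof (rule nn_integral_dominated_convergence[where w="\<lambda>w. ennreal (exp (\<theta> * X t w))"])
      show "AE w in M. (\<lambda>n. if crosses n w then ennreal (exp (\<theta> * X t w)) else 0) \<longlonglongrightarrow> (if w \<in> crossing y \<and> hit y w < t then ennreal (exp (\<theta> * X t w)) else 0)"
        using AE_conv
      proof eventually_elim
        case (elim w)
        then show ?case by (intro tendsto_eventually) (auto elim: eventually_mono)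
      qed
      show "(\<integral>\<^sup>+w. ennreal (exp (\<theta> * X t w)) \<partial>M) < \<infinity>" using laplace_nn[of t \<theta>] t \<theta> by simp
    qed (auto intro!: AE_I2)
    ultimately show ?thesis by simp
  qed
  have "(\<integral>\<^sup>+w. ennreal (if w \<in> crossing y \<and> hit y w < t then exp (\<theta> * y + \<psi> \<theta> * (t - hit y w)) else 0) \<partial>M)
    = (\<integral>\<^sup>+w. (if w \<in> crossing y \<and> hit y w < t then ennreal (exp (\<theta> * X t w)) else 0) \<partial>M)"
  proof (rule nn_integral_limit_second_moment[OF _ _ _ _ moment L])
    show "AE w in M. (\<lambda>n. Z n w) \<longlonglongrightarrow> (if w \<in> crossing y \<and> hit y w < t then exp (\<theta> * y + \<psi> \<theta> * (t - hit y w)) else 0)"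
      using AE_conv
    proof eventually_elim
      case (elim w)
      show ?case
      proof (cases "w \<in> crossing y \<and> hit y w < t")
        case True
        then have "(\<lambda>n. exp (\<theta> * X (\<sigma> n w) w + \<psi> \<theta> * (t - \<sigma> n w))) \<longlonglongrightarrow> exp (\<theta> * y + \<psi> \<theta> * (t - hit y w))"
          using elim by (intro tendsto_intros) auto
        moreover have "\<forall>\<^sub>F n in sequentially. exp (\<theta> * X (\<sigma> n w) w + \<psi> \<theta> * (t - \<sigma> n w)) = Z n w"
          using elim[THEN conjunct1] by eventually_elim (use True in \<open>simp add: Z_def\<close>)
        ultimately show ?thesis using True by (auto intro: Lim_transform_eventually)
      next
        case False
        have "\<forall>\<^sub>F n in sequentially. Z n w = 0"
          using elim[THEN conjunct1] by eventually_elim (use False in \<open>auto simp: Z_def\<close>)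
        then show ?thesis using False by (auto intro: tendsto_eventually)
      qed
    qed
  qed (auto simp: Z_def)
  then show ?thesis by simp
qed

end

lemma nn_integral_exp_Icc:
  assumes "0 \<le> a" "r \<le> t"
  shows "ennreal (exp (a * (t - r))) = 1 + ennreal a * (\<integral>\<^sup>+s\<in>{r..t}. ennreal (exp (a * (s - r))) \<partial>lborel)"
proof -
  have "(\<integral>\<^sup>+s. ennreal (a * exp (a * (s - r))) * indicator {r..t} s \<partial>lborel) = ennreal (exp (a * (t - r)) - exp (a * (r - r)))"
    by (rule nn_integral_FTC_Icc) (use assms in \<open>auto intro!: derivative_eq_intros\<close>)
  moreover have "(\<integral>\<^sup>+s. ennreal (a * exp (a * (s - r))) * indicator {r..t} s \<partial>lborel)
    = ennreal a * (\<integral>\<^sup>+s\<in>{r..t}. ennreal (exp (a * (s - r))) \<partial>lborel)"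
    using assms by (subst nn_integral_cmult[symmetric]) (auto simp: ennreal_mult mult.assoc)
  moreover have "1 \<le> exp (a * (t - r))" using assms by simp
  then have "1 + ennreal (exp (a * (t - r)) - 1) = ennreal (exp (a * (t - r)))"
    by (subst ennreal_1[symmetric], subst ennreal_plus[symmetric]) auto
  ultimately show ?thesis by simp
qed

section \<open>The passage formula and upward regularity\<close>

context snlp_from_zero
begin

lemma below_exp_le:
  assumes "0 \<le> t" "0 \<le> \<theta>" shows "below_exp \<theta> y t \<le> ennreal (exp (\<theta> * y))"
proof -
  have "below_exp \<theta> y t \<le> (\<integral>\<^sup>+w. ennreal (exp (\<theta> * y)) \<partial>M)"
    unfolding below_exp_def
  proof (rule nn_integral_mono)
    fix w assume w: "w \<in> space M"
    show "(if below y t w then ennreal (exp (\<theta> * path w t)) else 0) \<le> ennreal (exp (\<theta> * y))"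
      using alive_below_iff[OF w assms(1), of y] assms by (auto intro!: ennreal_leI mult_left_mono)
  qed
  then show ?thesis by (simp add: emeasure_space_1)
qed

text \<open>Split E e^(\<theta> X_t) = e^(a t) into m(t), the paths still at or below y, and c g(t),
  the others. Since e^(a t) = 1 + a * (integral of e^(a s)) and g = P + a * (integral of g) over
  [0, t], the integrals of g cancel and m(t) + c P(t) = 1 + a * (integral of m over [0, t]) remains.
  The formula is the limit t \<rightarrow> \<infinity>.\<close>

theorem passage_formula:
  assumes y: "0 < y" and \<theta>: "0 \<le> \<theta>" "0 < \<psi> \<theta>" "0 \<le> \<psi> (2 * \<theta>)"
  shows "1 + ennreal (\<psi> \<theta>) * occ \<theta> y = ennreal (exp (\<theta> * y)) * emeasure M (crossing y)"
proof -
  interpret LM: pair_sigma_finite lborel M ..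
  define m where "m = below_exp \<theta> y"
  have [measurable]: "m \<in> borel_measurable borel" unfolding m_def by (rule below_exp_measurable) measurable
  define C where "C t = {w \<in> space M. w \<in> crossing y \<and> hit y w < t}" for t
  have [measurable]: "C t \<in> sets M" for t unfolding C_def by measurable
  define P where "P t = emeasure M (C t)" for t
  define p where "p = emeasure M (crossing y)"
  define c where "c = ennreal (exp (\<theta> * y))"
  define a where "a = \<psi> \<theta>"
  have a: "0 < a" using \<theta> by (simp add: a_def)
  have Pp: "P t \<le> p" for t unfolding P_def p_def by (intro emeasure_mono) (auto simp: C_def)
  have p1: "p \<le> 1" unfolding p_def by (rule emeasure_le_1)
  \<comment> \<open>By optional stopping, c times the mean of \<open>G t\<close> is the share of E
    e^(\<theta> X_t) due to paths that crossed y before t.\<close>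
  define G where "G t w = (if w \<in> crossing y \<and> hit y w < t then ennreal (exp (a * (t - hit y w))) else 0)" for t w
  have [measurable]: "G t \<in> borel_measurable M" for t unfolding G_def by measurable
  have G2 [measurable]: "(\<lambda>x. G (fst x) (snd x)) \<in> borel_measurable (borel \<Otimes>\<^sub>M M)" unfolding G_def by measurable
  define g where "g t = (\<integral>\<^sup>+w. G t w \<partial>M)" for t
  have [measurable]: "g \<in> borel_measurable borel"
    using borel_measurable_nn_integral_fst[OF G2] by (simp add: g_def[abs_def])
  have 1: "m t + c * g t = ennreal (exp (t * a))" if t: "0 < t" for t
  proof -
    have [measurable]: "Measurable.pred M (\<lambda>w. below y t w)"
      by (rule below_measurable) measurable
    have [measurable]: "X t \<in> borel_measurable M" using t by (intro X_meas) simp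
    have "ennreal (exp (t * a)) = (\<integral>\<^sup>+w. ennreal (exp (\<theta> * X t w)) \<partial>M)"
      using laplace_nn[of t \<theta>] t \<theta> by (simp add: a_def)
    also have "\<dots> = (\<integral>\<^sup>+w. (if below y t w then ennreal (exp (\<theta> * path w t)) else 0)
        + (if w \<in> crossing y \<and> hit y w < t then ennreal (exp (\<theta> * X t w)) else 0) \<partial>M)"
    proof (rule nn_integral_cong_AE)
      show "AE w in M. ennreal (exp (\<theta> * X t w)) = (if below y t w then ennreal (exp (\<theta> * path w t)) else 0)
        + (if w \<in> crossing y \<and> hit y w < t then ennreal (exp (\<theta> * X t w)) else 0)"
        using no_jumps AE_space
      proof eventually_elim
        case (elim w)
        have "(\<exists>v\<in>{0..t}. y < X v w) \<longleftrightarrow> w \<in> crossing y \<and> hit y w < t"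
          using crossed_iff[OF elim(2,1) y, of t] elim(2) by (simp add: crossing_def)
        moreover have "below y t w \<longleftrightarrow> \<not> (\<exists>v\<in>{0..t}. y < X v w)"
          using alive_below_iff[OF elim(2), of t y] t by (auto simp: not_less)
        ultimately show ?case using t by auto
      qed
    qed
    also have "\<dots> = m t + (\<integral>\<^sup>+w. (if w \<in> crossing y \<and> hit y w < t then ennreal (exp (\<theta> * X t w)) else 0) \<partial>M)"
      unfolding m_def below_exp_def using t by (intro nn_integral_add) measurable
    also have "(\<integral>\<^sup>+w. (if w \<in> crossing y \<and> hit y w < t then ennreal (exp (\<theta> * X t w)) else 0) \<partial>M)
      = (\<integral>\<^sup>+w. ennreal (if w \<in> crossing y \<and> hit y w < t then exp (\<theta> * y + \<psi> \<theta> * (t - hit y w)) else 0) \<partial>M)"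
      using \<theta> by (intro optional_stopping y t) auto
    also have "\<dots> = (\<integral>\<^sup>+w. c * G t w \<partial>M)"
      by (intro nn_integral_cong) (auto simp: c_def G_def a_def exp_add ennreal_mult)
    also have "\<dots> = c * g t" unfolding g_def by (rule nn_integral_cmult) measurable
    finally show ?thesis by simp
  qed
  have 2: "g t = P t + ennreal a * (\<integral>\<^sup>+s\<in>{0..t}. g s \<partial>lborel)" if t: "0 < t" for t
  proof -
    have "G t w = indicator (C t) w + ennreal a * (\<integral>\<^sup>+s\<in>{0..t}. G s w \<partial>lborel)" if w: "w \<in> space M" for w
    proof (cases "w \<in> C t")
      case True
      then have h: "w \<in> crossing y" "hit y w < t" by (auto simp: C_def)
      then obtain v where "0 \<le> v" "y < X v w" by (auto simp: crossing_def)
      then have h0: "0 \<le> hit y w" by (rule hit_le)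
      have "(\<integral>\<^sup>+s\<in>{0..t}. G s w \<partial>lborel) = (\<integral>\<^sup>+s\<in>{hit y w..t}. ennreal (exp (a * (s - hit y w))) \<partial>lborel)"
      proof (rule nn_integral_cong_AE)
        show "AE s in lborel. G s w * indicator {0..t} s = ennreal (exp (a * (s - hit y w))) * indicator {hit y w..t} s"
          using AE_lborel_singleton[of "hit y w"]
          by eventually_elim (use h h0 in \<open>auto simp: G_def indicator_def\<close>)
      qed
      then show ?thesis
        using nn_integral_exp_Icc[of a "hit y w" t] True h a by (simp add: G_def)
    next
      case False
      then have "G s w * indicator {0..t} s = 0" for s using w by (auto simp: C_def G_def indicator_def)
      then have "(\<lambda>s. G s w * indicator {0..t} s) = (\<lambda>_. 0)" by (rule ext)
      then have "(\<integral>\<^sup>+s\<in>{0..t}. G s w \<partial>lborel) = 0" by (simp only: nn_integral_const mult_zero_left)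
      then show ?thesis using False w by (auto simp: C_def G_def)
    qed
    then have "g t = (\<integral>\<^sup>+w. indicator (C t) w + ennreal a * (\<integral>\<^sup>+s\<in>{0..t}. G s w \<partial>lborel) \<partial>M)"
      unfolding g_def by (intro nn_integral_cong)
    also have "\<dots> = P t + ennreal a * (\<integral>\<^sup>+w. (\<integral>\<^sup>+s\<in>{0..t}. G s w \<partial>lborel) \<partial>M)"
    proof -
      have [measurable]: "(\<lambda>x. G (snd x) (fst x)) \<in> borel_measurable (M \<Otimes>\<^sub>M lborel)" unfolding G_def by measurable
      have "(\<lambda>x. G (snd x) (fst x) * indicator {0..t} (snd x)) \<in> borel_measurable (M \<Otimes>\<^sub>M lborel)" by measurable
      from lborel.borel_measurable_nn_integral_fst[OF this]
      have [measurable]: "(\<lambda>w. \<integral>\<^sup>+s\<in>{0..t}. G s w \<partial>lborel) \<in> borel_measurable M" by simp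
      show ?thesis by (simp add: nn_integral_add nn_integral_cmult P_def)
    qed
    also have "(\<integral>\<^sup>+w. (\<integral>\<^sup>+s\<in>{0..t}. G s w \<partial>lborel) \<partial>M) = (\<integral>\<^sup>+s\<in>{0..t}. g s \<partial>lborel)"
    proof -
      have [measurable]: "(\<lambda>x. G (fst x) (snd x)) \<in> borel_measurable (lborel \<Otimes>\<^sub>M M)" unfolding G_def by measurable
      have "(\<lambda>x. G (fst x) (snd x) * indicator {0..t} (fst x)) \<in> borel_measurable (lborel \<Otimes>\<^sub>M M)" by measurable
      from LM.Fubini[OF this] show ?thesis unfolding g_def by (simp add: nn_integral_multc)
    qed
    finally show ?thesis .
  qed
  have 4: "m t + c * P t = 1 + ennreal a * (\<integral>\<^sup>+s\<in>{0..t}. m s \<partial>lborel)" if t: "0 < t" for t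
  proof -
    let ?Ig = "\<integral>\<^sup>+s\<in>{0..t}. g s \<partial>lborel" and ?Im = "\<integral>\<^sup>+s\<in>{0..t}. m s \<partial>lborel"
    have "(m t + c * P t) + c * (ennreal a * ?Ig) = m t + c * g t"
      using 2[OF t] by (simp add: distrib_left add.assoc)
    also have "\<dots> = 1 + ennreal a * (\<integral>\<^sup>+s\<in>{0..t}. ennreal (exp (a * s)) \<partial>lborel)"
      using 1[OF t] nn_integral_exp_Icc[of a 0 t] a t by (simp add: mult.commute)
    also have "(\<integral>\<^sup>+s\<in>{0..t}. ennreal (exp (a * s)) \<partial>lborel) = (\<integral>\<^sup>+s. m s * indicator {0..t} s + c * (g s * indicator {0..t} s) \<partial>lborel)"
    proof (rule nn_integral_cong_AE)
      show "AE s in lborel. ennreal (exp (a * s)) * indicator {0..t} s = m s * indicator {0..t} s + c * (g s * indicator {0..t} s)"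
        using AE_lborel_singleton[of 0]
        by eventually_elim (use 1 in \<open>auto simp: indicator_def mult.commute\<close>)
    qed
    also have "\<dots> = ?Im + c * ?Ig" by (simp add: nn_integral_add nn_integral_cmult)
    finally have eq: "(m t + c * P t) + c * (ennreal a * ?Ig) = (1 + ennreal a * ?Im) + c * (ennreal a * ?Ig)"
      by (simp add: distrib_left mult_ac add_ac)
    \<comment> \<open>Cancelling in the extended reals requires the common term to be finite; it is
      at most e^(a t).\<close>
    have "c * (ennreal a * ?Ig) \<le> c * g t" unfolding 2[OF t] by (intro mult_left_mono) auto
    also have "\<dots> \<le> ennreal (exp (t * a))" unfolding 1[OF t, symmetric] by simp
    also have "\<dots> < top" by simp
    finally have "c * (ennreal a * ?Ig) \<noteq> \<infinity>" by simp
    moreover have "c * (ennreal a * ?Ig) + (m t + c * P t) = c * (ennreal a * ?Ig) + (1 + ennreal a * ?Im)"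
      using eq by (simp only: add.commute)
    ultimately show ?thesis by (simp only: ennreal_add_left_cancel simp_thms)
  qed
  have Im_le: "ennreal a * (\<integral>\<^sup>+s\<in>{0..t}. m s \<partial>lborel) \<le> 2 * c" if t: "0 < t" for t
  proof -
    have "ennreal a * (\<integral>\<^sup>+s\<in>{0..t}. m s \<partial>lborel) \<le> m t + c * P t" unfolding 4[OF t] by simp
    also have "\<dots> \<le> c + c * 1"
      using below_exp_le[of t \<theta> y] t \<theta> order_trans[OF Pp p1, of t]
      by (intro add_mono mult_left_mono) (auto simp: m_def c_def)
    finally show ?thesis by (simp add: mult_2)
  qed
  define I where "I = occ \<theta> y"
  have I_lim: "(\<lambda>n. \<integral>\<^sup>+s\<in>{0..real n}. m s \<partial>lborel) \<longlonglongrightarrow> I"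
    unfolding I_def occ_def m_def[symmetric]
  proof (rule nn_integral_LIMSEQ)
    show "incseq (\<lambda>n s. m s * indicator {0..real n} s)"
      by (auto simp: incseq_def le_fun_def indicator_def)
    show "(\<lambda>n. m s * indicator {0..real n} s) \<longlonglongrightarrow> m s * indicator {0..} s" for s
    proof (rule tendsto_eventually)
      show "\<forall>\<^sub>F n in sequentially. m s * indicator {0..real n} s = m s * indicator {0..} s"
        using eventually_ge_at_top[of "nat \<lceil>s\<rceil>"]
        by eventually_elim (auto simp: indicator_def)
    qed
  qed measurable
  have aI_lim: "(\<lambda>n. 1 + ennreal a * (\<integral>\<^sup>+s\<in>{0..real n}. m s \<partial>lborel)) \<longlonglongrightarrow> 1 + ennreal a * I"
    by (intro tendsto_add tendsto_const ennreal_tendsto_cmult I_lim) simp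
  have "ennreal a * I \<le> 2 * c"
  proof (rule LIMSEQ_le_const2)
    show "(\<lambda>n. ennreal a * (\<integral>\<^sup>+s\<in>{0..real n}. m s \<partial>lborel)) \<longlonglongrightarrow> ennreal a * I"
      by (intro ennreal_tendsto_cmult I_lim) simp
    show "\<exists>N. \<forall>n\<ge>N. ennreal a * (\<integral>\<^sup>+s\<in>{0..real n}. m s \<partial>lborel) \<le> 2 * c"
      using Im_le by (intro exI[of _ 1]) auto
  qed
  then have "ennreal a * I < top" by (rule le_less_trans) (simp add: c_def ennreal_mult_less_top)
  then have I_fin: "I < top" using a by (auto simp: ennreal_mult_less_top)
  \<comment> \<open>Convergence of m(t) itself is not established. Its integrals over [n, n + 1]
    tend to 0 because \<open>occ\<close> is finite, and they suffice.\<close>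
  have tail: "(\<lambda>n. \<integral>\<^sup>+s\<in>{real n..real n + 1}. m s \<partial>lborel) \<longlonglongrightarrow> 0"
  proof -
    have "(\<lambda>n. \<integral>\<^sup>+s\<in>{real n..real n + 1}. m s \<partial>lborel) \<longlonglongrightarrow> (\<integral>\<^sup>+s. 0 \<partial>(lborel :: real measure))"
    proof (rule nn_integral_dominated_convergence[where w="\<lambda>s. m s * indicator {0..} s"])
      show "(\<integral>\<^sup>+s\<in>{0..}. m s \<partial>lborel) < \<infinity>" using I_fin by (simp add: I_def occ_def m_def)
      show "AE s in lborel. (\<lambda>n. m s * indicator {real n..real n + 1} s) \<longlonglongrightarrow> 0"
      proof (rule AE_I2, rule tendsto_eventually)
        fix s :: real
        show "\<forall>\<^sub>F n in sequentially. m s * indicator {real n..real n + 1} s = 0"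
          using eventually_gt_at_top[of "nat \<lceil>s\<rceil>"]
        proof eventually_elim
          case (elim n)
          then have "s < real n" by linarith
          then show ?case by simp
        qed
      qed
    qed (auto intro!: AE_I2 simp: indicator_def)
    then show ?thesis by simp
  qed
  \<comment> \<open>The identity for m(s) + c P(s) is integrated over s in [n, n + 1]: its right
    side increases in s, and P(s) \<le> p.\<close>
  have 5: "1 + ennreal a * (\<integral>\<^sup>+s\<in>{0..real n}. m s \<partial>lborel) \<le> (\<integral>\<^sup>+s\<in>{real n..real n + 1}. m s \<partial>lborel) + c * p" for n
  proof -
    let ?K = "1 + ennreal a * (\<integral>\<^sup>+s\<in>{0..real n}. m s \<partial>lborel)"
    have "?K * indicator {real n..real n + 1} s \<le> m s * indicator {real n..real n + 1} s + c * p * indicator {real n..real n + 1} s" if "s \<noteq> 0" for s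
    proof (cases "s \<in> {real n..real n + 1}")
      case True
      then have s: "0 < s" "real n \<le> s" using that by auto
      have "?K \<le> 1 + ennreal a * (\<integral>\<^sup>+r\<in>{0..s}. m r \<partial>lborel)"
        using s by (intro add_left_mono mult_left_mono nn_integral_mono) (auto simp: indicator_def)
      also have "\<dots> = m s + c * P s" using 4[OF s(1)] by simp
      also have "\<dots> \<le> m s + c * p" by (intro add_left_mono mult_left_mono Pp) simp
      finally show ?thesis using True by simp
    qed simp
    then have "(\<integral>\<^sup>+s. ?K * indicator {real n..real n + 1} s \<partial>lborel) \<le> (\<integral>\<^sup>+s. m s * indicator {real n..real n + 1} s + c * p * indicator {real n..real n + 1} s \<partial>lborel)"
      by (intro nn_integral_mono_AE eventually_mono[OF AE_lborel_singleton[of 0]])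
    then show ?thesis by (simp add: nn_integral_cmult nn_integral_add)
  qed
  have upper: "1 + ennreal a * I \<le> 0 + c * p"
    by (rule LIMSEQ_le[OF aI_lim tendsto_add[OF tail tendsto_const]]) (use 5 in auto)
  have "(\<lambda>n. P (real n)) \<longlonglongrightarrow> p"
  proof -
    have "(\<lambda>n. P (real n)) \<longlonglongrightarrow> emeasure M (\<Union>n::nat. C (real n))"
      unfolding P_def by (rule Lim_emeasure_incseq) (auto simp: incseq_def C_def)
    also have "(\<Union>n::nat. C (real n)) = crossing y"
      unfolding C_def by (auto simp: crossing_def intro: reals_Archimedean2)
    finally show ?thesis by (simp add: p_def)
  qed
  then have "(\<lambda>n. c * P (real n)) \<longlonglongrightarrow> c * p" by (intro ennreal_tendsto_cmult) (simp_all add: c_def)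
  then have lower: "c * p \<le> 1 + ennreal a * I"
  proof (rule LIMSEQ_le[OF _ aI_lim], intro exI[of _ 1] allI impI)
    fix n :: nat assume "1 \<le> n"
    then show "c * P (real n) \<le> 1 + ennreal a * (\<integral>\<^sup>+s\<in>{0..real n}. m s \<partial>lborel)"
      using 4[of "real n"] by (metis add.commute le_iff_add of_nat_0_less_iff less_le_trans zero_less_one)
  qed
  show ?thesis using upper lower by (simp add: I_def a_def c_def p_def)
qed

lemma alive_mono: "alive z t p \<Longrightarrow> z \<le> z' \<Longrightarrow> alive z' t p"
  by (force simp: alive_def)

text \<open>Upward regularity: letting \<open>y\<close> tend to \<open>0\<close> in the passage formula leaves no time below \<open>0\<close>.\<close>

lemma regular_upward: "AE t in lborel. 0 \<le> t \<longrightarrow> (AE w in M. \<not> below 0 t w)"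
proof -
  obtain \<theta> where \<theta>0: "0 < \<theta>" "\<And>\<eta>. \<theta> \<le> \<eta> \<Longrightarrow> 0 < \<psi> \<eta>" using psi_eventually_pos by blast
  then have \<theta>: "0 \<le> \<theta>" "0 < \<psi> \<theta>" "0 \<le> \<psi> (2 * \<theta>)" by (auto simp: less_imp_le)
  have [measurable]: "below_exp \<theta> 0 \<in> borel_measurable borel" by (rule below_exp_measurable) measurable
  have le: "1 + ennreal (\<psi> \<theta>) * occ \<theta> 0 \<le> ennreal (exp (\<theta> * y))" if y: "0 < y" for y
  proof -
    have "occ \<theta> 0 \<le> occ \<theta> y"
      unfolding occ_def below_exp_def
      by (intro nn_integral_mono mult_right_mono) (use y in \<open>auto dest: alive_mono[of 0 _ _ y]\<close>)
    then have "1 + ennreal (\<psi> \<theta>) * occ \<theta> 0 \<le> 1 + ennreal (\<psi> \<theta>) * occ \<theta> y"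
      by (intro add_left_mono mult_left_mono) auto
    also have "\<dots> = ennreal (exp (\<theta> * y)) * emeasure M (crossing y)" by (rule passage_formula[OF y \<theta>])
    also have "\<dots> \<le> ennreal (exp (\<theta> * y)) * 1" by (intro mult_left_mono emeasure_le_1) auto
    finally show ?thesis by simp
  qed
  have "(\<lambda>n. ennreal (exp (\<theta> * (1 / real (Suc n))))) \<longlonglongrightarrow> ennreal (exp (\<theta> * 0))"
    by (intro tendsto_ennrealI tendsto_intros LIMSEQ_Suc[OF lim_const_over_n])
  then have "1 + ennreal (\<psi> \<theta>) * occ \<theta> 0 \<le> ennreal (exp (\<theta> * 0))"
  proof (rule LIMSEQ_le_const, intro exI allI impI)
    fix n :: nat
    show "1 + ennreal (\<psi> \<theta>) * occ \<theta> 0 \<le> ennreal (exp (\<theta> * (1 / real (Suc n))))" by (rule le) simp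
  qed
  then have le1: "1 + ennreal (\<psi> \<theta>) * occ \<theta> 0 \<le> 1 + 0" by simp
  then have "ennreal (\<psi> \<theta>) * occ \<theta> 0 \<le> 0" by (subst (asm) ennreal_add_left_cancel_le) auto
  then have "occ \<theta> 0 = 0" using \<theta> by simp
  then have "AE t in lborel. below_exp \<theta> 0 t * indicator {0..} t = 0"
    unfolding occ_def by (subst (asm) nn_integral_0_iff_AE) auto
  then show ?thesis
  proof eventually_elim
    case (elim t)
    show ?case
    proof
      assume t: "0 \<le> t"
      have [measurable]: "Measurable.pred M (\<lambda>w. below 0 t w)" by (rule below_measurable) measurable
      have "below_exp \<theta> 0 t = 0" using elim t by simp
      then have "AE w in M. (if below 0 t w then ennreal (exp (\<theta> * path w t)) else 0) = 0"
        unfolding below_exp_def using t by (subst (asm) nn_integral_0_iff_AE) auto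
      then show "AE w in M. \<not> below 0 t w"
        by eventually_elim (auto split: if_splits)
    qed
  qed
qed

end

section \<open>The process killed below zero\<close>

text \<open>Rays form an intersection-stable generator. Intersecting everything with a ray of finite
  mass makes the complement step a cancellation; the ray then grows, and simple functions and
  monotone limits give all f, infinite values included.\<close>

lemma sum_measures_eqI:
  fixes \<mu> \<rho> \<kappa> :: "real measure"
  assumes sets [measurable_cong, simp]: "sets \<mu> = sets borel" "sets \<rho> = sets borel" "sets \<kappa> = sets borel"
    and eq: "\<And>b. emeasure \<mu> {..<b} + emeasure \<rho> {..<b} = emeasure \<kappa> {..<b}"
    and fin: "\<And>b. emeasure \<kappa> {..<b} < \<infinity>"
    and f: "f \<in> borel_measurable borel"
  shows "(\<integral>\<^sup>+y. f y \<partial>\<mu>) + (\<integral>\<^sup>+y. f y \<partial>\<rho>) = (\<integral>\<^sup>+y. f y \<partial>\<kappa>)"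
proof -
  have space [simp]: "space \<mu> = UNIV" "space \<rho> = UNIV" "space \<kappa> = UNIV"
    using sets_eq_imp_space_eq[OF sets(1)] sets_eq_imp_space_eq[OF sets(2)] sets_eq_imp_space_eq[OF sets(3)]
    by simp_all
  have restricted: "emeasure \<mu> (A \<inter> {..<b}) + emeasure \<rho> (A \<inter> {..<b}) = emeasure \<kappa> (A \<inter> {..<b})"
    if "A \<in> sets borel" for A b
  proof -
    have A: "A \<in> sigma_sets UNIV (range (lessThan :: real \<Rightarrow> real set))" using that unfolding borel_Iio by simp
    have Int: "{..<a} \<inter> {..<b} = {..<min a b}" for a b :: real by auto
    have "Int_stable (range (lessThan :: real \<Rightarrow> real set) :: real set set)" unfolding Int_stable_def using Int by auto
    moreover have "range (lessThan :: real \<Rightarrow> real set) \<subseteq> Pow (UNIV :: real set)" by simp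
    ultimately show ?thesis using A
    proof (induction rule: sigma_sets_induct_disjoint)
      case (basic A)
      then obtain a where "A = {..<a}" by auto
      then show ?case using eq[of "min a b"] by (simp add: Int)
    next
      case (compl A)
      then have [measurable]: "A \<in> sets borel" unfolding borel_Iio by simp
      have split: "emeasure \<nu> {..<b} = emeasure \<nu> (A \<inter> {..<b}) + emeasure \<nu> ((UNIV - A) \<inter> {..<b})"
        if "sets \<nu> = sets borel" for \<nu>
      proof -
        have "{..<b} = (A \<inter> {..<b}) \<union> ((UNIV - A) \<inter> {..<b})" by auto
        moreover have "emeasure \<nu> (A \<inter> {..<b}) + emeasure \<nu> ((UNIV - A) \<inter> {..<b}) = emeasure \<nu> ((A \<inter> {..<b}) \<union> ((UNIV - A) \<inter> {..<b}))"
          using that by (intro plus_emeasure) auto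
        ultimately show ?thesis by simp
      qed
      have "emeasure \<kappa> (A \<inter> {..<b}) \<le> emeasure \<kappa> {..<b}" by (intro emeasure_mono) auto
      then have "emeasure \<kappa> (A \<inter> {..<b}) \<noteq> \<infinity>" using fin[of b] by (auto simp: less_top)
      moreover have "emeasure \<kappa> (A \<inter> {..<b}) + (emeasure \<mu> ((UNIV - A) \<inter> {..<b}) + emeasure \<rho> ((UNIV - A) \<inter> {..<b}))
        = emeasure \<kappa> (A \<inter> {..<b}) + emeasure \<kappa> ((UNIV - A) \<inter> {..<b})"
        using eq[of b] unfolding split[OF sets(1)] split[OF sets(2)] split[OF sets(3)] compl(2)[symmetric]
        by (simp only: add_ac)
      ultimately show ?case by (simp only: ennreal_add_left_cancel simp_thms)
    next
      case (union A)
      then have A: "\<And>i. A i \<in> sets borel" unfolding borel_Iio by auto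
      have sum: "emeasure \<nu> ((\<Union>i. A i) \<inter> {..<b}) = (\<Sum>i. emeasure \<nu> (A i \<inter> {..<b}))" if "sets \<nu> = sets borel" for \<nu>
      proof -
        have "disjoint_family (\<lambda>i. A i \<inter> {..<b})" using union(1) by (auto simp: disjoint_family_on_def)
        then have "(\<Sum>i. emeasure \<nu> (A i \<inter> {..<b})) = emeasure \<nu> (\<Union>i. A i \<inter> {..<b})"
          using A that by (intro suminf_emeasure) auto
        then show ?thesis by (simp add: Int_UN_distrib2)
      qed
      show ?case
        unfolding sum[OF sets(1)] sum[OF sets(2)] sum[OF sets(3)] union(3)[symmetric]
        by (rule suminf_add) auto
    qed simp
  qed
  have all: "emeasure \<mu> A + emeasure \<rho> A = emeasure \<kappa> A" if A: "A \<in> sets borel" for A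
  proof -
    have lim: "(\<lambda>n. emeasure \<nu> (A \<inter> {..<real n})) \<longlonglongrightarrow> emeasure \<nu> A" if "sets \<nu> = sets borel" for \<nu>
    proof -
      have "(\<lambda>n. emeasure \<nu> (A \<inter> {..<real n})) \<longlonglongrightarrow> emeasure \<nu> (\<Union>n. A \<inter> {..<real n})"
      proof (rule Lim_emeasure_incseq)
        show "range (\<lambda>n. A \<inter> {..<real n}) \<subseteq> sets \<nu>"
          unfolding that using A by (intro image_subsetI sets.Int) simp_all
        show "incseq (\<lambda>n. A \<inter> {..<real n})"
          by (intro monoI Int_mono order_refl) (simp add: lessThan_subset_iff)
      qed
      also have "(\<Union>n. A \<inter> {..<real n}) = A" by (auto intro: reals_Archimedean2)
      finally show ?thesis .
    qed
    have "(\<lambda>n. emeasure \<kappa> (A \<inter> {..<real n})) \<longlonglongrightarrow> emeasure \<mu> A + emeasure \<rho> A"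
      using tendsto_add[OF lim[OF sets(1)] lim[OF sets(2)]] unfolding restricted[OF A] .
    from LIMSEQ_unique[OF this lim[OF sets(3)]] show ?thesis .
  qed
  show ?thesis using f
  proof (induction rule: borel_measurable_induct)
    case (cong f g)
    then have "f = g" by (intro ext) simp
    then show ?case using cong by simp
  next
    case (set A)
    then show ?case using all by simp
  next
    case (mult u c)
    then show ?case by (simp add: nn_integral_cmult distrib_left[symmetric])
  next
    case (add u v)
    have sum: "(\<integral>\<^sup>+y. v y + u y \<partial>\<nu>) = (\<integral>\<^sup>+y. v y \<partial>\<nu>) + (\<integral>\<^sup>+y. u y \<partial>\<nu>)" if "sets \<nu> = sets borel" for \<nu>
      using add(1,3) measurable_cong_sets[OF that refl] by (intro nn_integral_add) blast+
    have "((\<integral>\<^sup>+y. v y \<partial>\<mu>) + (\<integral>\<^sup>+y. u y \<partial>\<mu>)) + ((\<integral>\<^sup>+y. v y \<partial>\<rho>) + (\<integral>\<^sup>+y. u y \<partial>\<rho>))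
      = ((\<integral>\<^sup>+y. v y \<partial>\<mu>) + (\<integral>\<^sup>+y. v y \<partial>\<rho>)) + ((\<integral>\<^sup>+y. u y \<partial>\<mu>) + (\<integral>\<^sup>+y. u y \<partial>\<rho>))"
      by (simp only: add_ac)
    then show ?case
      unfolding sum[OF sets(1)] sum[OF sets(2)] sum[OF sets(3)] by (simp only: add.IH)
  next
    case (seq U)
    have lim: "(\<integral>\<^sup>+y. (SUP i. U i) y \<partial>\<nu>) = (SUP i. \<integral>\<^sup>+y. U i y \<partial>\<nu>)" if "sets \<nu> = sets borel" for \<nu>
      unfolding SUP_apply
      using seq(1,3) measurable_cong_sets[OF that refl] by (intro nn_integral_monotone_convergence_SUP) blast+
    have inc: "incseq (\<lambda>i. \<integral>\<^sup>+y. U i y \<partial>\<nu>)" for \<nu>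
      using seq(3) by (auto simp: incseq_def le_fun_def intro!: nn_integral_mono)
    show ?case
      unfolding lim[OF sets(1)] lim[OF sets(2)] lim[OF sets(3)]
      by (subst ennreal_SUP_add[symmetric]) (auto simp: inc seq.IH)
  qed
qed

lemma AE_lborel_ex_between:
  fixes a b :: real
  assumes "AE x in lborel. P x" and "a < b"
  obtains x where "a < x" "x < b" "P x"
proof -
  have "\<not> (\<forall>x\<in>{a<..<b}. \<not> P x)"
  proof
    assume *: "\<forall>x\<in>{a<..<b}. \<not> P x"
    from assms(1) have "AE x in lborel. x \<notin> {a<..<b}" by eventually_elim (use * in auto)
    then have "emeasure lborel {a<..<b} = 0" by (subst (asm) AE_iff_measurable[where N="{a<..<b}"]) auto
    then show False using assms(2) by simp
  qed
  then show ?thesis using that by auto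
qed

locale snlp_scale = snlp_from_zero +
  fixes W :: "real \<Rightarrow> real"
  assumes scale_function: "is_scale_function \<psi> 0 W"
begin

lemma W_nonneg: "0 \<le> W x" and W_neg: "x < 0 \<Longrightarrow> W x = 0"
  and W_continuous: "continuous_on {0..} W" and W_mono_on: "mono_on {0..} W"
  using scale_function by (auto simp: is_scale_function_def)

lemma W_mono: "mono W"
proof (rule monoI)
  fix x y :: real assume "x \<le> y"
  then show "W x \<le> W y"
    using W_nonneg[of y] W_neg[of x] mono_onD[OF W_mono_on, of x y] by (cases "0 \<le> x") auto
qed

lemma W_measurable [measurable]: "W \<in> borel_measurable borel"
  using W_mono by (rule borel_measurable_mono)

lemma W_laplace:
  assumes "right_inverse \<psi> 0 < \<theta>"
  shows "(\<integral>\<^sup>+x\<in>{0..}. ennreal (exp (- \<theta> * x)) * ennreal (W x) \<partial>lborel) = ennreal (1 / \<psi> \<theta>)"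
proof -
  have int: "integrable lborel (\<lambda>y. indicator {0..} y *\<^sub>R (exp (- \<theta> * y) * W y))"
    and eq: "(LINT y|lborel. indicator {0..} y *\<^sub>R (exp (- \<theta> * y) * W y)) = 1 / \<psi> \<theta>"
    using scale_function assms by (auto simp: is_scale_function_def set_integrable_def set_lebesgue_integral_def)
  have "(\<integral>\<^sup>+x\<in>{0..}. ennreal (exp (- \<theta> * x)) * ennreal (W x) \<partial>lborel)
    = (\<integral>\<^sup>+x. ennreal (indicator {0..} x *\<^sub>R (exp (- \<theta> * x) * W x)) \<partial>lborel)"
    by (intro nn_integral_cong) (auto simp: indicator_def ennreal_mult W_nonneg)
  also have "\<dots> = ennreal (1 / \<psi> \<theta>)"
    using nn_integral_eq_integral[OF int] eq by (simp add: W_nonneg)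
  finally show ?thesis .
qed

text \<open>The integral of f p in the overview, with p(y) the probability of ever exceeding
  y.\<close>

definition pass_int :: "(real \<Rightarrow> ennreal) \<Rightarrow> ennreal" where
  "pass_int f = (\<integral>\<^sup>+y\<in>{0..}. f y * emeasure M (crossing y) \<partial>lborel)"

definition W_conv :: "(real \<Rightarrow> ennreal) \<Rightarrow> real \<Rightarrow> ennreal" where
  "W_conv f x = (\<integral>\<^sup>+y\<in>{0..}. f y * ennreal (W (x - y)) \<partial>lborel)"

lemma crossing_emeasure_measurable [measurable]: "(\<lambda>y. emeasure M (crossing y)) \<in> borel_measurable borel"
proof -
  have "mono (\<lambda>y. - prob (crossing y))"
    by (intro monoI) (auto simp: crossing_def intro!: finite_measure_mono crossing_measurable[unfolded crossing_def])
  then have "(\<lambda>y. - prob (crossing y)) \<in> borel_measurable borel" by (rule borel_measurable_mono)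
  then have "(\<lambda>y. ennreal (- (- prob (crossing y)))) \<in> borel_measurable borel" by measurable
  then show ?thesis by (simp add: emeasure_eq_measure)
qed

lemma occ_neg:
  assumes "y < 0" shows "occ \<theta> y = 0"
proof -
  have "below_exp \<theta> y t = 0" for t
  proof -
    have zero: "(0::real) \<in> rats1" by (auto simp: rats1_def)
    have "below_exp \<theta> y t = (\<integral>\<^sup>+w. 0 \<partial>M)"
      unfolding below_exp_def
      by (rule nn_integral_cong) (use assms zero X_start in \<open>auto simp: alive_def intro!: bexI[of _ 0]\<close>)
    then show ?thesis by simp
  qed
  then show ?thesis by (simp add: occ_def)
qed

lemma occ_measurable [measurable]: "occ \<theta> \<in> borel_measurable borel"
proof -
  have [measurable]: "(\<lambda>x. below_exp \<theta> (fst x) (snd x)) \<in> borel_measurable (borel \<Otimes>\<^sub>M lborel)"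
    by (rule below_exp_measurable) measurable
  have "(\<lambda>x. below_exp \<theta> (fst x) (snd x) * indicator {0..} (snd x)) \<in> borel_measurable (borel \<Otimes>\<^sub>M lborel)" by measurable
  from lborel.borel_measurable_nn_integral_fst[OF this] show ?thesis by (simp add: occ_def[abs_def])
qed

lemma W_conv_measurable [measurable]:
  assumes [measurable]: "f \<in> borel_measurable borel"
  shows "W_conv f \<in> borel_measurable borel"
proof -
  have "(\<lambda>p. f (snd p) * ennreal (W (fst p - snd p)) * indicator {0..} (snd p)) \<in> borel_measurable (borel \<Otimes>\<^sub>M lborel)"
    by measurable
  from lborel.borel_measurable_nn_integral_fst[OF this] show ?thesis by (simp add: W_conv_def[abs_def])
qed

lemma W_conv_laplace:
  assumes [measurable]: "f \<in> borel_measurable borel"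
  shows "(\<integral>\<^sup>+x\<in>{0..}. ennreal (exp (- \<theta> * x)) * W_conv f x \<partial>lborel)
    = (\<integral>\<^sup>+y\<in>{0..}. f y * ennreal (exp (- \<theta> * y)) \<partial>lborel) * (\<integral>\<^sup>+x\<in>{0..}. ennreal (exp (- \<theta> * x)) * ennreal (W x) \<partial>lborel)"
proof -
  have "(\<integral>\<^sup>+x\<in>{0..}. ennreal (exp (- \<theta> * x)) * W_conv f x \<partial>lborel)
    = (\<integral>\<^sup>+x. (\<integral>\<^sup>+y. ennreal (exp (- \<theta> * x)) * indicator {0..} x * (f y * ennreal (W (x - y)) * indicator {0..} y) \<partial>lborel) \<partial>lborel)"
  proof (rule nn_integral_cong)
    fix x :: real
    have "(\<integral>\<^sup>+y. ennreal (exp (- \<theta> * x)) * indicator {0..} x * (f y * ennreal (W (x - y)) * indicator {0..} y) \<partial>lborel)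
      = ennreal (exp (- \<theta> * x)) * indicator {0..} x * W_conv f x"
      unfolding W_conv_def by (rule nn_integral_cmult) measurable
    then show "ennreal (exp (- \<theta> * x)) * W_conv f x * indicator {0..} x
      = (\<integral>\<^sup>+y. ennreal (exp (- \<theta> * x)) * indicator {0..} x * (f y * ennreal (W (x - y)) * indicator {0..} y) \<partial>lborel)"
      by (simp only: mult_ac)
  qed
  also have "\<dots> = (\<integral>\<^sup>+y. (\<integral>\<^sup>+x. ennreal (exp (- \<theta> * x)) * indicator {0..} x * (f y * ennreal (W (x - y)) * indicator {0..} y) \<partial>lborel) \<partial>lborel)"
  proof -
    have "(\<lambda>p. ennreal (exp (- \<theta> * fst p)) * indicator {0..} (fst p) * (f (snd p) * ennreal (W (fst p - snd p)) * indicator {0..} (snd p))) \<in> borel_measurable (lborel \<Otimes>\<^sub>M lborel)"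
      by measurable
    from lborel_pair.Fubini[OF this] show ?thesis by simp
  qed
  also have "\<dots> = (\<integral>\<^sup>+y. (f y * ennreal (exp (- \<theta> * y)) * indicator {0..} y) * (\<integral>\<^sup>+z\<in>{0..}. ennreal (exp (- \<theta> * z)) * ennreal (W z) \<partial>lborel) \<partial>lborel)"
  proof (rule nn_integral_cong)
    fix y :: real
    have "(\<integral>\<^sup>+x. ennreal (exp (- \<theta> * x)) * indicator {0..} x * (f y * ennreal (W (x - y)) * indicator {0..} y) \<partial>lborel)
      = (\<integral>\<^sup>+z. ennreal (exp (- \<theta> * (y + z))) * indicator {0..} (y + z) * (f y * ennreal (W z) * indicator {0..} y) \<partial>lborel)"
      using nn_integral_real_affine[of "\<lambda>x. ennreal (exp (- \<theta> * x)) * indicator {0..} x * (f y * ennreal (W (x - y)) * indicator {0..} y)" 1 y] by simp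
    also have "\<dots> = (\<integral>\<^sup>+z. (f y * ennreal (exp (- \<theta> * y)) * indicator {0..} y) * (ennreal (exp (- \<theta> * z)) * ennreal (W z) * indicator {0..} z) \<partial>lborel)"
    proof (rule nn_integral_cong)
      fix z :: real
      show "ennreal (exp (- \<theta> * (y + z))) * indicator {0..} (y + z) * (f y * ennreal (W z) * indicator {0..} y)
        = (f y * ennreal (exp (- \<theta> * y)) * indicator {0..} y) * (ennreal (exp (- \<theta> * z)) * ennreal (W z) * indicator {0..} z)"
      proof (cases "0 \<le> y \<and> 0 \<le> z")
        case True
        have "ennreal (exp (- \<theta> * (y + z))) = ennreal (exp (- \<theta> * y)) * ennreal (exp (- \<theta> * z))"
          by (simp add: ennreal_mult[symmetric] exp_add[symmetric] algebra_simps)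
        then show ?thesis using True by (simp add: mult_ac)
      next
        case False
        then show ?thesis using W_neg[of z] by (auto simp: indicator_def)
      qed
    qed
    also have "\<dots> = (f y * ennreal (exp (- \<theta> * y)) * indicator {0..} y) * (\<integral>\<^sup>+z\<in>{0..}. ennreal (exp (- \<theta> * z)) * ennreal (W z) \<partial>lborel)"
      by (rule nn_integral_cmult) measurable
    finally show "(\<integral>\<^sup>+x. ennreal (exp (- \<theta> * x)) * indicator {0..} x * (f y * ennreal (W (x - y)) * indicator {0..} y) \<partial>lborel) = \<dots>" .
  qed
  also have "\<dots> = (\<integral>\<^sup>+y\<in>{0..}. f y * ennreal (exp (- \<theta> * y)) \<partial>lborel) * (\<integral>\<^sup>+x\<in>{0..}. ennreal (exp (- \<theta> * x)) * ennreal (W x) \<partial>lborel)"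
    by (rule nn_integral_multc) measurable
  finally show ?thesis .
qed

text \<open>With A and B as below, the left side has transform A + B / \<psi>(\<theta>) = (B +
  \<psi>(\<theta>) A) / \<psi>(\<theta>). The passage formula multiplied by e^(-\<theta> y) shows
  that the numerator is \<open>pass_int f\<close>, free of \<theta>. A constant over
  \<psi>(\<theta>) is the transform of that constant times W.\<close>

lemma one_sided_AE:
  assumes f [measurable]: "f \<in> borel_measurable borel" and fin: "pass_int f < \<infinity>"
  shows "AE x in lborel. 0 \<le> x \<longrightarrow> free_res f x + W_conv f x = ennreal (W x) * pass_int f"
proof -
  obtain \<theta>\<^sub>1 where \<theta>1: "0 < \<theta>\<^sub>1" "\<And>\<theta>. \<theta>\<^sub>1 \<le> \<theta> \<Longrightarrow> 0 < \<psi> \<theta>" using psi_eventually_pos by blast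
  have "right_inverse \<psi> 0 \<le> \<theta>\<^sub>1"
    unfolding right_inverse_def by (rule cInf_lower) (use \<theta>1 in \<open>auto intro!: bdd_belowI[where m=0]\<close>)
  \<comment> \<open>From \<open>\<theta>\<^sub>1 + 1\<close> on, \<theta> lies strictly above the
    right inverse at 0, where the transform of W is known, and both \<psi>(\<theta>) and
    \<psi>(2\<theta>) are positive.\<close>
  then have inv: "right_inverse \<psi> 0 < \<theta>" if "\<theta>\<^sub>1 + 1 \<le> \<theta>" for \<theta> using that by linarith
  have eq: "(\<integral>\<^sup>+x\<in>{0..}. ennreal (exp (- \<theta> * x)) * (free_res f x + W_conv f x) \<partial>lborel) = ennreal (1 / \<psi> \<theta>) * pass_int f"
    "(\<integral>\<^sup>+x\<in>{0..}. ennreal (exp (- \<theta> * x)) * (ennreal (W x) * pass_int f) \<partial>lborel) = ennreal (1 / \<psi> \<theta>) * pass_int f"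
    if \<theta>: "\<theta>\<^sub>1 + 1 \<le> \<theta>" for \<theta>
  proof -
    have \<psi>: "0 < \<psi> \<theta>" "0 \<le> \<psi> (2 * \<theta>)" "0 \<le> \<theta>" using \<theta>1(1) \<theta>1(2)[of \<theta>] \<theta>1(2)[of "2 * \<theta>"] \<theta> by auto
    have W: "(\<integral>\<^sup>+x\<in>{0..}. ennreal (exp (- \<theta> * x)) * ennreal (W x) \<partial>lborel) = ennreal (1 / \<psi> \<theta>)"
      by (rule W_laplace[OF inv[OF \<theta>]])
    have inv1: "ennreal (1 / \<psi> \<theta>) * ennreal (\<psi> \<theta>) = 1"
      using \<psi> by (simp add: ennreal_mult[symmetric])
    let ?A = "\<integral>\<^sup>+y. f y * (ennreal (exp (- \<theta> * y)) * occ \<theta> y) \<partial>lborel"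
    let ?B = "\<integral>\<^sup>+y\<in>{0..}. f y * ennreal (exp (- \<theta> * y)) \<partial>lborel"
    have "?B + ennreal (\<psi> \<theta>) * ?A = (\<integral>\<^sup>+y. f y * ennreal (exp (- \<theta> * y)) * indicator {0..} y + ennreal (\<psi> \<theta>) * (f y * (ennreal (exp (- \<theta> * y)) * occ \<theta> y)) \<partial>lborel)"
      by (simp add: nn_integral_add nn_integral_cmult)
    also have "\<dots> = pass_int f"
      unfolding pass_int_def
    proof (rule nn_integral_cong_AE)
      show "AE y in lborel. f y * ennreal (exp (- \<theta> * y)) * indicator {0..} y + ennreal (\<psi> \<theta>) * (f y * (ennreal (exp (- \<theta> * y)) * occ \<theta> y))
        = f y * emeasure M (crossing y) * indicator {0..} y"
        \<comment> \<open>The passage formula covers y > 0. For y < 0 both sides vanish, and the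
          point 0 is a null set.\<close>
        using AE_lborel_singleton[of 0]
      proof eventually_elim
        case (elim y)
        show ?case
        proof (cases "0 < y")
          case True
          have "f y * ennreal (exp (- \<theta> * y)) + ennreal (\<psi> \<theta>) * (f y * (ennreal (exp (- \<theta> * y)) * occ \<theta> y))
            = f y * (ennreal (exp (- \<theta> * y)) * (1 + ennreal (\<psi> \<theta>) * occ \<theta> y))"
            by (simp add: distrib_left mult_ac)
          also have "\<dots> = f y * (ennreal (exp (- \<theta> * y)) * ennreal (exp (\<theta> * y)) * emeasure M (crossing y))"
            unfolding passage_formula[OF True \<psi>(3,1,2)] by (simp add: mult_ac)
          also have "ennreal (exp (- \<theta> * y)) * ennreal (exp (\<theta> * y)) = 1"
            by (simp add: ennreal_mult[symmetric] exp_add[symmetric])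
          finally show ?thesis using True by simp
        next
          case False
          then show ?thesis using elim occ_neg[of y \<theta>] by simp
        qed
      qed
    qed
    finally have AB: "?B + ennreal (\<psi> \<theta>) * ?A = pass_int f" .
    have "(\<integral>\<^sup>+x\<in>{0..}. ennreal (exp (- \<theta> * x)) * (free_res f x + W_conv f x) \<partial>lborel)
      = (\<integral>\<^sup>+x\<in>{0..}. ennreal (exp (- \<theta> * x)) * free_res f x \<partial>lborel) + (\<integral>\<^sup>+x\<in>{0..}. ennreal (exp (- \<theta> * x)) * W_conv f x \<partial>lborel)"
      unfolding distrib_left distrib_right by (rule nn_integral_add) measurable
    also have "\<dots> = ?A + ?B * ennreal (1 / \<psi> \<theta>)"
      unfolding res_laplace_transform[OF f] W_conv_laplace[OF f] W ..
    also have "\<dots> = ennreal (1 / \<psi> \<theta>) * ennreal (\<psi> \<theta>) * ?A + ennreal (1 / \<psi> \<theta>) * ?B"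
      unfolding inv1 by (simp add: mult.commute)
    also have "\<dots> = ennreal (1 / \<psi> \<theta>) * pass_int f"
      unfolding AB[symmetric] by (simp add: distrib_left mult_ac add_ac)
    finally show "(\<integral>\<^sup>+x\<in>{0..}. ennreal (exp (- \<theta> * x)) * (free_res f x + W_conv f x) \<partial>lborel) = ennreal (1 / \<psi> \<theta>) * pass_int f" .
    have "(\<integral>\<^sup>+x\<in>{0..}. ennreal (exp (- \<theta> * x)) * (ennreal (W x) * pass_int f) \<partial>lborel)
      = (\<integral>\<^sup>+x. (ennreal (exp (- \<theta> * x)) * ennreal (W x) * indicator {0..} x) * pass_int f \<partial>lborel)"
      by (intro nn_integral_cong) (simp only: mult_ac)
    also have "\<dots> = (\<integral>\<^sup>+x\<in>{0..}. ennreal (exp (- \<theta> * x)) * ennreal (W x) \<partial>lborel) * pass_int f"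
      by (rule nn_integral_multc) measurable
    finally show "(\<integral>\<^sup>+x\<in>{0..}. ennreal (exp (- \<theta> * x)) * (ennreal (W x) * pass_int f) \<partial>lborel) = ennreal (1 / \<psi> \<theta>) * pass_int f"
      unfolding W .
  qed
  show ?thesis
  proof (rule laplace_unique[where \<theta>="\<theta>\<^sub>1 + 1"])
    show "(\<integral>\<^sup>+x\<in>{0..}. ennreal (exp (- (\<theta>\<^sub>1 + 1) * x)) * (free_res f x + W_conv f x) \<partial>lborel) < \<infinity>"
      unfolding eq(1)[OF order_refl] using fin by (simp add: ennreal_mult_less_top)
    show "(\<integral>\<^sup>+x\<in>{0..}. ennreal (exp (- (\<theta>\<^sub>1 + 1 + real k) * x)) * (free_res f x + W_conv f x) \<partial>lborel)
      = (\<integral>\<^sup>+x\<in>{0..}. ennreal (exp (- (\<theta>\<^sub>1 + 1 + real k) * x)) * (ennreal (W x) * pass_int f) \<partial>lborel)" for k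
      using eq[of "\<theta>\<^sub>1 + 1 + real k"] by simp
  qed measurable
qed

lemma W_tendsto:
  assumes "z \<longlonglongrightarrow> x" and "\<And>n. 0 \<le> z n" and "0 \<le> x"
  shows "(\<lambda>n. W (z n)) \<longlonglongrightarrow> W x"
  by (rule continuous_on_tendsto_compose[OF W_continuous assms(1)]) (use assms in auto)

text \<open>These indicators are right-continuous, which upgrades the a.e. identity to every starting point.\<close>

lemma one_sided_Iio:
  assumes x: "0 \<le> x"
  shows "free_res (indicator {..<b}) x + W_conv (indicator {..<b}) x = ennreal (W x) * pass_int (indicator {..<b})"
proof -
  let ?f = "\<lambda>b. indicator {..<b::real} :: real \<Rightarrow> ennreal"
  have fin: "pass_int (?f b) < \<infinity>" for b
  proof -
    have "pass_int (?f b) \<le> (\<integral>\<^sup>+y. indicator {0..\<bar>b\<bar>} y \<partial>lborel)"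
      unfolding pass_int_def by (rule nn_integral_mono) (auto simp: indicator_def emeasure_le_1)
    also have "\<dots> < \<infinity>" by simp
    finally show ?thesis .
  qed
  \<comment> \<open>The identity for b + 1 supplies the majorant. If z' is in (x, x + 1) and z in
    (x, z'), a path from z that survives and ends below b survives from z' as well and ends below b
    + 1 there.\<close>
  define P where "P z \<longleftrightarrow> free_res (?f b) z + W_conv (?f b) z = ennreal (W z) * pass_int (?f b)
    \<and> free_res (?f (b + 1)) z + W_conv (?f (b + 1)) z = ennreal (W z) * pass_int (?f (b + 1))" for z
  have AE_P: "AE z in lborel. 0 \<le> z \<longrightarrow> P z"
  proof -
    have [measurable]: "?f b \<in> borel_measurable borel" for b by measurable
    have "AE z in lborel. 0 \<le> z \<longrightarrow> free_res (?f b) z + W_conv (?f b) z = ennreal (W z) * pass_int (?f b)"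
      "AE z in lborel. 0 \<le> z \<longrightarrow> free_res (?f (b + 1)) z + W_conv (?f (b + 1)) z = ennreal (W z) * pass_int (?f (b + 1))"
      by (rule one_sided_AE[OF _ fin], measurable)+
    then show ?thesis by eventually_elim (simp add: P_def)
  qed
  obtain z' where z': "x < z'" "z' < x + 1" "P z'"
  proof (rule AE_lborel_ex_between[OF AE_P, of x "x + 1"])
    fix z assume "x < z" "z < x + 1" "0 \<le> z \<longrightarrow> P z"
    then show thesis using that[of z] x by simp
  qed simp
  have "\<exists>z. x < z \<and> z < min z' (x + 1 / real (Suc n)) \<and> P z" for n
  proof -
    have "x < min z' (x + 1 / real (Suc n))" using z' by simp
    from AE_lborel_ex_between[OF AE_P this] obtain z where "x < z" "z < min z' (x + 1 / real (Suc n))" "0 \<le> z \<longrightarrow> P z" .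
    then show ?thesis using x by (intro exI[of _ z]) auto
  qed
  then obtain z where z: "\<And>n. x < z n" "\<And>n. z n < min z' (x + 1 / real (Suc n))" "\<And>n. P (z n)" by metis
  have z_lim: "z \<longlonglongrightarrow> x"
  proof (rule tendsto_sandwich[of "\<lambda>_. x" z sequentially "\<lambda>n. x + 1 / real (Suc n)"])
    have "(\<lambda>n. x + 1 / real (Suc n)) \<longlonglongrightarrow> x + 0"
      by (intro tendsto_intros LIMSEQ_Suc[OF lim_const_over_n])
    then show "(\<lambda>n. x + 1 / real (Suc n)) \<longlonglongrightarrow> x" by simp
    show "\<forall>\<^sub>F n in sequentially. z n \<le> x + 1 / real (Suc n)"
      using z(2) by (intro always_eventually allI) (simp add: less_imp_le)
  qed (use z(1) in \<open>auto intro!: always_eventually less_imp_le\<close>)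
  have zz: "z n < z'" "0 \<le> z n" for n using z(1)[of n] z(2)[of n] x by auto
  have res_lim: "(\<lambda>n. free_res (?f b) (z n)) \<longlonglongrightarrow> free_res (?f b) x"
    unfolding res_def
  proof (rule nn_integral_dominated_convergence[where w="\<lambda>t. (fk_mean (\<lambda>_. 0) (?f (b + 1)) z' t) * indicator {0..} t"])
    have [measurable]: "(\<lambda>t. fk_mean (\<lambda>_. 0) (?f b) z t) \<in> borel_measurable lborel" for z b
      by (rule expectation_fkf_measurable) measurable
    show "(\<lambda>t. (fk_mean (\<lambda>_. 0) (?f b) (z n) t) * indicator {0..} t) \<in> borel_measurable lborel" for n by measurable
    show "(\<lambda>t. (fk_mean (\<lambda>_. 0) (?f b) x t) * indicator {0..} t) \<in> borel_measurable lborel" by measurable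
    show "(\<lambda>t. (fk_mean (\<lambda>_. 0) (?f (b+1)) z' t) * indicator {0..} t) \<in> borel_measurable lborel" by measurable
    have dom: "fkf (\<lambda>_. 0) (?f b) (z n) t (path w) \<le> fkf (\<lambda>_. 0) (?f (b + 1)) z' t (path w)" for n t w
      using alive_mono[of "z n" t "path w" z'] zz[of n] z(1)[of n] z' by (auto simp: fkf_zero indicator_def)
    show "AE t in lborel. (fk_mean (\<lambda>_. 0) (?f b) (z n) t) * indicator {0..} t
      \<le> (fk_mean (\<lambda>_. 0) (?f (b + 1)) z' t) * indicator {0..} t" for n
      by (intro AE_I2 mult_right_mono nn_integral_mono dom) simp
    have "free_res (?f (b + 1)) z' \<le> ennreal (W z') * pass_int (?f (b + 1))"
      using z'(3) unfolding P_def by (metis le_iff_add)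
    also have "\<dots> < \<infinity>" using fin[of "b + 1"] by (simp add: ennreal_mult_less_top)
    finally show "(\<integral>\<^sup>+t\<in>{0..}. (fk_mean (\<lambda>_. 0) (?f (b + 1)) z' t) \<partial>lborel) < \<infinity>"
      by (simp add: res_def)
    have point: "(\<lambda>n. fkf (\<lambda>_. 0) (?f b) (z n) t p) \<longlonglongrightarrow> fkf (\<lambda>_. 0) (?f b) x t p" for t p
    proof (rule tendsto_eventually)
      have lim: "(\<lambda>n. z n + d) \<longlonglongrightarrow> x + d" for d by (intro tendsto_intros z_lim)
      show "\<forall>\<^sub>F n in sequentially. fkf (\<lambda>_. 0) (?f b) (z n) t p = fkf (\<lambda>_. 0) (?f b) x t p"
      proof (cases "alive x t p")
        case True
        then have al: "alive (z n) t p" for n using alive_mono[of x t p "z n"] z(1)[of n] by simp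
        show ?thesis
        proof (cases "x + p t < b")
          case True
          from order_tendstoD(2)[OF lim True] show ?thesis
            by eventually_elim (use al \<open>alive x t p\<close> True in \<open>simp add: fkf_zero\<close>)
        next
          case False
          then have "\<not> z n + p t < b" for n using z(1)[of n] by simp
          then show ?thesis using False by (auto simp: fkf_zero)
        qed
      next
        case False
        then obtain q where q: "q \<in> rats1" "x + p (t * q) < 0" by (auto simp: alive_def not_le)
        from order_tendstoD(2)[OF lim q(2)] show ?thesis
          by eventually_elim (use q False in \<open>auto simp: fkf_zero alive_def not_le[symmetric]\<close>)
      qed
    qed
    show "AE t in lborel. (\<lambda>n. (fk_mean (\<lambda>_. 0) (?f b) (z n) t) * indicator {0..} t)
      \<longlonglongrightarrow> (fk_mean (\<lambda>_. 0) (?f b) x t) * indicator {0..} t"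
    proof (rule AE_I2)
      fix t :: real
      have [measurable]: "(\<lambda>w. fkf (\<lambda>_. 0) (?f b) z t (path w)) \<in> borel_measurable M" for z
        by (rule fkf_path_measurable) measurable
      have "(\<lambda>n. fk_mean (\<lambda>_. 0) (?f b) (z n) t) \<longlonglongrightarrow> (fk_mean (\<lambda>_. 0) (?f b) x t)"
      proof (rule nn_integral_dominated_convergence[where w="\<lambda>_. 1"])
        show "AE w in M. fkf (\<lambda>_. 0) (?f b) (z n) t (path w) \<le> 1" for n
          by (intro AE_I2) (simp add: fkf_zero indicator_def)
        show "AE w in M. (\<lambda>n. fkf (\<lambda>_. 0) (?f b) (z n) t (path w)) \<longlonglongrightarrow> fkf (\<lambda>_. 0) (?f b) x t (path w)"
          by (intro AE_I2 point)
      qed (simp_all add: emeasure_space_1)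
      then show "(\<lambda>n. (fk_mean (\<lambda>_. 0) (?f b) (z n) t) * indicator {0..} t)
        \<longlonglongrightarrow> (fk_mean (\<lambda>_. 0) (?f b) x t) * indicator {0..} t"
        by (cases "0 \<le> t") auto
    qed
  qed
  have conv_lim: "(\<lambda>n. W_conv (?f b) (z n)) \<longlonglongrightarrow> W_conv (?f b) x"
    unfolding W_conv_def
  proof (rule nn_integral_dominated_convergence[where w="\<lambda>y. ennreal (W z') * indicator {0..\<bar>b\<bar>} y"])
    show "AE y in lborel. indicator {..<b} y * ennreal (W (z n - y)) * indicator {0..} y \<le> ennreal (W z') * indicator {0..\<bar>b\<bar>} y" for n
      using zz[of n] by (intro AE_I2) (auto simp: indicator_def intro!: ennreal_leI monoD[OF W_mono])
    show "(\<integral>\<^sup>+y. ennreal (W z') * indicator {0..\<bar>b\<bar>} y \<partial>lborel) < \<infinity>"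
      by (simp add: nn_integral_cmult ennreal_mult_less_top)
    show "AE y in lborel. (\<lambda>n. indicator {..<b} y * ennreal (W (z n - y)) * indicator {0..} y)
      \<longlonglongrightarrow> indicator {..<b} y * ennreal (W (x - y)) * indicator {0..} y"
      using AE_lborel_singleton[of x]
    proof eventually_elim
      case (elim y)
      have "(\<lambda>n. W (z n - y)) \<longlonglongrightarrow> W (x - y)"
      proof (cases "y < x")
        case True
        show ?thesis
          by (rule W_tendsto) (use True z(1) in \<open>auto intro!: tendsto_intros z_lim intro: less_imp_le order.strict_trans\<close>)
      next
        case False
        then have "x < y" using elim by simp
        from order_tendstoD(2)[OF z_lim this]
        have "\<forall>\<^sub>F n in sequentially. W (z n - y) = W (x - y)"
          by eventually_elim (use \<open>x < y\<close> in \<open>simp add: W_neg\<close>)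
        then show ?thesis by (rule tendsto_eventually)
      qed
      from tendsto_ennrealI[OF this]
      show ?case by (cases "y < b"; cases "0 \<le> y") auto
    qed
  qed measurable
  have "(\<lambda>n. ennreal (W (z n)) * pass_int (?f b)) \<longlonglongrightarrow> ennreal (W x) * pass_int (?f b)"
  proof -
    have "(\<lambda>n. pass_int (?f b) * ennreal (W (z n))) \<longlonglongrightarrow> pass_int (?f b) * ennreal (W x)"
      using fin[of b] by (intro ennreal_tendsto_cmult tendsto_ennrealI W_tendsto z_lim zz x) simp
    then show ?thesis by (simp only: mult.commute)
  qed
  moreover have "(\<lambda>n. ennreal (W (z n)) * pass_int (?f b)) \<longlonglongrightarrow> free_res (?f b) x + W_conv (?f b) x"
    using tendsto_add[OF res_lim conv_lim] z(3) by (simp add: P_def)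
  ultimately show ?thesis by (rule LIMSEQ_unique[symmetric])
qed

text \<open>The measure is the occupation measure of the killed process. Its existence allows
  uniqueness of measures to extend the identity from rays to all f.\<close>

lemma res_zero_eq_nn_integral:
  obtains \<mu> :: "real measure" where "sets \<mu> = sets borel"
    and "\<And>f. f \<in> borel_measurable borel \<Longrightarrow> free_res f x = (\<integral>\<^sup>+y. f y \<partial>\<mu>)"
proof
  define d where "d p = (if 0 \<le> fst p \<and> alive x (fst p) (path (snd p)) then 1 else 0 :: ennreal)" for p :: "real \<times> 'a"
  define \<mu> where "\<mu> = distr (density (lborel \<Otimes>\<^sub>M M) d) borel (\<lambda>p. x + path (snd p) (fst p))"
  have [measurable]: "Measurable.pred (lborel \<Otimes>\<^sub>M M) (\<lambda>p. alive x (fst p) (path (snd p)))"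
    by (rule alive_path_measurable) measurable
  have d [measurable]: "d \<in> borel_measurable (lborel \<Otimes>\<^sub>M M)" unfolding d_def by measurable
  have pm [measurable]: "(\<lambda>p. path (snd p) (fst p)) \<in> borel_measurable (lborel \<Otimes>\<^sub>M M)"
    by (rule path_measurable_compose) measurable
  show "sets \<mu> = sets borel" by (simp add: \<mu>_def)
  fix f :: "real \<Rightarrow> ennreal" assume [measurable]: "f \<in> borel_measurable borel"
  have "(\<integral>\<^sup>+y. f y \<partial>\<mu>) = (\<integral>\<^sup>+p. d p * f (x + path (snd p) (fst p)) \<partial>(lborel \<Otimes>\<^sub>M M))"
    unfolding \<mu>_def by (simp add: nn_integral_distr nn_integral_density)
  also have "\<dots> = (\<integral>\<^sup>+t. (\<integral>\<^sup>+w. d (t, w) * f (x + path w t) \<partial>M) \<partial>lborel)"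
  proof -
    have "(\<lambda>p. d p * f (x + path (snd p) (fst p))) \<in> borel_measurable (lborel \<Otimes>\<^sub>M M)" by measurable
    from nn_integral_fst[OF this] show ?thesis by simp
  qed
  also have "\<dots> = free_res f x"
    unfolding res_def
  proof (rule nn_integral_cong)
    fix t :: real
    show "(\<integral>\<^sup>+w. d (t, w) * f (x + path w t) \<partial>M) = (fk_mean (\<lambda>_. 0) f x t) * indicator {0..} t"
    proof (cases "0 \<le> t")
      case True
      then show ?thesis by (auto simp: d_def fkf_zero intro!: nn_integral_cong)
    qed (simp add: d_def)
  qed
  finally show "free_res f x = (\<integral>\<^sup>+y. f y \<partial>\<mu>)" by simp
qed

text \<open>All three terms are measures evaluated at f that satisfy the relation on rays. No
  finiteness is imposed on f, so that the identity applies to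
  \<open>rate n y * res (rate n) indB y\<close>, whose integrals are not known in advance to be
  finite.\<close>

theorem one_sided_resolvent:
  assumes x: "0 \<le> x" and f [measurable]: "f \<in> borel_measurable borel"
  shows "free_res f x + W_conv f x = ennreal (W x) * pass_int f"
proof -
  obtain \<mu> :: "real measure" where \<mu>: "sets \<mu> = sets borel"
    "\<And>f. f \<in> borel_measurable borel \<Longrightarrow> free_res f x = (\<integral>\<^sup>+y. f y \<partial>\<mu>)"
    using res_zero_eq_nn_integral by blast
  define \<rho> where "\<rho> = density lborel (\<lambda>y. ennreal (W (x - y)) * indicator {0..} y)"
  define \<kappa> where "\<kappa> = density lborel (\<lambda>y. ennreal (W x) * (emeasure M (crossing y) * indicator {0..} y))"
  have \<rho>: "W_conv f x = (\<integral>\<^sup>+y. f y \<partial>\<rho>)" if [measurable]: "f \<in> borel_measurable borel" for f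
    unfolding \<rho>_def W_conv_def by (subst nn_integral_density) (auto simp: mult_ac)
  have \<kappa>: "ennreal (W x) * pass_int f = (\<integral>\<^sup>+y. f y \<partial>\<kappa>)" if [measurable]: "f \<in> borel_measurable borel" for f
    unfolding \<kappa>_def pass_int_def by (subst nn_integral_density) (auto simp: mult_ac nn_integral_cmult[symmetric])
  have em: "emeasure \<nu> {..<b} = (\<integral>\<^sup>+y. indicator {..<b} y \<partial>\<nu>)" if "sets \<nu> = sets borel" for \<nu> :: "real measure" and b
    using that by simp
  have "(\<integral>\<^sup>+y. f y \<partial>\<mu>) + (\<integral>\<^sup>+y. f y \<partial>\<rho>) = (\<integral>\<^sup>+y. f y \<partial>\<kappa>)"
  proof (rule sum_measures_eqI)
    show s: "sets \<mu> = sets borel" "sets \<rho> = sets borel" "sets \<kappa> = sets borel" by (simp_all add: \<mu> \<rho>_def \<kappa>_def)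
    fix b :: real
    show "emeasure \<mu> {..<b} + emeasure \<rho> {..<b} = emeasure \<kappa> {..<b}"
      unfolding em[OF s(1)] em[OF s(2)] em[OF s(3)]
      using one_sided_Iio[OF x, of b] by (simp only: \<mu>(2) \<rho> \<kappa> borel_measurable_indicator lessThan_borel)
    have "pass_int (indicator {..<b}) \<le> (\<integral>\<^sup>+y. indicator {0..\<bar>b\<bar>} y \<partial>lborel)"
      unfolding pass_int_def by (rule nn_integral_mono) (auto simp: indicator_def emeasure_le_1)
    also have "\<dots> < \<infinity>" by simp
    finally have "ennreal (W x) * pass_int (indicator {..<b}) < \<infinity>" by (simp add: ennreal_mult_less_top)
    then show "emeasure \<kappa> {..<b} < \<infinity>" unfolding em[OF s(3)] by (subst (asm) \<kappa>) auto
  qed (rule f)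
  then show ?thesis by (simp add: \<mu>(2) \<rho> \<kappa>)
qed

text \<open>If \<open>W c = 0\<close>, the process started at \<open>c\<close> would spend no time above \<open>0\<close> before leaving.\<close>

lemma W_pos:
  assumes c: "0 < c" shows "0 < W c"
proof (rule ccontr)
  assume "\<not> 0 < W c"
  then have "W c = 0" using W_nonneg[of c] by simp
  then have "free_res (indicator {..<c + 1}) c = 0"
    using one_sided_resolvent[of c "indicator {..<c + 1}"] c by simp
  moreover have [measurable]: "(\<lambda>t. fk_mean (\<lambda>_. 0) (indicator {..<c + 1}) c t) \<in> borel_measurable borel"
    by (rule expectation_fkf_measurable) measurable
  ultimately have "AE t in lborel. (fk_mean (\<lambda>_. 0) (indicator {..<c + 1}) c t) * indicator {0..} t = 0"
    unfolding res_def by (subst (asm) nn_integral_0_iff_AE) auto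
  then have AE_t: "AE t in lborel. 0 \<le> t \<longrightarrow> (AE w in M. \<not> (alive c t (path w) \<and> path w t < 1))"
  proof eventually_elim
    case (elim t)
    show ?case
    proof
      assume t: "0 \<le> t"
      have m: "(\<lambda>w. fkf (\<lambda>_. 0) (indicator {..<c + 1}) c t (path w)) \<in> borel_measurable M"
        by (rule fkf_path_measurable) measurable
      have "(fk_mean (\<lambda>_. 0) (indicator {..<c + 1}) c t) = 0" using elim t by simp
      then have "AE w in M. fkf (\<lambda>_. 0) (indicator {..<c + 1}) c t (path w) = 0"
        by (subst (asm) nn_integral_0_iff_AE[OF m])
      then show "AE w in M. \<not> (alive c t (path w) \<and> path w t < 1)"
        by eventually_elim (auto simp: fkf_zero)
    qed
  qed
  \<comment> \<open>The property holds for almost every t, hence along times tending to 0. But near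
    time 0 right continuity keeps a path within min(c, 1) of its start, where it survives and is
    counted.\<close>
  define Q where "Q t \<longleftrightarrow> (AE w in M. \<not> (alive c t (path w) \<and> path w t < 1))" for t
  have "\<exists>t. 0 < t \<and> t < 1 / real (Suc n) \<and> Q t" for n
  proof -
    have "0 < 1 / real (Suc n)" by simp
    from AE_lborel_ex_between[OF AE_t[folded Q_def] this] obtain t where
      "0 < t" "t < 1 / real (Suc n)" "0 \<le> t \<longrightarrow> Q t" .
    then show ?thesis by (meson less_imp_le)
  qed
  then obtain t where t: "\<And>n. 0 < t n" "\<And>n. t n < 1 / real (Suc n)" "\<And>n. Q (t n)" by metis
  have "AE w in M. \<forall>n. \<not> (alive c (t n) (path w) \<and> path w (t n) < 1)"
    unfolding AE_all_countable by (intro allI t(3)[unfolded Q_def])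
  then have "AE w in M. False"
    using AE_space
  proof eventually_elim
    case (elim w)
    have "((\<lambda>u. X u w) \<longlongrightarrow> 0) (at_right 0)"
      using rcont_X[OF elim(2), unfolded rcont_def, rule_format, of 0] X_start[OF elim(2)] by simp
    from tendstoD[OF this, of "min c 1"] c
    obtain b where b: "b > 0" "\<And>u. 0 < u \<Longrightarrow> u < b \<Longrightarrow> dist (X u w) 0 < min c 1"
      by (auto simp: eventually_at_right_field)
    obtain n where "inverse (real (Suc n)) < b" using reals_Archimedean[OF b(1)] by blast
    then have tb: "t n < b" using t(2)[of n] by (simp only: inverse_eq_divide)
    have small: "\<bar>path w v\<bar> < min c 1" if "0 \<le> v" "v \<le> t n" for v
      using b(2)[of v] that tb X_start[OF elim(2)] c by (cases "v = 0") (auto simp: dist_real_def)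
    have "alive c (t n) (path w)"
      unfolding alive_def
    proof
      fix q assume "q \<in> rats1"
      then have "0 \<le> t n * q" "t n * q \<le> t n" using t(1)[of n] by (auto simp: rats1_def mult_left_le)
      from small[OF this] show "0 \<le> c + path w (t n * q)" by linarith
    qed
    moreover have "path w (t n) < 1" using small[of "t n"] t(1)[of n] by auto
    ultimately show False using elim(1) by blast
  qed
  then show False using AE_False prob_space by (auto simp: prob_space_def emeasure_space_1)
qed

end

section \<open>Killing above a level\<close>

locale killed_snlp = snlp_scale +
  fixes \<omega> :: "real \<Rightarrow> real" and c K :: real and B :: "real set"
  assumes \<omega>_measurable [measurable]: "\<omega> \<in> borel_measurable borel" and \<omega>_nonneg: "\<And>z. 0 \<le> \<omega> z"
    and \<omega>_bounded: "\<And>z. z \<in> {0..c} \<Longrightarrow> \<omega> z \<le> K"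
    and c_pos: "0 < c" and B [measurable]: "B \<in> sets borel" and B_subset: "B \<subseteq> {0..c}"
begin

text \<open>Killing above \<open>c\<close> is the limit of running the rate \<open>n\<close> there.\<close>

definition rate :: "nat \<Rightarrow> real \<Rightarrow> real" where
  "rate n z = (if z < 0 then 0 else if z \<le> c then \<omega> z else real n)"

abbreviation indB :: "real \<Rightarrow> ennreal" where "indB \<equiv> indicator B"

text \<open>The cut-off to 0 \<le> z \<le> x \<le> c makes the bounds global and turns the integral
  over the line into a Volterra integral; only values of \<open>\<omega>\<close> on [0, c]
  enter.\<close>

definition kernel :: "real \<Rightarrow> real \<Rightarrow> real" where
  "kernel x z = (if 0 \<le> z \<and> z \<le> x \<and> x \<le> c then W (x - z) * \<omega> z else 0)"

definition g :: "real \<Rightarrow> real \<Rightarrow> real" where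
  "g x y = (if 0 \<le> y \<and> y \<le> x \<and> x \<le> c then W (x - y) else 0)"

definition killed_res :: "real \<Rightarrow> ennreal" where
  "killed_res x = (INF n. res (rate n) indB x)"

lemma rate_measurable [measurable]: "rate n \<in> borel_measurable borel"
  unfolding rate_def by measurable

lemma rate_nonneg: "0 \<le> rate n z"
  using \<omega>_nonneg by (simp add: rate_def)

lemma rate_le: "rate n z \<le> max K (real n)"
  using \<omega>_bounded[of z] by (auto simp: rate_def le_max_iff_disj)

lemma K_nonneg: "0 \<le> K"
  using \<omega>_nonneg[of 0] \<omega>_bounded[of 0] c_pos by auto

lemma killed_res_measurable [measurable]: "killed_res \<in> borel_measurable borel"
  unfolding killed_res_def by measurable

lemma f_le: "indB y \<le> 1" and f_outside: "y \<notin> {0..c} \<Longrightarrow> indB y = 0"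
  using B_subset by (auto simp: indicator_def)

lemma path_borel: "w \<in> space M \<Longrightarrow> path w \<in> borel_measurable borel"
  using path_measurable_compose[of "\<lambda>_. w" borel "\<lambda>t. t"] by simp

lemma rate_path_integrable:
  assumes "w \<in> space M"
  shows "set_integrable lborel {0..t} (\<lambda>v. rate n (x + path w v))"
proof (rule set_integrable_bound)
  note [measurable] = path_borel[OF assms]
  show "set_integrable lborel {0..t} (\<lambda>_. max K (real n))" by (rule borel_integrable_atLeastAtMost') auto
  show "set_borel_measurable lborel {0..t} (\<lambda>v. rate n (x + path w v))"
    unfolding set_borel_measurable_def by measurable
  show "AE v in lborel. v \<in> {0..t} \<longrightarrow> norm (rate n (x + path w v)) \<le> norm (max K (real n))"
    using rate_nonneg rate_le K_nonneg by (auto intro!: AE_I2)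
qed

lemma fkf_decseq:
  assumes w: "w \<in> space M"
  shows "decseq (\<lambda>n. fkf (rate n) indB x t (path w))"
proof (rule decseq_SucI)
  fix n
  have "(LINT v:{0..t}|lborel. rate n (x + path w v)) \<le> (LINT v:{0..t}|lborel. rate (Suc n) (x + path w v))"
    by (intro set_integral_mono rate_path_integrable w) (auto simp: rate_def)
  then show "fkf (rate (Suc n)) indB x t (path w) \<le> fkf (rate n) indB x t (path w)"
    by (auto simp: fkf_def intro!: mult_right_mono ennreal_leI)
qed

lemma res_decseq: "decseq (\<lambda>n. res (rate n) indB x)"
  unfolding decseq_def res_def
  by (intro allI impI nn_integral_mono mult_right_mono decseqD[OF fkf_decseq]) auto

lemma killed_res_lim: "(\<lambda>n. res (rate n) indB x) \<longlonglongrightarrow> killed_res x"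
  unfolding killed_res_def using res_decseq by (rule LIMSEQ_INF)

lemma pass_int_f: "pass_int indB \<le> ennreal c"
proof -
  have "pass_int indB \<le> (\<integral>\<^sup>+y. indicator {0..c} y \<partial>lborel)"
    unfolding pass_int_def
  proof (rule nn_integral_mono)
    fix y
    show "indB y * emeasure M (crossing y) * indicator {0..} y \<le> indicator {0..c} y"
      using f_outside[of y] f_le[of y] mult_mono[of "indB y" 1 "emeasure M (crossing y)" 1] emeasure_le_1[of "crossing y"]
      by (auto simp: indicator_def)
  qed
  also have "\<dots> = ennreal c" using c_pos by simp
  finally show ?thesis .
qed

text \<open>Dropping the convolution from the one-sided identity leaves W(x) times
  \<open>pass_int indB\<close>. The resulting bound W(c) c passes to all the killed resolvents and
  supplies the majorants and the finiteness used below.\<close>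

lemma res_zero_f_le:
  assumes "x \<in> {0..c}" shows "free_res indB x \<le> ennreal (W c * c)"
proof -
  have "free_res indB x \<le> ennreal (W x) * pass_int indB"
    using one_sided_resolvent[of x indB] assms by (metis B atLeastAtMost_iff borel_measurable_indicator le_iff_add)
  also have "\<dots> \<le> ennreal (W c) * ennreal c"
    using assms by (intro mult_mono pass_int_f ennreal_leI monoD[OF W_mono]) auto
  finally show ?thesis using W_nonneg[of c] c_pos by (simp add: ennreal_mult)
qed

lemma resolvent_eq: "free_res indB x = res (rate n) indB x + free_res (\<lambda>y. rate n y * res (rate n) indB y) x"
  by (rule resolvent_identity[where K="max K (real n)"]) (auto simp: rate_nonneg rate_le)

lemma res_rate_le:
  assumes "x \<in> {0..c}" shows "res (rate n) indB x \<le> ennreal (W c * c)"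
  using res_zero_f_le[OF assms] unfolding resolvent_eq[of x n] by (metis le_iff_add order_trans)

lemma kernel_measurable: "case_prod kernel \<in> borel_measurable (borel \<Otimes>\<^sub>M borel)"
  unfolding kernel_def case_prod_beta' by measurable

lemma g_measurable': "case_prod g \<in> borel_measurable (borel \<Otimes>\<^sub>M borel)"
  unfolding g_def case_prod_beta' by measurable

lemma kernel_bounds: "0 \<le> kernel x z" "kernel x z \<le> W c * K"
proof -
  show "0 \<le> kernel x z" using W_nonneg \<omega>_nonneg by (simp add: kernel_def)
  show "kernel x z \<le> W c * K"
    using W_nonneg[of c] K_nonneg
    by (auto simp: kernel_def intro!: mult_mono monoD[OF W_mono] \<omega>_bounded \<omega>_nonneg)
qed

lemma g_bounds: "0 \<le> g x y" "g x y \<le> W c"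
  using W_nonneg by (auto simp: g_def intro!: monoD[OF W_mono])

lemma kernel_section [measurable]: "kernel x \<in> borel_measurable borel"
  unfolding kernel_def by measurable

lemma g_section [measurable]: "g x \<in> borel_measurable borel"
  unfolding g_def by measurable

lemma W_conv_f:
  assumes x: "x \<in> {0..c}"
  shows "W_conv indB x = ennreal (LINT y|lborel. indicator B y * g x y)"
proof -
  have eq: "indB y * ennreal (W (x - y)) * indicator {0..} y = ennreal (indicator B y * g x y)" for y
    using x B_subset W_neg[of "x - y"] by (auto simp: g_def indicator_def)
  have int: "integrable lborel (\<lambda>y. indicator B y * g x y)"
  proof (rule Bochner_Integration.integrable_bound)
    show "integrable lborel (\<lambda>y. W c * indicator {0..c} y)"
      by (intro integrable_mult_right integrable_real_indicator) (auto simp: emeasure_lborel_Icc_eq)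
    show "AE y in lborel. norm (indicator B y * g x y) \<le> norm (W c * indicator {0..c} y)"
      using g_bounds W_nonneg[of c] B_subset by (intro AE_I2) (auto simp: indicator_def)
  qed measurable
  show ?thesis
    unfolding W_conv_def eq using g_bounds by (intro nn_integral_eq_integral int) auto
qed

text \<open>Only z in [0, x] contributes, and there \<open>rate n\<close> equals
  \<open>\<omega>\<close>. Inside the convolution n survives only in the resolvent; the rate above c
  enters through \<open>pass_int\<close> alone, that is, through a constant.\<close>

lemma W_conv_rate:
  assumes x: "x \<in> {0..c}"
  shows "W_conv (\<lambda>y. rate n y * res (rate n) indB y) x = (\<integral>\<^sup>+z. ennreal (kernel x z) * res (rate n) indB z \<partial>lborel)"
  unfolding W_conv_def
proof (rule nn_integral_cong)
  fix z
  show "ennreal (rate n z) * res (rate n) indB z * ennreal (W (x - z)) * indicator {0..} z = ennreal (kernel x z) * res (rate n) indB z"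
    using x W_neg[of "x - z"] W_nonneg[of "x - z"] \<omega>_nonneg[of z]
    by (cases "z < 0"; cases "x < z") (auto simp: kernel_def rate_def ennreal_mult mult_ac)
qed

lemma kernel_integral_le:
  assumes h: "\<And>z. z \<in> {0..c} \<Longrightarrow> h z \<le> ennreal (W c * c)"
  shows "ennreal (kernel x z) * h z \<le> ennreal (W c * K * (W c * c)) * indicator {0..c} z"
proof (cases "z \<in> {0..c}")
  case True
  have "ennreal (kernel x z) * h z \<le> ennreal (W c * K) * ennreal (W c * c)"
    by (intro mult_mono ennreal_leI kernel_bounds h True) auto
  then show ?thesis using True W_nonneg[of c] K_nonneg c_pos by (simp add: ennreal_mult)
next
  case False
  then have "kernel x z = 0" by (auto simp: kernel_def)
  then show ?thesis by simp
qed

lemma killed_res_le: "x \<in> {0..c} \<Longrightarrow> killed_res x \<le> ennreal (W c * c)"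
  unfolding killed_res_def using res_rate_le by (metis INF_lower order_trans UNIV_I)

lemma kernel_dominated: "(\<integral>\<^sup>+z. ennreal (W c * K * (W c * c)) * indicator {0..c} z \<partial>lborel) < \<infinity>"
  using c_pos by (subst nn_integral_cmult) (auto simp: ennreal_mult_less_top)

lemma kernel_lim:
  "(\<lambda>n. \<integral>\<^sup>+z. ennreal (kernel x z) * res (rate n) indB z \<partial>lborel) \<longlonglongrightarrow> (\<integral>\<^sup>+z. ennreal (kernel x z) * killed_res z \<partial>lborel)"
proof (rule nn_integral_dominated_convergence[OF _ _ _ _ kernel_dominated])
  show "AE z in lborel. ennreal (kernel x z) * res (rate n) indB z \<le> ennreal (W c * K * (W c * c)) * indicator {0..c} z" for n
    by (intro AE_I2 kernel_integral_le res_rate_le)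
  show "AE z in lborel. (\<lambda>n. ennreal (kernel x z) * res (rate n) indB z) \<longlonglongrightarrow> ennreal (kernel x z) * killed_res z"
    by (intro AE_I2 ennreal_tendsto_cmult killed_res_lim) simp
qed measurable

lemma kernel_killed_res:
  "(\<integral>\<^sup>+z. ennreal (kernel x z) * killed_res z \<partial>lborel) = ennreal (LINT z|lborel. kernel x z * enn2real (killed_res z))"
proof -
  have fin: "killed_res z < \<infinity>" if "z \<in> {0..c}" for z using killed_res_le[OF that] by (rule le_less_trans) simp
  have eq: "ennreal (kernel x z) * killed_res z = ennreal (kernel x z * enn2real (killed_res z))" for z
  proof (cases "z \<in> {0..c}")
    case True
    then show ?thesis using fin[OF True] kernel_bounds[of x z] by (simp add: ennreal_mult)
  next
    case False
    then have "kernel x z = 0" by (auto simp: kernel_def)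
    then show ?thesis by simp
  qed
  have "integrable lborel (\<lambda>z. kernel x z * enn2real (killed_res z))"
  proof (rule integrableI_nonneg)
    have "(\<integral>\<^sup>+z. ennreal (kernel x z) * killed_res z \<partial>lborel) \<le> (\<integral>\<^sup>+z. ennreal (W c * K * (W c * c)) * indicator {0..c} z \<partial>lborel)"
      by (intro nn_integral_mono kernel_integral_le killed_res_le)
    also have "\<dots> < \<infinity>" by (rule kernel_dominated)
    finally show "(\<integral>\<^sup>+z. ennreal (kernel x z * enn2real (killed_res z)) \<partial>lborel) < \<infinity>" unfolding eq .
  qed (use kernel_bounds in auto)
  then show ?thesis unfolding eq by (intro nn_integral_eq_integral) (use kernel_bounds in auto)
qed

text \<open>The one-sided identity is applied to the indicator of B and to rate times resolvent;
  \<open>resolvent_eq\<close> eliminates the free resolvents. This is the Volterra equation for each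
  n, with constant p - r(n). Its value at c shows that these constants converge.\<close>

lemma killed_res_equation:
  obtains \<kappa> where "\<And>x. x \<in> {0..c} \<Longrightarrow>
    enn2real (killed_res x) = \<kappa> * g x 0 - (LINT y|lborel. indicator B y * g x y) + (LINT z|lborel. kernel x z * enn2real (killed_res z))"
proof -
  define u where "u n x = enn2real (res (rate n) indB x)" for n x
  define T where "T n x = enn2real (\<integral>\<^sup>+z. ennreal (kernel x z) * res (rate n) indB z \<partial>lborel)" for n x
  define q where "q n = pass_int (\<lambda>y. rate n y * res (rate n) indB y)" for n
  let ?F = "\<lambda>x. LINT y|lborel. indicator B y * g x y"
  have Wc: "0 < W c" by (rule W_pos[OF c_pos])
  have c_in: "c \<in> {0..c}" using c_pos by simp
  have F_nonneg: "0 \<le> ?F x" for x using g_bounds by (intro integral_nonneg_AE) auto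
  have u: "res (rate n) indB x = ennreal (u n x)" if "x \<in> {0..c}" for n x
  proof -
    have "res (rate n) indB x < top" using res_rate_le[OF that, of n] by (rule le_less_trans) simp
    then show ?thesis by (simp add: u_def)
  qed
  have T: "(\<integral>\<^sup>+z. ennreal (kernel x z) * res (rate n) indB z \<partial>lborel) = ennreal (T n x)" for n x
  proof -
    have "(\<integral>\<^sup>+z. ennreal (kernel x z) * res (rate n) indB z \<partial>lborel) \<le> (\<integral>\<^sup>+z. ennreal (W c * K * (W c * c)) * indicator {0..c} z \<partial>lborel)"
      by (intro nn_integral_mono kernel_integral_le res_rate_le)
    also have "\<dots> < top" using kernel_dominated by simp
    finally show ?thesis by (simp add: T_def)
  qed
  define p where "p = enn2real (pass_int indB)"
  have p: "pass_int indB = ennreal p"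
  proof -
    have "pass_int indB < top" using pass_int_f by (rule le_less_trans) simp
    then show ?thesis by (simp add: p_def)
  qed
  \<comment> \<open>Kept free of subtraction: at this stage \<open>q n\<close> might be
    infinite.\<close>
  have eqE: "ennreal (u n x) + ennreal (W x) * q n + ennreal (?F x) = ennreal (W x) * ennreal p + ennreal (T n x)"
    if x: "x \<in> {0..c}" for n x
  proof -
    let ?h = "\<lambda>y. ennreal (rate n y) * res (rate n) indB y"
    have x0: "0 \<le> x" using x by simp
    have hm: "?h \<in> borel_measurable borel" and fm: "indB \<in> borel_measurable borel" by measurable
    have 1: "free_res indB x + W_conv indB x = ennreal (W x) * pass_int indB" by (rule one_sided_resolvent[OF x0 fm])
    have 2: "free_res ?h x + W_conv ?h x = ennreal (W x) * q n" unfolding q_def by (rule one_sided_resolvent[OF x0 hm])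
    have "ennreal (u n x) + ennreal (W x) * q n + ennreal (?F x) = res (rate n) indB x + (free_res ?h x + W_conv ?h x) + W_conv indB x"
      unfolding 2 u[OF x] W_conv_f[OF x] ..
    also have "\<dots> = (res (rate n) indB x + free_res ?h x) + W_conv indB x + W_conv ?h x" by (simp only: add_ac)
    also have "\<dots> = ennreal (W x) * pass_int indB + W_conv ?h x" unfolding resolvent_eq[symmetric] 1 ..
    also have "\<dots> = ennreal (W x) * ennreal p + ennreal (T n x)" unfolding p W_conv_rate[OF x] T ..
    finally show ?thesis .
  qed
  define r where "r n = enn2real (q n)" for n
  have q: "q n = ennreal (r n)" for n
  proof -
    \<comment> \<open>At x = c the other side of \<open>eqE\<close> is finite, and W(c) > 0 then
      forces \<open>q n\<close> to be finite.\<close>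
    have "ennreal (W c) * q n \<le> ennreal (u n c) + ennreal (W c) * q n + ennreal (?F c)"
      by (metis add.commute add.left_commute le_iff_add)
    also have "\<dots> < top" unfolding eqE[OF c_in] by (simp add: ennreal_mult_less_top)
    finally have "q n < top" using Wc by (auto simp: ennreal_mult_less_top)
    then show ?thesis by (simp add: r_def)
  qed
  have pos: "0 \<le> u n x" "0 \<le> T n x" "0 \<le> r n" "0 \<le> p" for n x by (simp_all add: u_def T_def r_def p_def)
  have eqR: "u n x = W x * (p - r n) - ?F x + T n x" if x: "x \<in> {0..c}" for n x
  proof -
    have "ennreal (u n x + W x * r n + ?F x) = ennreal (W x * p + T n x)"
      using eqE[OF x, of n] pos F_nonneg[of x] W_nonneg[of x] unfolding q
      by (simp add: ennreal_mult[symmetric] ennreal_plus[symmetric] del: ennreal_plus)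
    then have "u n x + W x * r n + ?F x = W x * p + T n x"
      using pos F_nonneg[of x] W_nonneg[of x] by (subst (asm) ennreal_inj) auto
    then show ?thesis by (simp add: algebra_simps)
  qed
  have u_lim: "(\<lambda>n. u n x) \<longlonglongrightarrow> enn2real (killed_res x)" if x: "x \<in> {0..c}" for x
  proof -
    have "killed_res x < top" using killed_res_le[OF x] by (rule le_less_trans) simp
    then have "killed_res x = ennreal (enn2real (killed_res x))" by simp
    then show ?thesis unfolding u_def using killed_res_lim[of x] by (intro tendsto_enn2real) auto
  qed
  have T_lim: "(\<lambda>n. T n x) \<longlonglongrightarrow> (LINT z|lborel. kernel x z * enn2real (killed_res z))" for x
  proof -
    have "0 \<le> (LINT z|lborel. kernel x z * enn2real (killed_res z))" using kernel_bounds by (intro integral_nonneg_AE) auto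
    then show ?thesis unfolding T_def using kernel_lim[of x] unfolding kernel_killed_res by (intro tendsto_enn2real) auto
  qed
  \<comment> \<open>Solving the limiting equation at x = c for the constant; the equation for each
    n, solved in the same way, then converges to it.\<close>
  define \<kappa> where "\<kappa> = (enn2real (killed_res c) + ?F c - (LINT z|lborel. kernel c z * enn2real (killed_res z))) / W c"
  have "(\<lambda>n. (u n c + ?F c - T n c) / W c) \<longlonglongrightarrow> \<kappa>"
    unfolding \<kappa>_def using Wc by (intro tendsto_intros u_lim c_in T_lim) auto
  then have \<kappa>: "(\<lambda>n. p - r n) \<longlonglongrightarrow> \<kappa>"
    using eqR[OF c_in] Wc by simp
  show ?thesis
  proof
    fix x assume x: "x \<in> {0..c}"
    have "(\<lambda>n. W x * (p - r n) - ?F x + T n x) \<longlonglongrightarrow> W x * \<kappa> - ?F x + (LINT z|lborel. kernel x z * enn2real (killed_res z))"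
      by (intro tendsto_intros \<kappa> T_lim)
    then have "(\<lambda>n. u n x) \<longlonglongrightarrow> W x * \<kappa> - ?F x + (LINT z|lborel. kernel x z * enn2real (killed_res z))"
      using eqR[OF x] by simp
    from LIMSEQ_unique[OF u_lim[OF x] this] x
    show "enn2real (killed_res x) = \<kappa> * g x 0 - ?F x + (LINT z|lborel. kernel x z * enn2real (killed_res z))"
      by (simp add: g_def mult.commute)
  qed
qed

text \<open>A path in [0, c] up to t meets only the rate \<open>\<omega>\<close>, so nothing depends
  on n. A path above c at some v < t stays above c for a length d after v, so its weight is at most
  e^(-n d). The value at t itself is constrained by B, a subset of [0, c].\<close>

lemma fkf_limit:
  assumes w: "w \<in> space M" and t: "0 \<le> t"
  shows "(INF n. fkf (rate n) indB x t (path w))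
    = (if (\<forall>v\<in>{0..<t}. x + X v w \<in> {0..c}) then ennreal (exp (- (LINT v:{0..t}|lborel. \<omega> (x + X v w)))) * indB (x + X t w) else 0)"
proof (cases "x + X t w \<in> B")
  case False
  then show ?thesis using t by (simp add: fkf_def)
next
  case inB: True
  have rc: "rcont (path w)" using w by (rule rcont_path)
  show ?thesis
  proof (cases "\<forall>v\<in>{0..<t}. x + X v w \<in> {0..c}")
    case True
    have in_c: "x + X v w \<in> {0..c}" if "v \<in> {0..t}" for v
      using that True inB B_subset by (cases "v = t") auto
    have "alive x t (path w)"
      unfolding alive_iff[OF rc t]
    proof
      fix v assume v: "v \<in> {0..t}"
      then show "0 \<le> x + path w v" using in_c[OF v] by simp
    qed
    moreover have "(LINT v:{0..t}|lborel. rate n (x + path w v)) = (LINT v:{0..t}|lborel. \<omega> (x + X v w))" for n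
      unfolding set_lebesgue_integral_def
    proof (rule Bochner_Integration.integral_cong)
      fix v :: real
      show "indicator {0..t} v *\<^sub>R rate n (x + path w v) = indicator {0..t} v *\<^sub>R \<omega> (x + X v w)"
      proof (cases "v \<in> {0..t}")
        case True
        then show ?thesis using in_c[OF True] by (simp add: rate_def)
      qed simp
    qed simp
    ultimately have "fkf (rate n) indB x t (path w) = ennreal (exp (- (LINT v:{0..t}|lborel. \<omega> (x + X v w)))) * indB (x + X t w)" for n
      using t by (simp add: fkf_def)
    then show ?thesis using True by simp
  next
    case False
    then obtain v where v: "0 \<le> v" "v < t" "x + X v w \<notin> {0..c}" by auto
    have "(INF n. fkf (rate n) indB x t (path w)) \<le> 0"
    proof (cases "x + X v w < 0")
      case True
      then have "\<not> alive x t (path w)" using v alive_iff[OF rc t, of x] by (auto intro!: bexI[of _ v])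
      then show ?thesis by (simp add: fkf_def)
    next
      case False
      then have gt: "c - x < X v w" using v by auto
      have "((\<lambda>u. X u w) \<longlongrightarrow> X v w) (at_right v)" using rcont_X[OF w] v by (simp add: rcont_def)
      from order_tendstoD(1)[OF this gt]
      obtain b where b: "b > v" "\<And>r. v < r \<Longrightarrow> r < b \<Longrightarrow> c - x < X r w" by (auto simp: eventually_at_right_field)
      define d where "d = min b t - v"
      have d: "0 < d" using b v by (simp add: d_def)
      have int_ge: "real n * d \<le> (LINT v:{0..t}|lborel. rate n (x + path w v))" for n
      proof -
        have "real n * d = (LINT r:{v<..<v+d}|lborel. real n)"
          using d by (simp add: set_lebesgue_integral_def)
        also have "\<dots> \<le> (LINT r:{0..t}|lborel. rate n (x + path w r))"
          unfolding set_lebesgue_integral_def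
        proof (rule integral_mono)
          show "integrable lborel (\<lambda>r. indicator {v<..<v+d} r *\<^sub>R real n)"
            using d by (intro integrable_scaleR_left integrable_real_indicator) auto
          show "integrable lborel (\<lambda>r. indicator {0..t} r *\<^sub>R rate n (x + path w r))"
            using rate_path_integrable[OF w] by (simp add: set_integrable_def)
          fix r :: real
          show "indicator {v<..<v+d} r *\<^sub>R real n \<le> indicator {0..t} r *\<^sub>R rate n (x + path w r)"
          proof (cases "r \<in> {v<..<v+d}")
            case True
            then have "c < x + X r w" "r \<in> {0..t}" using b(2)[of r] v by (auto simp: d_def)
            then show ?thesis using True c_pos by (simp add: rate_def)
          qed (simp add: rate_nonneg)
        qed
        finally show ?thesis .
      qed
      have fk_le: "fkf (rate n) indB x t (path w) \<le> ennreal (exp (- (real n * d)))" for n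
      proof -
        have "fkf (rate n) indB x t (path w) \<le> ennreal (exp (- (LINT v:{0..t}|lborel. rate n (x + path w v)))) * 1"
        proof -
          have "ennreal (exp (- (LINT v:{0..t}|lborel. rate n (x + path w v)))) * indB (x + path w t)
            \<le> ennreal (exp (- (LINT v:{0..t}|lborel. rate n (x + path w v)))) * 1"
            by (intro mult_left_mono f_le) simp
          then show ?thesis by (cases "alive x t (path w)") (simp_all only: fkf_def if_True if_False zero_le)
        qed
        also have "\<dots> \<le> ennreal (exp (- (real n * d)))" using int_ge[of n] by (simp add: ennreal_leI)
        finally show ?thesis .
      qed
      have "(\<lambda>n. ennreal (exp (- d) ^ n)) \<longlonglongrightarrow> ennreal 0"
        using d by (intro tendsto_ennrealI LIMSEQ_power_zero) auto
      then have "(\<lambda>n. ennreal (exp (- (real n * d)))) \<longlonglongrightarrow> 0"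
        by (simp add: exp_of_nat_mult[symmetric])
      then show ?thesis
      proof (rule LIMSEQ_le_const, intro exI allI impI)
        fix n
        have "(INF n. fkf (rate n) indB x t (path w)) \<le> fkf (rate n) indB x t (path w)" by (rule INF_lower) simp
        also have "\<dots> \<le> ennreal (exp (- (real n * d)))" by (rule fk_le)
        finally show "(INF n. fkf (rate n) indB x t (path w)) \<le> ennreal (exp (- (real n * d)))" .
      qed
    qed
    then show ?thesis unfolding if_not_P[OF False] by simp
  qed
qed

lemma killed_res_explicit:
  assumes x: "x \<in> {0..c}"
  shows "killed_res x = (\<integral>\<^sup>+t\<in>{0..}. (\<integral>\<^sup>+w. (INF n. fkf (rate n) indB x t (path w)) \<partial>M) \<partial>lborel)"
proof -
  have [measurable]: "(\<lambda>t. fk_mean (rate n) indB x t) \<in> borel_measurable lborel" for n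
    by (rule expectation_fkf_measurable) measurable
  have [measurable]: "(\<lambda>w. fkf (rate n) indB x t (path w)) \<in> borel_measurable M" for n t
    by (rule fkf_path_measurable) measurable
  have fkf1: "fkf (rate n) indB x t (path w) \<le> 1" for n t w
  proof -
    have "0 \<le> (LINT v:{0..t}|lborel. rate n (x + path w v))"
      unfolding set_lebesgue_integral_def by (intro integral_nonneg_AE) (auto simp: rate_nonneg)
    then have "ennreal (exp (- (LINT v:{0..t}|lborel. rate n (x + path w v)))) * indB (x + path w t) \<le> 1 * 1"
      by (intro mult_mono f_le) auto
    then show ?thesis by (simp add: fkf_def)
  qed
  have inner: "(\<lambda>n. fk_mean (rate n) indB x t) \<longlonglongrightarrow> (\<integral>\<^sup>+w. (INF n. fkf (rate n) indB x t (path w)) \<partial>M)" for t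
  proof (rule nn_integral_dominated_convergence[where w="\<lambda>_. 1"])
    show "AE w in M. (\<lambda>n. fkf (rate n) indB x t (path w)) \<longlonglongrightarrow> (INF n. fkf (rate n) indB x t (path w))"
      using AE_space by eventually_elim (intro LIMSEQ_INF fkf_decseq)
  qed (auto intro!: AE_I2 fkf1 simp: emeasure_space_1)
  have meas_inner: "(\<lambda>t. \<integral>\<^sup>+w. (INF n. fkf (rate n) indB x t (path w)) \<partial>M) \<in> borel_measurable lborel"
  proof -
    have [measurable]: "(\<lambda>p. fkf (rate n) indB x (fst p) (path (snd p))) \<in> borel_measurable (lborel \<Otimes>\<^sub>M M)" for n
      by (rule fkf_path_measurable) measurable
    have "(\<lambda>p. INF n. fkf (rate n) indB x (fst p) (path (snd p))) \<in> borel_measurable (lborel \<Otimes>\<^sub>M M)" by measurable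
    from borel_measurable_nn_integral_fst[OF this] show ?thesis by simp
  qed
  have "(\<lambda>n. res (rate n) indB x) \<longlonglongrightarrow> (\<integral>\<^sup>+t\<in>{0..}. (\<integral>\<^sup>+w. (INF n. fkf (rate n) indB x t (path w)) \<partial>M) \<partial>lborel)"
    unfolding res_def
  \<comment> \<open>The functionals decrease in n, so the one with n = 0 is a majorant, and its
    resolvent is finite on [0, c].\<close>
  proof (rule nn_integral_dominated_convergence[where w="\<lambda>t. (fk_mean (rate 0) indB x t) * indicator {0..} t"])
    show "AE t in lborel. (fk_mean (rate n) indB x t) * indicator {0..} t \<le> (fk_mean (rate 0) indB x t) * indicator {0..} t" for n
      by (intro AE_I2 mult_right_mono nn_integral_mono decseqD[OF fkf_decseq]) auto
    show "(\<integral>\<^sup>+t\<in>{0..}. (fk_mean (rate 0) indB x t) \<partial>lborel) < \<infinity>"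
      using le_less_trans[OF res_rate_le[OF x, of 0]] by (simp add: res_def)
    show "AE t in lborel. (\<lambda>n. (fk_mean (rate n) indB x t) * indicator {0..} t)
      \<longlonglongrightarrow> (\<integral>\<^sup>+w. (INF n. fkf (rate n) indB x t (path w)) \<partial>M) * indicator {0..} t"
    proof (rule AE_I2)
      fix t :: real
      show "(\<lambda>n. (fk_mean (rate n) indB x t) * indicator {0..} t)
        \<longlonglongrightarrow> (\<integral>\<^sup>+w. (INF n. fkf (rate n) indB x t (path w)) \<partial>M) * indicator {0..} t"
        using inner[of t] by (cases "0 \<le> t") auto
    qed
  qed (use meas_inner in measurable)
  from LIMSEQ_unique[OF killed_res_lim this] show ?thesis .
qed

lemma killed_res_at_c: "killed_res c = 0"
proof -
  have "(\<integral>\<^sup>+t\<in>{0..}. (\<integral>\<^sup>+w. (INF n. fkf (rate n) indB c t (path w)) \<partial>M) \<partial>lborel) = (\<integral>\<^sup>+t. 0 \<partial>(lborel :: real measure))"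
  proof (rule nn_integral_cong_AE)
    show "AE t in lborel. (\<integral>\<^sup>+w. (INF n. fkf (rate n) indB c t (path w)) \<partial>M) * indicator {0..} t = 0"
      using regular_upward
    proof eventually_elim
      case (elim t)
      show ?case
      proof (cases "0 \<le> t")
        case t: True
        have "AE w in M. (INF n. fkf (rate n) indB c t (path w)) = 0"
          using elim[rule_format, OF t] AE_space
        proof eventually_elim
          case (elim w)
          then obtain v where v: "v \<in> {0..t}" "\<not> X v w \<le> 0" using alive_below_iff[OF elim(2) t, of 0] by blast
          show ?case
          \<comment> \<open>If the path is seen above c only at time t itself, then its final value
            lies outside [0, c], hence outside B.\<close>
          proof (cases "v = t")
            case True
            then show ?thesis using fkf_limit[OF elim(2) t, of c] v f_outside[of "c + X t w"] by simp
          next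
            case False
            then have "\<not> (\<forall>v\<in>{0..<t}. c + X v w \<in> {0..c})" using v by (auto intro!: bexI[of _ v])
            then show ?thesis unfolding fkf_limit[OF elim(2) t] by (rule if_not_P)
          qed
        qed
        then have "(\<integral>\<^sup>+w. (INF n. fkf (rate n) indB c t (path w)) \<partial>M) = (\<integral>\<^sup>+w. 0 \<partial>M)" by (rule nn_integral_cong_AE)
        then show ?thesis by simp
      qed simp
    qed
  qed
  then show ?thesis using killed_res_explicit[of c] c_pos by simp
qed

section \<open>From the limiting functional to the first passage times\<close>

definition unexited :: "real \<Rightarrow> real \<Rightarrow> 'a \<Rightarrow> bool" where
  "unexited x t w \<longleftrightarrow> (\<exists>q\<in>rats0. t < q \<and> (\<forall>r\<in>rats0. 0 < r \<and> r < q \<longrightarrow> x + path w r \<in> {0..c}))"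

text \<open>Rational times below q accumulate at s from the right because s \<le> t < q, and [0, c]
  is closed.\<close>

lemma unexited_imp:
  assumes w: "w \<in> space M" and "unexited x t w" and s: "0 < s" "s \<le> t"
  shows "x + X s w \<in> {0..c}"
proof -
  obtain q where q: "t < q" "\<And>r. r \<in> rats0 \<Longrightarrow> 0 < r \<Longrightarrow> r < q \<Longrightarrow> x + X r w \<in> {0..c}"
    using assms(2) by (auto simp: unexited_def)
  have lim: "((\<lambda>u. x + X u w) \<longlongrightarrow> x + X s w) (at_right s)"
    using rcont_X[OF w] s by (auto simp: rcont_def intro!: tendsto_intros)
  have "closed {0..c}" by simp
  moreover have "\<exists>\<^sub>F u in at_right s. x + X u w \<in> {0..c}"
    unfolding frequently_def
  proof
    assume "\<forall>\<^sub>F u in at_right s. x + X u w \<notin> {0..c}"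
    then obtain b where b: "b > s" "\<And>u. s < u \<Longrightarrow> u < b \<Longrightarrow> x + X u w \<notin> {0..c}"
      by (auto simp: eventually_at_right_field)
    obtain r where r: "r \<in> \<rat>" "s < r" "r < min b q"
      using Rats_dense_in_real[of s "min b q"] b(1) q(1) s by auto
    then show False using b(2)[of r] q(2)[of r] s by (auto simp: rats0_def)
  qed
  ultimately show ?thesis
  proof (rule_tac ccontr)
    assume "x + X s w \<notin> {0..c}"
    then have "\<forall>\<^sub>F u in at_right s. x + X u w \<in> - {0..c}"
      by (intro topological_tendstoD[OF lim]) auto
    then show False using \<open>\<exists>\<^sub>F u in at_right s. x + X u w \<in> {0..c}\<close> by (simp add: frequently_def)
  qed
qed

text \<open>Being strictly below an infimum means that some rational q > t precedes every exit time.
  With q in place, right continuity reduces the condition on all of (0, q) to rational times, which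
  makes the event measurable.\<close>

lemma before_exit_iff:
  assumes w: "w \<in> space M" and t: "0 \<le> t"
  shows "ereal t < min (passage_below 0 (\<lambda>s. started_at x X s w)) (passage_above c (\<lambda>s. started_at x X s w)) \<longleftrightarrow> unexited x t w"
    (is "ereal t < ?m \<longleftrightarrow> _")
proof
  assume "ereal t < ?m"
  then obtain z where z: "ereal t < ereal z" "ereal z < ?m" using ereal_dense2 by blast
  then have "t < z" by simp
  then obtain q where q: "q \<in> \<rat>" "t < q" "q < z" using Rats_dense_in_real by blast
  have "x + path w r \<in> {0..c}" if r: "0 < r" "r < q" for r
  proof (rule ccontr)
    assume "x + path w r \<notin> {0..c}"
    then have "passage_below 0 (\<lambda>s. started_at x X s w) \<le> ereal r \<or> passage_above c (\<lambda>s. started_at x X s w) \<le> ereal r"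
      using r by (auto simp: passage_below_def passage_above_def started_at_def intro: INF_lower)
    then have "?m \<le> ereal r" by (auto simp: min_le_iff_disj)
    also have "\<dots> < ereal z" using r q by simp
    finally show False using z(2) by (rule less_asym)
  qed
  then show "unexited x t w" unfolding unexited_def using q t by (intro bexI[of _ q]) (auto simp: rats0_def)
next
  assume "unexited x t w"
  then obtain q where q: "q \<in> rats0" "t < q" "\<forall>r\<in>rats0. 0 < r \<and> r < q \<longrightarrow> x + path w r \<in> {0..c}"
    by (auto simp: unexited_def)
  have un: "unexited x s w" if "s < q" for s using that q unfolding unexited_def by blast
  have in_c: "x + X s w \<in> {0..c}" if "0 < s" "s < q" for s
    by (rule unexited_imp[OF w un[OF that(2)]]) (use that in auto)
  have "ereal q \<le> ?m"
    unfolding passage_below_def passage_above_def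
  proof (intro min.boundedI INF_greatest)
    fix s assume "s \<in> {t. 0 < t \<and> started_at x X t w < 0}"
    then show "ereal q \<le> ereal s" using in_c[of s] by (force simp: started_at_def)
  next
    fix s assume "s \<in> {t. 0 < t \<and> c < started_at x X t w}"
    then show "ereal q \<le> ereal s" using in_c[of s] by (force simp: started_at_def)
  qed
  moreover have "ereal t < ereal q" using q by simp
  ultimately show "ereal t < ?m" by (rule less_le_trans[rotated])
qed

definition surviving :: "real \<Rightarrow> real \<Rightarrow> 'a \<Rightarrow> ennreal" where
  "surviving x t w = (if unexited x t w \<and> x + path w t \<in> B then ennreal (exp (- (LINT v:{0..t}|lborel. \<omega> (x + path w v)))) else 0)"

lemma surviving_measurable:
  assumes [measurable]: "z \<in> borel_measurable N" "t \<in> borel_measurable N" "V \<in> measurable N M"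
  shows "(\<lambda>a. surviving (z a) (t a) (V a)) \<in> borel_measurable N"
proof -
  have [measurable]: "(\<lambda>a. path (V a) (s a)) \<in> borel_measurable N" if [measurable]: "s \<in> borel_measurable N" for s
    by (rule path_measurable_compose) measurable
  have "{a \<in> space N. unexited (z a) (t a) (V a)}
    = (\<Union>q\<in>rats0. {a \<in> space N. t a < q} \<inter> {a \<in> space N. \<forall>r\<in>rats0. 0 < r \<and> r < q \<longrightarrow> z a + path (V a) r \<in> {0..c}})"
    unfolding unexited_def by blast
  also have "\<dots> \<in> sets N"
  proof (intro sets.countable_UN'' sets.Int)
    fix q
    show "{a \<in> space N. t a < q} \<in> sets N" by measurable
    have "{a \<in> space N. \<forall>r\<in>rats0. 0 < r \<and> r < q \<longrightarrow> z a + path (V a) r \<in> {0..c}}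
      = {a \<in> space N. \<forall>r\<in>{r\<in>rats0. 0 < r \<and> r < q}. z a + path (V a) r \<in> {0..c}}" by auto
    also have "\<dots> \<in> sets N"
    proof (rule sets.sets_Collect_countable_All')
      fix r
      show "{a \<in> space N. z a + path (V a) r \<in> {0..c}} \<in> sets N" by measurable
      show "countable {r \<in> rats0. 0 < r \<and> r < q}" by (rule countable_subset[of _ rats0]) auto
    qed
    finally show "{a \<in> space N. \<forall>r\<in>rats0. 0 < r \<and> r < q \<longrightarrow> z a + path (V a) r \<in> {0..c}} \<in> sets N" .
  qed simp
  finally have [measurable]: "Measurable.pred N (\<lambda>a. unexited (z a) (t a) (V a))" by (simp add: pred_def)
  have [measurable]: "(\<lambda>p. path (V (fst p)) (snd p)) \<in> borel_measurable (N \<Otimes>\<^sub>M lborel)"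
    by (rule path_measurable_compose) measurable
  have "(\<lambda>(a, v). indicator {0..t a} v *\<^sub>R \<omega> (z a + path (V a) v)) \<in> borel_measurable (N \<Otimes>\<^sub>M lborel)"
    unfolding indicator_def atLeastAtMost_iff case_prod_beta' by measurable
  then have [measurable]: "(\<lambda>a. LINT v:{0..t a}|lborel. \<omega> (z a + path (V a) v)) \<in> borel_measurable N"
    unfolding set_lebesgue_integral_def by (rule lborel.borel_measurable_lebesgue_integral)
  show ?thesis unfolding surviving_def by measurable
qed

lemma surviving_le: "surviving x t w \<le> 1"
proof -
  have "0 \<le> (LINT v:{0..t}|lborel. \<omega> (x + path w v))"
    unfolding set_lebesgue_integral_def by (intro integral_nonneg_AE) (auto simp: \<omega>_nonneg)
  then show ?thesis by (simp add: surviving_def)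
qed

text \<open>The start \<open>z\<close> is random because a Levy process starts at \<open>0\<close> only almost surely.\<close>

lemma killed_expectation_eq:
  assumes Y: "\<And>w s. w \<in> space M \<Longrightarrow> 0 \<le> s \<Longrightarrow> Y s w = z w + X s w"
    and [measurable]: "z \<in> borel_measurable M" and z: "AE w in M. z w = x" and t: "0 \<le> t"
  shows "ennreal (omega_killed_expectation M Y \<omega> c t B) = (\<integral>\<^sup>+w. surviving x t w \<partial>M)"
    and "0 \<le> omega_killed_expectation M Y \<omega> c t B"
proof -
  let ?S = "{w \<in> space M. ereal t < min (passage_below 0 (\<lambda>s. Y s w)) (passage_above c (\<lambda>s. Y s w)) \<and> Y t w \<in> B}"
  let ?h = "\<lambda>w. indicator ?S w *\<^sub>R exp (- (LINT s:{0..t}|lborel. \<omega> (Y s w)))"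
  let ?s = "\<lambda>w. surviving (z w) t w"
  have [measurable]: "?s \<in> borel_measurable M" "surviving x t \<in> borel_measurable M"
    by (rule surviving_measurable; measurable)+
  have eq: "?h w = enn2real (?s w)" if w: "w \<in> space M" for w
  proof -
    have "(LINT s:{0..t}|lborel. \<omega> (Y s w)) = (LINT s:{0..t}|lborel. \<omega> (z w + path w s))"
      unfolding set_lebesgue_integral_def
      by (intro Bochner_Integration.integral_cong) (auto simp: indicator_def Y w)
    moreover have "Y t w = z w + path w t" using t by (simp add: Y w)
    moreover have "passage_below 0 (\<lambda>s. Y s w) = passage_below 0 (\<lambda>s. started_at (z w) X s w)"
      unfolding passage_below_def started_at_def
      by (rule arg_cong[where f="\<lambda>A. INF t\<in>A. ereal t"]) (auto simp: Y w)
    moreover have "passage_above c (\<lambda>s. Y s w) = passage_above c (\<lambda>s. started_at (z w) X s w)"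
      unfolding passage_above_def started_at_def
      by (rule arg_cong[where f="\<lambda>A. INF t\<in>A. ereal t"]) (auto simp: Y w)
    ultimately have "w \<in> ?S \<longleftrightarrow> unexited (z w) t w \<and> z w + path w t \<in> B"
      using before_exit_iff[OF w t, of "z w"] w by (simp only: mem_Collect_eq simp_thms)
    with \<open>(LINT s:{0..t}|lborel. \<omega> (Y s w)) = (LINT s:{0..t}|lborel. \<omega> (z w + path w s))\<close>
    show ?thesis by (simp add: surviving_def indicator_def)
  qed
  have "omega_killed_expectation M Y \<omega> c t B = (LINT w|M. enn2real (?s w))"
    unfolding omega_killed_expectation_def set_lebesgue_integral_def[of M]
    by (intro Bochner_Integration.integral_cong eq refl)
  moreover have "ennreal (LINT w|M. enn2real (?s w)) = (\<integral>\<^sup>+w. ennreal (enn2real (?s w)) \<partial>M)"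
  proof (rule nn_integral_eq_integral[symmetric])
    show "integrable M (\<lambda>w. enn2real (?s w))"
    proof (rule integrable_const_bound[where B=1])
      show "AE w in M. norm (enn2real (?s w)) \<le> 1"
        using enn2real_mono[OF surviving_le] by (intro AE_I2) simp
    qed measurable
  qed simp
  moreover have "(\<integral>\<^sup>+w. ennreal (enn2real (?s w)) \<partial>M) = (\<integral>\<^sup>+w. surviving x t w \<partial>M)"
  proof (rule nn_integral_cong_AE)
    show "AE w in M. ennreal (enn2real (?s w)) = surviving x t w"
      using z
    proof eventually_elim
      case (elim w)
      have "surviving x t w < top" using surviving_le by (rule le_less_trans) simp
      with elim show ?case by simp
    qed
  qed
  ultimately show "ennreal (omega_killed_expectation M Y \<omega> c t B) = (\<integral>\<^sup>+w. surviving x t w \<partial>M)"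
    "0 \<le> omega_killed_expectation M Y \<omega> c t B"
    by simp_all
qed

text \<open>At the exit time itself the path may still lie in \<open>[0, c]\<close>, so the two descriptions of survival
  differ, but for each path at no more than one time.\<close>

lemma killed_res_eq_surviving:
  assumes x: "x \<in> {0..c}"
  shows "killed_res x = (\<integral>\<^sup>+t\<in>{0..}. (\<integral>\<^sup>+w. surviving x t w \<partial>M) \<partial>lborel)"
proof -
  interpret LM: pair_sigma_finite lborel M ..
  let ?I = "\<lambda>t w. INF n. fkf (rate n) indB x t (path w)"
  have [measurable]: "(\<lambda>p. fkf (rate n) indB x (fst p) (path (snd p))) \<in> borel_measurable (lborel \<Otimes>\<^sub>M M)" for n
    by (rule fkf_path_measurable) measurable
  have [measurable]: "(\<lambda>w. fkf (rate n) indB x t (path w)) \<in> borel_measurable M" for n t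
    by (rule fkf_path_measurable) measurable
  have [measurable]: "(\<lambda>p. surviving x (fst p) (snd p)) \<in> borel_measurable (lborel \<Otimes>\<^sub>M M)"
    by (rule surviving_measurable) measurable
  have [measurable]: "surviving x t \<in> borel_measurable M" for t
    by (rule surviving_measurable) measurable
  have "killed_res x = (\<integral>\<^sup>+t. (\<integral>\<^sup>+w. ?I t w * indicator {0..} t \<partial>M) \<partial>lborel)"
    unfolding killed_res_explicit[OF x] by (intro nn_integral_cong nn_integral_multc[symmetric]) measurable
  also have "\<dots> = (\<integral>\<^sup>+w. (\<integral>\<^sup>+t. ?I t w * indicator {0..} t \<partial>lborel) \<partial>M)"
  proof -
    have "(\<lambda>p. (INF n. fkf (rate n) indB x (fst p) (path (snd p))) * indicator {0..} (fst p)) \<in> borel_measurable (lborel \<Otimes>\<^sub>M M)"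
      by measurable
    from LM.Fubini[OF this] show ?thesis by simp
  qed
  also have "\<dots> = (\<integral>\<^sup>+w. (\<integral>\<^sup>+t. surviving x t w * indicator {0..} t \<partial>lborel) \<partial>M)"
  proof (rule nn_integral_cong, rule nn_integral_cong_AE)
    fix w assume w: "w \<in> space M"
    let ?in = "\<lambda>t. \<forall>v\<in>{0..<t}. x + X v w \<in> {0..c}"
    \<comment> \<open>If s < t were both in E, then a rational q in (s, t) would witness
      \<open>unexited x s w\<close>, since the path stays in [0, c] before t.\<close>
    define E where "E = {t. 0 \<le> t \<and> ?in t \<and> \<not> unexited x t w}"
    have "s = t" if "s \<in> E" "t \<in> E" for s t
    proof (rule ccontr)
      assume "s \<noteq> t"
      moreover have "unexited x a w" if "a < b" "0 \<le> a" "?in b" for a b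
      proof -
        obtain q where q: "q \<in> \<rat>" "a < q" "q < b" using Rats_dense_in_real[OF \<open>a < b\<close>] by blast
        then show ?thesis using that unfolding unexited_def by (intro bexI[of _ q]) (auto simp: rats0_def)
      qed
      moreover have "s < t \<or> t < s" using \<open>s \<noteq> t\<close> by linarith
      ultimately show False using that unfolding E_def by blast
    qed
    then have "E \<subseteq> {SOME t. t \<in> E}" by (auto intro: someI2)
    then have "AE t in lborel. t \<notin> E"
      using AE_lborel_singleton[of "SOME t. t \<in> E"] by (rule_tac eventually_mono) auto
    then show "AE t in lborel. ?I t w * indicator {0..} t = surviving x t w * indicator {0..} t"
    proof eventually_elim
      case (elim t)
      show ?case
      proof (cases "0 \<le> t")
        case t: True
        \<comment> \<open>\<open>unexited\<close> speaks of positive times only, as the passage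
          times do; at time 0 the value is x, which lies in [0, c].\<close>
        have imp: "?in t" if "unexited x t w"
          using unexited_imp[OF w that] X_start[OF w] x by (force simp: less_le)
        have "?in t \<longleftrightarrow> unexited x t w" using imp elim t by (auto simp: E_def)
        then show ?thesis
          using t fkf_limit[OF w t, of x] set_lebesgue_integral_cong[of "{0..t}" lborel "\<lambda>v. \<omega> (x + X v w)" "\<lambda>v. \<omega> (x + path w v)"]
          by (simp add: surviving_def indicator_def)
      qed simp
    qed
  qed
  also have "\<dots> = (\<integral>\<^sup>+t. (\<integral>\<^sup>+w. surviving x t w * indicator {0..} t \<partial>M) \<partial>lborel)"
  proof -
    have "(\<lambda>p. surviving x (fst p) (snd p) * indicator {0..} (fst p)) \<in> borel_measurable (lborel \<Otimes>\<^sub>M M)"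
      by measurable
    from LM.Fubini[OF this] show ?thesis by simp
  qed
  also have "\<dots> = (\<integral>\<^sup>+t\<in>{0..}. (\<integral>\<^sup>+w. surviving x t w \<partial>M) \<partial>lborel)"
    by (intro nn_integral_cong nn_integral_multc) measurable
  finally show ?thesis .
qed

text \<open>Measurability in t is obtained from the representation as a finite nonnegative integral;
  integrability then follows from the finiteness of the killed resolvent.\<close>

lemma killed_resolvent:
  assumes x: "x \<in> {0..c}"
    and Y: "\<And>w s. w \<in> space M \<Longrightarrow> 0 \<le> s \<Longrightarrow> Y s w = z w + X s w"
    and z: "z \<in> borel_measurable M" "AE w in M. z w = x"
  shows "set_integrable lborel {0..} (\<lambda>t. omega_killed_expectation M (Y) \<omega> c t B)"
    and "(LINT t:{0..}|lborel. omega_killed_expectation M (Y) \<omega> c t B) = enn2real (killed_res x)"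
proof -
  let ?k = "\<lambda>t. indicator {0..} t *\<^sub>R omega_killed_expectation M (Y) \<omega> c t B"
  let ?K = "\<lambda>t. (\<integral>\<^sup>+w. surviving x t w \<partial>M) * indicator {0..} t"
  have K: "ennreal (?k t) = ?K t" and k0: "0 \<le> ?k t" for t
    using killed_expectation_eq[OF Y z, of t] by (auto simp: indicator_def)
  have "(\<lambda>p. surviving x (fst p) (snd p)) \<in> borel_measurable (lborel \<Otimes>\<^sub>M M)"
    by (rule surviving_measurable) measurable
  from borel_measurable_nn_integral_fst[OF this]
  have [measurable]: "(\<lambda>t. \<integral>\<^sup>+w. surviving x t w \<partial>M) \<in> borel_measurable lborel" by simp
  have "?k = (\<lambda>t. enn2real (?K t))" using K k0 by (metis enn2real_ennreal)
  then have m: "?k \<in> borel_measurable lborel" by simp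
  have nn: "(\<integral>\<^sup>+t. ennreal (?k t) \<partial>lborel) = killed_res x" unfolding K killed_res_eq_surviving[OF x] ..
  have fin: "killed_res x < \<infinity>" using killed_res_le[OF x] by (rule le_less_trans) simp
  have int: "integrable lborel ?k"
    by (rule integrableI_nonneg[OF m]) (use k0 nn fin in auto)
  then show "set_integrable lborel {0..} (\<lambda>t. omega_killed_expectation M (Y) \<omega> c t B)"
    by (simp add: set_integrable_def)
  show "(LINT t:{0..}|lborel. omega_killed_expectation M (Y) \<omega> c t B) = enn2real (killed_res x)"
    unfolding set_lebesgue_integral_def nn[symmetric] using m k0 by (intro integral_eq_nn_integral) auto
qed

text \<open>\<open>\<W>\<close> is the resolvent kernel for \<open>kernel\<close> and
  \<open>g\<close>, so \<open>V.solution\<close> expresses the killed resolvent up to \<kappa>. The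
  vanishing at c determines \<kappa>, where \<open>\<W> c 0\<close> is positive because it is at
  least W(c).\<close>

theorem killed_resolvent_density:
  assumes scale: "is_omega_scale_function W \<omega> \<W>" and x: "x \<in> {0..c}"
  shows "set_integrable lborel B (\<lambda>y. \<W> x 0 / \<W> c 0 * \<W> c y - \<W> x y)"
    and "enn2real (killed_res x) = (LINT y:B|lborel. \<W> x 0 / \<W> c 0 * \<W> c y - \<W> x y)"
proof -
  have sc: "(\<lambda>x. \<W> x y) \<in> borel_measurable borel" "locally_bounded (\<lambda>x. \<W> x y)"
    "\<W> x y = W (x - y) + (LBINT z=y..x. W (x - z) * \<omega> z * \<W> z y)" for x y
    using scale unfolding is_omega_scale_function_def by blast+
  \<comment> \<open>For z < y the oriented integral runs backwards over s in [z, y], where W(z - s)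
    vanishes except possibly at s = z.\<close>
  have zero: "\<W> z y = 0" if "z < y" for z y
  proof -
    have "(LBINT s=y..z. W (z - s) * \<omega> s * \<W> s y) = - (LBINT s=z..y. W (z - s) * \<omega> s * \<W> s y)"
      by (rule interval_integral_endpoints_reverse)
    also have "(LBINT s=z..y. W (z - s) * \<omega> s * \<W> s y) = (LBINT s:{z..y}. W (z - s) * \<omega> s * \<W> s y)"
      using that by (intro interval_integral_Icc) simp
    also have "\<dots> = 0"
      unfolding set_lebesgue_integral_def
      by (intro integral_eq_zero_AE eventually_mono[OF AE_lborel_singleton[of z]]) (auto simp: indicator_def W_neg)
    finally show ?thesis using sc(3)[of z y] that W_neg[of "z - y"] by simp
  qed
  interpret V: volterra_resolvent kernel "W c * K" c g \<W> "W c"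
  proof
    show "case_prod kernel \<in> borel_measurable (borel \<Otimes>\<^sub>M borel)" by (rule kernel_measurable)
    show "kernel x z = 0" if "z \<notin> {0..x}" for x z using that by (auto simp: kernel_def)
    show "case_prod g \<in> borel_measurable (borel \<Otimes>\<^sub>M borel)" by (rule g_measurable')
    show "\<exists>C. \<forall>x\<in>{0..c}. \<bar>\<W> x y\<bar> \<le> C" for y
    proof -
      have "bounded ((\<lambda>x. \<W> x y) ` {0..c})" using sc(2)[of y] by (simp add: locally_bounded_def)
      then show ?thesis by (auto simp: bounded_iff)
    qed
    fix x y assume x: "x \<in> {0..c}" and y: "y \<in> {0..c}"
    show "\<W> x y = g x y + (LINT z|lborel. kernel x z * \<W> z y)"
    proof (cases "y \<le> x")
      case True
      have "(LBINT z=y..x. W (x - z) * \<omega> z * \<W> z y) = (LBINT z:{y..x}. W (x - z) * \<omega> z * \<W> z y)"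
        using True by (rule interval_integral_Icc)
      also have "\<dots> = (LINT z|lborel. kernel x z * \<W> z y)"
        unfolding set_lebesgue_integral_def
      proof (rule Bochner_Integration.integral_cong)
        fix z
        show "indicator {y..x} z *\<^sub>R (W (x - z) * \<omega> z * \<W> z y) = kernel x z * \<W> z y"
          using x y zero[of z y] by (cases "z < y") (auto simp: kernel_def indicator_def)
      qed simp
      finally show ?thesis using sc(3)[of x y] True x y by (simp add: g_def)
    next
      case False
      have "kernel x z * \<W> z y = 0" for z using False zero[of z y] by (cases "z < y") (auto simp: kernel_def)
      then have "(\<lambda>z. kernel x z * \<W> z y) = (\<lambda>_. 0)" by (rule ext)
      then have "(LINT z|lborel. kernel x z * \<W> z y) = 0" by (simp only: Bochner_Integration.integral_zero)
      then show ?thesis using False zero[of x y] by (simp add: g_def)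
    qed
  qed (use kernel_bounds g_bounds sc(1) in auto)
  obtain \<kappa> where \<kappa>: "\<And>x. x \<in> {0..c} \<Longrightarrow>
    enn2real (killed_res x) = \<kappa> * g x 0 - (LINT y|lborel. indicator B y * g x y) + (LINT z|lborel. kernel x z * enn2real (killed_res z))"
    using killed_res_equation by blast
  have sol: "enn2real (killed_res x) = \<kappa> * \<W> x 0 - (LINT y|lborel. indicator B y * \<W> x y)" if "x \<in> {0..c}" for x
  proof (rule V.solution[where \<phi>="\<lambda>x. enn2real (killed_res x)" and C="W c * c"])
    show "\<bar>enn2real (killed_res x)\<bar> \<le> W c * c" if "x \<in> {0..c}" for x
      using enn2real_mono[OF killed_res_le[OF that]] W_nonneg[of c] c_pos by simp
  qed (use B_subset \<kappa> that in auto)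
  have c_in: "c \<in> {0..c}" and zero_in: "0 \<in> {0..c}" using c_pos by auto
  have "0 < W c" by (rule W_pos[OF c_pos])
  also have "W c = g c 0" using c_pos by (simp add: g_def)
  also have "\<dots> \<le> \<W> c 0" by (rule V.R_bounds[OF c_in zero_in])
  finally have pos: "0 < \<W> c 0" .
  \<comment> \<open>Measurability of \<open>\<W>\<close> in its second variable is borrowed from
    \<open>V.R_joint\<close>, with which it agrees on the square.\<close>
  have int: "integrable lborel (\<lambda>y. indicator B y * \<W> x y)" if x: "x \<in> {0..c}" for x
  proof -
    have "integrable lborel (\<lambda>y. indicator B y * V.R_joint x y)"
      by (rule V.set_integrable_bounded_Icc[OF _ B B_subset V.R_joint_bounds(2)]) measurable
    moreover have "indicator B y * V.R_joint x y = indicator B y * \<W> x y" for y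
      by (cases "y \<in> B") (use V.R_joint_eq[OF x, of y] B_subset in auto)
    ultimately show ?thesis by simp
  qed
  let ?d = "\<lambda>y. \<W> x 0 / \<W> c 0 * \<W> c y - \<W> x y"
  have eq: "(\<lambda>y. indicator B y *\<^sub>R ?d y) = (\<lambda>y. \<W> x 0 / \<W> c 0 * (indicator B y * \<W> c y) - indicator B y * \<W> x y)"
    by (auto simp: indicator_def)
  show "set_integrable lborel B ?d"
    unfolding set_integrable_def eq using int[OF c_in] int[OF x] by simp
  have "\<kappa> * \<W> c 0 = (LINT y|lborel. indicator B y * \<W> c y)"
    using sol[OF c_in] killed_res_at_c by simp
  then have "\<kappa> = (LINT y|lborel. indicator B y * \<W> c y) / \<W> c 0" using pos by (simp add: field_simps)
  moreover have "(LINT y:B|lborel. ?d y) = \<W> x 0 / \<W> c 0 * (LINT y|lborel. indicator B y * \<W> c y) - (LINT y|lborel. indicator B y * \<W> x y)"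
    unfolding set_lebesgue_integral_def eq using int[OF c_in] int[OF x] by simp
  ultimately show "enn2real (killed_res x) = (LINT y:B|lborel. ?d y)"
    using sol[OF x] by simp
qed

end

section \<open>Reduction to a process that starts at zero at every sample point\<close>

theorem theorem2p2:
  fixes M :: "'a measure" and X :: "real \<Rightarrow> 'a \<Rightarrow> real"
    and \<psi> W \<omega> :: "real \<Rightarrow> real" and \<W> :: "real \<Rightarrow> real \<Rightarrow> real"
    and c x :: real and B :: "real set"
  assumes "spectrally_negative_levy_process M X"
    and "is_laplace_exponent M X \<psi>"
    and "is_scale_function \<psi> 0 W"
    and "\<omega> \<in> borel_measurable borel" and "\<And>z. 0 \<le> \<omega> z" and "locally_bounded \<omega>"
    and "is_omega_scale_function W \<omega> \<W>"
    and "0 < c" and "x \<in> {0..c}"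
    and "B \<in> sets borel" and "B \<subseteq> {0..c}"
  shows "set_integrable lborel {0..}
           (\<lambda>t. omega_killed_expectation M (started_at x X) \<omega> c t B) \<and>
         set_integrable lborel B (\<lambda>y. \<W> x 0 / \<W> c 0 * \<W> c y - \<W> x y) \<and>
         (LINT t:{0..}|lborel. omega_killed_expectation M (started_at x X) \<omega> c t B) =
         (LINT y:B|lborel. \<W> x 0 / \<W> c 0 * \<W> c y - \<W> x y)"
proof -
  interpret S: spectrally_negative_levy_process M X by (rule assms(1))
  have [measurable]: "X 0 \<in> borel_measurable M" by (rule S.random_variable_X) simp
  \<comment> \<open>Subtracting \<open>X 0\<close> alters paths on a null set only and leaves all
    increments unchanged, so \<open>X'\<close> has the law of X and starts at 0 everywhere.\<close>
  define X' where "X' t w = X t w - X 0 w" for t w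
  have [measurable]: "X' t \<in> borel_measurable M" if "0 \<le> t" for t
    unfolding X'_def using S.random_variable_X[OF that] by measurable
  have AE_eq: "AE w in M. \<forall>t. X' t w = X t w"
    using S.X_zero by eventually_elim (simp add: X'_def)
  have X'_incr: "X' s w - X' t w = X s w - X t w" for s t w by (simp add: X'_def)
  have levy: "levy_process M X'"
  proof
    show "AE w in M. X' 0 w = 0" by (simp add: X'_def)
    show "cadlag (\<lambda>t. X' t w)" if "w \<in> space M" for w
    proof -
      note cadlag = S.cadlag_paths[OF that, unfolded cadlag_def]
      show ?thesis
        unfolding cadlag_def X'_def
      proof (intro conjI allI impI)
        fix t :: real assume "0 \<le> t"
        then show "((\<lambda>t. X t w - X 0 w) \<longlongrightarrow> X t w - X 0 w) (at_right t)"
          using cadlag by (intro tendsto_diff tendsto_const) blast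
      next
        fix t :: real assume "0 < t"
        then obtain l where "((\<lambda>t. X t w) \<longlongrightarrow> l) (at_left t)" using cadlag by blast
        then show "\<exists>l. ((\<lambda>t. X t w - X 0 w) \<longlongrightarrow> l) (at_left t)"
          by (intro exI[of _ "l - X 0 w"] tendsto_diff tendsto_const)
      qed
    qed
    show "S.indep_vars (\<lambda>_. borel) (\<lambda>i w. X' (t (Suc i)) w - X' (t i) w) {..<n}"
      if "0 \<le> t 0" "\<And>i. i < n \<Longrightarrow> t i \<le> t (Suc i)" for t :: "nat \<Rightarrow> real" and n
      unfolding X'_incr by (rule S.independent_increments[OF that])
    show "distr M borel (\<lambda>w. X' (s + t) w - X' s w) = distr M borel (X' t)" if "0 \<le> s" "0 \<le> t" for s t
    proof -
      have "distr M borel (X' t) = distr M borel (X t)"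
        using AE_eq S.random_variable_X[OF that(2)] that
        by (intro distr_cong_AE) (auto elim: eventually_mono)
      then show ?thesis unfolding X'_incr using S.stationary_increments[OF that] by simp
    qed
  qed simp
  obtain K where K: "\<And>z. z \<in> {0..c} \<Longrightarrow> \<omega> z \<le> K"
  proof -
    have "bounded (\<omega> ` {0..c})" using assms(6) by (simp add: locally_bounded_def)
    then obtain a where "\<forall>x\<in>{0..c}. norm (\<omega> x) \<le> a" by (auto simp: bounded_iff)
    then show ?thesis by (intro that[of a]) (auto simp: abs_le_iff)
  qed
  have "killed_snlp M X' \<psi> W \<omega> c K B"
  proof (intro killed_snlp.intro snlp_scale.intro snlp_from_zero.intro levy_process_from_zero.intro levy
      levy_process_from_zero_axioms.intro snlp_from_zero_axioms.intro snlp_scale_axioms.intro killed_snlp_axioms.intro)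
    show "X' 0 w = 0" for w by (simp add: X'_def)
    show "AE w in M. no_positive_jumps (\<lambda>t. X' t w)"
      using S.AE_no_positive_jumps AE_eq by eventually_elim simp
    show "\<not> (AE w in M. \<forall>s t. 0 \<le> s \<longrightarrow> s \<le> t \<longrightarrow> X' t w \<le> X' s w)"
      using S.not_negative_subordinator by (simp add: X'_def)
    have "(LINT w|M. exp (\<theta> * X' t w)) = (LINT w|M. exp (\<theta> * X t w))" if t: "0 \<le> t" for t \<theta>
    proof -
      note [measurable] = S.random_variable_X[OF t]
      have "AE w in M. exp (\<theta> * X' t w) = exp (\<theta> * X t w)"
        using AE_eq by eventually_elim simp
      then show ?thesis using t by (intro Bochner_Integration.integral_cong_AE) auto
    qed
    then show "is_laplace_exponent M X' \<psi>" using assms(2) by (simp add: is_laplace_exponent_def)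
    show "is_scale_function \<psi> 0 W" "\<omega> \<in> borel_measurable borel" "\<And>z. 0 \<le> \<omega> z" "0 < c" "B \<in> sets borel" "B \<subseteq> {0..c}"
      by (fact assms)+
    show "\<And>z. z \<in> {0..c} \<Longrightarrow> \<omega> z \<le> K" by (rule K)
  qed
  then interpret Q: killed_snlp M X' \<psi> W \<omega> c K B .
  \<comment> \<open>The subtracted \<open>X 0\<close> returns as a random starting point that equals
    x almost surely.\<close>
  have start: "started_at x X s w = (x + X 0 w) + X' s w" for s w
    by (simp add: started_at_def X'_def)
  have "AE w in M. x + X 0 w = x" using S.X_zero by eventually_elim simp
  then have "set_integrable lborel {0..} (\<lambda>t. omega_killed_expectation M (started_at x X) \<omega> c t B)"
    "(LINT t:{0..}|lborel. omega_killed_expectation M (started_at x X) \<omega> c t B) = enn2real (Q.killed_res x)"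
    by (intro Q.killed_resolvent[where z="\<lambda>w. x + X 0 w", OF assms(9) start]; measurable)+
  then show ?thesis
    using Q.killed_resolvent_density[OF assms(7,9)] by simp
qed

end
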